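(* Let $1\le p<\infty$ and let $K:\mathbb Z\times\mathbb Z\to\mathbb C$ be a function satisfying $$\sum_{j\in\mathbb Z}\Big(\sum_{m\in\mathbb Z}|K(j,m)|^p\Big)^{1/p}<\infty .$$ Then the relation $K(i,j)=\langle Te_j,e_i\rangle$, $(i,j)\in\mathbb Z\times\mathbb Z$, defines a nuclear operator $T:\ell^p(\mathbb Z)\to\ell^p(\mathbb Z)$. Moreover, one has $$\operatorname{Det}(I+\lambda T)=\exp\left(\sum_{m=1}^\infty\frac{(-1)^{m+1}}{m}\lambda^m\sum_{\substack{(j_0,j_1,\dots,j_m)\in\mathbb Z^{m+1}\\ j_0=j_m}}\ \prod_{s=1}^mK(j_{s-1},j_s)\right)$$ for $\lambda$ in a sufficiently small disc centered at $0$ in $\mathbb C$.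
   Context: $e_j\in\ell^p(\mathbb Z)$ is the standard basis vector, $e_j(i)=\delta_{ij}$, and $\langle f,e_i\rangle=f(i)$; so $T$ is given by $Tf(i)=\sum_jK(i,j)f(j)$. A linear operator $T$ on a Banach space $\mathcal B$ is nuclear if there are sequences $x_n'\in\mathcal B'$, $y_n\in\mathcal B$ with $Tx=\sum_n\langle x,x_n'\rangle y_n$ and $\sum_n\|x_n'\|_{\mathcal B'}\|y_n\|_{\mathcal B}<\infty$. The nuclear operators form an ideal $\mathcal N(\mathcal B)$ with norm $N(T)$ equal to the infimum of $\sum_n\|x_n'\|_{\mathcal B'}\|y_n\|_{\mathcal B}$ over all such representations. For a finite rank operator $F$ on $\mathcal B$, choose $\mathcal B=M\oplus N$ with $\dim M<\infty$, $F(M)\subset M$, $N\subset\ker F$, and set $\operatorname{Det}(I+F)=\det(I+F|_M)$ (independent of choices). The space $\mathcal B=\ell^p(\mathbb Z)$ has the approximation property; finite rank operators are dense in $\mathcal N(\mathcal B)$ for the norm $N$, and $F\mapsto\operatorname{Det}(I+F)$ extends continuously in this norm to $\mathcal N(\mathcal B)$. The value of the extension at $T\in\mathcal N(\mathcal B)$ is $\operatorname{Det}(I+T)$; this is the determinant in the claim.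
   Formalization: For p>2 the printed condition fails: K(0,m)=m^{-1/2} (m≥1), K=0 elsewhere, gives an unbounded T. It is assumed as printed only for p≤2; alternatively, for all 1≤p<∞, the condition with the indices of K exchanged, sum_j (sum_m |K(m,j)|^p)^{1/p}<∞, is assumed. *)

theory Defs
  imports
    Complex_Main
    "HOL-Library.FuncSet"
    "HOL-Library.Function_Algebras"
    "HOL-Analysis.Infinite_Sum"
    "Jordan_Normal_Form.Determinant"
begin

section \<open>Normed spaces of complex-valued functions\<close>

text \<open>
  The exponent of \<open>\<ell>\<^sup>p\<close> is a real variable, so \<open>\<ell>\<^sup>p\<close> is not a type. A Banach space is represented
  by a subspace \<open>V\<close> of \<open>'i \<Rightarrow> complex\<close> (pointwise operations, from HOL-Library) and a norm
  \<open>N\<close> on it. Operators and functionals are total functions; only their values on \<open>V\<close> matter.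
\<close>

definition cscale :: "complex \<Rightarrow> ('i \<Rightarrow> complex) \<Rightarrow> ('i \<Rightarrow> complex)"
  where "cscale c f = (\<lambda>i. c * f i)"

interpretation cfun: vector_space "cscale :: complex \<Rightarrow> ('i \<Rightarrow> complex) \<Rightarrow> ('i \<Rightarrow> complex)"
  by unfold_locales (auto simp: cscale_def fun_eq_iff algebra_simps)

definition lp :: "real \<Rightarrow> ('i \<Rightarrow> complex) set"
  where "lp p = {f. (\<lambda>i. cmod (f i) powr p) summable_on UNIV}"

definition lp_norm :: "real \<Rightarrow> ('i \<Rightarrow> complex) \<Rightarrow> real"
  where "lp_norm p f = (\<Sum>\<^sub>\<infinity>i. cmod (f i) powr p) powr (1 / p)"

definition unit_seq :: "'i \<Rightarrow> ('i \<Rightarrow> complex)"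
  where "unit_seq j = (\<lambda>i. if i = j then 1 else 0)"

definition linear_op_on ::
  "('i \<Rightarrow> complex) set \<Rightarrow> (('i \<Rightarrow> complex) \<Rightarrow> ('i \<Rightarrow> complex)) \<Rightarrow> bool"
  where "linear_op_on V T \<longleftrightarrow>
    (\<forall>x\<in>V. T x \<in> V) \<and>
    (\<forall>x\<in>V. \<forall>y\<in>V. T (x + y) = T x + T y) \<and>
    (\<forall>c. \<forall>x\<in>V. T (cscale c x) = cscale c (T x))"

definition dual_space ::
  "('i \<Rightarrow> complex) set \<Rightarrow> (('i \<Rightarrow> complex) \<Rightarrow> real) \<Rightarrow> (('i \<Rightarrow> complex) \<Rightarrow> complex) set"
  where "dual_space V N = {\<phi>.
    (\<forall>x\<in>V. \<forall>y\<in>V. \<phi> (x + y) = \<phi> x + \<phi> y) \<and>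
    (\<forall>c. \<forall>x\<in>V. \<phi> (cscale c x) = c * \<phi> x) \<and>
    (\<exists>C. \<forall>x\<in>V. cmod (\<phi> x) \<le> C * N x)}"

definition dual_norm ::
  "('i \<Rightarrow> complex) set \<Rightarrow> (('i \<Rightarrow> complex) \<Rightarrow> real) \<Rightarrow> (('i \<Rightarrow> complex) \<Rightarrow> complex) \<Rightarrow> real"
  where "dual_norm V N \<phi> = (SUP x\<in>{x\<in>V. N x \<le> 1}. cmod (\<phi> x))"


section \<open>Nuclear operators\<close>

definition nuclear_rep ::
  "('i \<Rightarrow> complex) set \<Rightarrow> (('i \<Rightarrow> complex) \<Rightarrow> real) \<Rightarrow> (('i \<Rightarrow> complex) \<Rightarrow> ('i \<Rightarrow> complex))
    \<Rightarrow> (nat \<Rightarrow> ('i \<Rightarrow> complex) \<Rightarrow> complex) \<Rightarrow> (nat \<Rightarrow> 'i \<Rightarrow> complex) \<Rightarrow> bool"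
  where "nuclear_rep V N T \<phi> y \<longleftrightarrow>
    (\<forall>n. \<phi> n \<in> dual_space V N) \<and> (\<forall>n. y n \<in> V) \<and>
    summable (\<lambda>n. dual_norm V N (\<phi> n) * N (y n)) \<and>
    (\<forall>x\<in>V. (\<lambda>k. N (T x - (\<Sum>n<k. cscale (\<phi> n x) (y n)))) \<longlonglongrightarrow> 0)"

definition nuclear_on ::
  "('i \<Rightarrow> complex) set \<Rightarrow> (('i \<Rightarrow> complex) \<Rightarrow> real) \<Rightarrow> (('i \<Rightarrow> complex) \<Rightarrow> ('i \<Rightarrow> complex)) \<Rightarrow> bool"
  where "nuclear_on V N T \<longleftrightarrow> linear_op_on V T \<and> (\<exists>\<phi> y. nuclear_rep V N T \<phi> y)"

text \<open>Meaningful for nuclear operators only: the infimum of the empty set is unspecified.\<close>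

definition nuclear_norm ::
  "('i \<Rightarrow> complex) set \<Rightarrow> (('i \<Rightarrow> complex) \<Rightarrow> real) \<Rightarrow> (('i \<Rightarrow> complex) \<Rightarrow> ('i \<Rightarrow> complex)) \<Rightarrow> real"
  where "nuclear_norm V N T =
    Inf {\<Sum>n. dual_norm V N (\<phi> n) * N (y n) | \<phi> y. nuclear_rep V N T \<phi> y}"


section \<open>Determinants\<close>

text \<open>Bounded operators of finite rank.\<close>

definition finite_rank_on ::
  "('i \<Rightarrow> complex) set \<Rightarrow> (('i \<Rightarrow> complex) \<Rightarrow> real) \<Rightarrow> (('i \<Rightarrow> complex) \<Rightarrow> ('i \<Rightarrow> complex)) \<Rightarrow> bool"
  where "finite_rank_on V N F \<longleftrightarrow>
    linear_op_on V F \<and> (\<exists>C. \<forall>x\<in>V. N (F x) \<le> C * N x) \<and>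
    (\<exists>S. finite S \<and> F ` V \<subseteq> cfun.span S)"

text \<open>
  Determinant of an endomorphism \<open>G\<close> of a finite-dimensional space \<open>M\<close>: the determinant of its
  matrix \<open>A\<close> in any basis \<open>b 0, \<dots>, b (n - 1)\<close> of \<open>M\<close>.
\<close>

definition endo_det ::
  "('i \<Rightarrow> complex) set \<Rightarrow> (('i \<Rightarrow> complex) \<Rightarrow> ('i \<Rightarrow> complex)) \<Rightarrow> complex"
  where "endo_det M G = (THE d. \<exists>n b A.
    inj_on b {..<n} \<and> cfun.independent (b ` {..<n}) \<and> cfun.span (b ` {..<n}) = M \<and>
    A \<in> carrier_mat n n \<and>
    (\<forall>j<n. G (b j) = (\<Sum>i<n. cscale (A $$ (i, j)) (b i))) \<and>
    d = Determinant.det A)"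

text \<open>\<open>Det (I + F)\<close> for \<open>F\<close> of finite rank, via a decomposition \<open>V = M \<oplus> W\<close>.\<close>

definition finite_rank_det ::
  "('i \<Rightarrow> complex) set \<Rightarrow> (('i \<Rightarrow> complex) \<Rightarrow> ('i \<Rightarrow> complex)) \<Rightarrow> complex"
  where "finite_rank_det V F = (THE d. \<exists>M W.
    cfun.subspace M \<and> cfun.subspace W \<and> M \<inter> W = {0} \<and> {u + w | u w. u \<in> M \<and> w \<in> W} = V \<and>
    (\<exists>S. finite S \<and> cfun.span S = M) \<and> F ` M \<subseteq> M \<and> (\<forall>w\<in>W. F w = 0) \<and>
    d = endo_det M (\<lambda>x. x + F x))"

text \<open>
  \<open>Det (I + T)\<close>: the continuous extension of \<open>finite_rank_det\<close> to nuclear operators, that is, its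
  limit as \<open>F\<close> of finite rank tends to \<open>T\<close> in the nuclear norm.
\<close>

definition finite_rank_approx ::
  "('i \<Rightarrow> complex) set \<Rightarrow> (('i \<Rightarrow> complex) \<Rightarrow> real) \<Rightarrow> (('i \<Rightarrow> complex) \<Rightarrow> ('i \<Rightarrow> complex))
    \<Rightarrow> (('i \<Rightarrow> complex) \<Rightarrow> ('i \<Rightarrow> complex)) filter"
  where "finite_rank_approx V N T =
    (INF e\<in>{0<..}. principal {F. finite_rank_on V N F \<and> nuclear_norm V N (F - T) < e})"

definition nuclear_det ::
  "('i \<Rightarrow> complex) set \<Rightarrow> (('i \<Rightarrow> complex) \<Rightarrow> real) \<Rightarrow> (('i \<Rightarrow> complex) \<Rightarrow> ('i \<Rightarrow> complex)) \<Rightarrow> complex"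
  where "nuclear_det V N T = Lim (finite_rank_approx V N T) (finite_rank_det V)"


section \<open>Conditions on and sums over the kernel\<close>

definition row_summable :: "real \<Rightarrow> (int \<Rightarrow> int \<Rightarrow> complex) \<Rightarrow> bool"
  where "row_summable p K \<longleftrightarrow>
    (\<forall>j. (\<lambda>m. K j m) \<in> lp p) \<and> (\<lambda>j. lp_norm p (\<lambda>m. K j m)) summable_on UNIV"

text \<open>
  For \<open>p > 2\<close>, \<open>row_summable p K\<close> does not make \<open>K i j = T (unit_seq j) i\<close> a bounded operator on
  \<open>\<ell>\<^sup>p\<close>: take \<open>K 0 m = m powr (-1/2)\<close> for \<open>m \<ge> 1\<close> and \<open>K i j = 0\<close> otherwise; this row is in
  \<open>\<ell>\<^sup>p\<close> but not in the dual of \<open>\<ell>\<^sup>p\<close>. The same condition on the columns of \<open>K\<close>, which are the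
  vectors \<open>T (unit_seq j)\<close>, is the one that works for all \<open>p \<ge> 1\<close>.
\<close>

definition col_summable :: "real \<Rightarrow> (int \<Rightarrow> int \<Rightarrow> complex) \<Rightarrow> bool"
  where "col_summable p K \<longleftrightarrow> row_summable p (\<lambda>i j. K j i)"

text \<open>Index tuples \<open>(j\<^sub>0, \<dots>, j\<^sub>m)\<close> with \<open>j\<^sub>0 = j\<^sub>m\<close>, as functions on \<open>{0..m}\<close>.\<close>

definition closed_tuples :: "nat \<Rightarrow> (nat \<Rightarrow> int) set"
  where "closed_tuples m = {j \<in> {0..m} \<rightarrow>\<^sub>E UNIV. j 0 = j m}"

end

theory Submission
  imports
    "HOL-Analysis.Complex_Transcendental"
    "HOL-Library.Nat_Bijection"
    "Jordan_Normal_Form.Schur_Decomposition"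
    Defs
begin

text \<open>
  All determinants are compared through their finite sections \<open>det (I + P\<^sub>k G P\<^sub>k)\<close>, where \<open>P\<^sub>k\<close>
  restricts a sequence to its first \<open>k\<close> coordinates.

  For \<open>F = \<Sum> \<psi>\<^sub>i \<otimes> b\<^sub>i\<close> of finite rank, \<open>det (I + A B) = det (I + B A)\<close> turns the section into the
  determinant of \<open>\<delta>\<^sub>i\<^sub>j + \<psi>\<^sub>i (P\<^sub>k b\<^sub>j)\<close>, which converges to \<open>Det (I + F)\<close> because \<open>P\<^sub>k b\<^sub>j\<close> tends to
  \<open>b\<^sub>j\<close> in norm. Adding a rank-one term \<open>\<phi> \<otimes> y\<close> to an operator of norm at most \<open>q < 1\<close> multiplies
  each section by a factor \<open>1 + a\<close> with \<open>\<bar>a\<bar> \<le> \<parallel>\<phi>\<parallel> \<parallel>y\<parallel> / (1 - q)\<close>. Hence two operators that are close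
  in the nuclear norm have close sections, uniformly in \<open>k\<close>, and \<open>Det (I + \<lambda> T)\<close> is the limit of the
  sections of \<open>\<lambda> T\<close>. By the Schur decomposition, a section of \<open>\<lambda> T\<close> is the exponential of the
  series of traces of its powers. These traces are sums over closed walks in a finite set of
  indices, and Tannery's theorem gives the limit.
\<close>

section \<open>The spaces of \<open>p\<close>-summable functions\<close>

text \<open>The matrices grow with \<open>k\<close>, so an entrywise comparison of two sections
  degrades as \<open>k\<close> increases; the estimates have to see operator norms only. This works
  because truncation is a contraction of \<open>lp p\<close>: if \<open>G\<close> has norm at most
  \<open>q < 1\<close>, the section of \<open>I + G\<close> is bounded below by \<open>1 - q\<close>
  in the norm of \<open>lp p\<close>, for every \<open>k\<close>. Errors come out relative to the
  section of \<lambda> T itself, whose convergence the trace series supplies, so no a priori bound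
  on determinants enters. The terms added are those of a representation of F - \<lambda> T, so all
  intermediate operators stay near \<lambda> T and inherit its small norm. Thus \<lambda> is small
  for two reasons: invertibility along this path, and convergence of the logarithm series, uniformly
  in \<open>k\<close>. Truncations converge to the identity only strongly; for p = 1 a functional
  composed with them need not converge in the dual norm. The limit for finite rank therefore lets
  truncation act on the vectors and not on the functionals.\<close>

lemma powr_convex_nonneg:
  fixes p t u v :: real
  assumes p: "1 \<le> p" and t: "0 \<le> t" "t \<le> 1" and u: "0 \<le> u" and v: "0 \<le> v"
  shows "(t * u + (1 - t) * v) powr p \<le> t * u powr p + (1 - t) * v powr p"
proof -
  \<comment> \<open>With \<open>u = 0\<close> or \<open>v = 0\<close> convexity reduces to
    \<open>s powr p \<le> s\<close> on the unit interval.\<close>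
  have one: "(s * w) powr p \<le> s * w powr p" if "0 \<le> s" "s \<le> 1" "0 \<le> w" for s w :: real
  proof -
    have "s powr p \<le> s"
      using powr_mono'[of 1 p s] that p by (cases "s = 0") auto
    then show ?thesis
      using that by (simp add: powr_mult mult_right_mono)
  qed
  consider "u = 0" | "v = 0" | "u > 0" "v > 0" using u v by linarith
  then show ?thesis
  proof cases
    case 1
    then show ?thesis using one[of "1 - t" v] t v p by simp
  next
    case 2
    then show ?thesis using one[of t u] t u p by simp
  next
    case 3
    then show ?thesis
      using convex_onD[OF powr_convex[OF p], of "1 - t" u v] t by simp
  qed
qed

lemma lp_norm_nonneg [simp]: "0 \<le> lp_norm p f"
  by (simp add: lp_norm_def)

lemma lp_norm_powr:
  assumes "1 \<le> p"
  shows "lp_norm p f powr p = (\<Sum>\<^sub>\<infinity>i. cmod (f i) powr p)"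
proof -
  have "0 \<le> (\<Sum>\<^sub>\<infinity>i. cmod (f i) powr p)" by (rule infsum_nonneg) simp
  then show ?thesis using assms by (simp add: lp_norm_def powr_powr)
qed

text \<open>Membership and norm bound are tested together on finite sums, so later estimates in
  \<open>lp p\<close> carry no separate summability argument.\<close>

lemma lp_bound_iff:
  assumes p: "1 \<le> p" and B: "0 \<le> B"
  shows "f \<in> lp p \<and> lp_norm p f \<le> B \<longleftrightarrow>
    (\<forall>S. finite S \<longrightarrow> (\<Sum>i\<in>S. cmod (f i) powr p) \<le> B powr p)"
proof safe
  fix S :: "'a set"
  assume f: "f \<in> lp p" "lp_norm p f \<le> B" and S: "finite S"
  have "(\<Sum>i\<in>S. cmod (f i) powr p) \<le> lp_norm p f powr p"
    unfolding lp_norm_powr[OF p]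
    using f(1) S by (intro finite_sum_le_infsum) (auto simp: lp_def)
  also have "\<dots> \<le> B powr p"
    using f(2) p by (intro powr_mono2) auto
  finally show "(\<Sum>i\<in>S. cmod (f i) powr p) \<le> B powr p" .
next
  assume *: "\<forall>S. finite S \<longrightarrow> (\<Sum>i\<in>S. cmod (f i) powr p) \<le> B powr p"
  have sm: "(\<lambda>i. cmod (f i) powr p) summable_on UNIV"
    by (rule nonneg_bdd_above_summable_on) (auto intro!: bdd_aboveI2[where M = "B powr p"] simp: *)
  then show "f \<in> lp p" by (simp add: lp_def)
  have "(\<Sum>\<^sub>\<infinity>i. cmod (f i) powr p) \<le> B powr p"
    by (rule infsum_le_finite_sums[OF sm]) (simp add: *)
  then have "lp_norm p f \<le> (B powr p) powr (1 / p)"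
    unfolding lp_norm_def using p by (intro powr_mono2) (auto intro: infsum_nonneg)
  then show "lp_norm p f \<le> B" using p B by (simp add: powr_powr)
qed

lemma lp_boundI:
  assumes "1 \<le> p" "0 \<le> B" "\<And>S. finite S \<Longrightarrow> (\<Sum>i\<in>S. cmod (f i) powr p) \<le> B powr p"
  shows "f \<in> lp p" "lp_norm p f \<le> B"
  using lp_bound_iff[of p B f] assms by blast+

lemma lp_boundD:
  assumes "1 \<le> p" "f \<in> lp p" "lp_norm p f \<le> B" "finite S"
  shows "(\<Sum>i\<in>S. cmod (f i) powr p) \<le> B powr p"
proof -
  have "0 \<le> B" using assms(3) lp_norm_nonneg[of p f] by linarith
  then show ?thesis using lp_bound_iff[of p B f] assms by blast
qed

lemma norm_le_lp_norm:
  assumes p: "1 \<le> p" and f: "f \<in> lp p"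
  shows "cmod (f i) \<le> lp_norm p f"
proof -
  have "cmod (f i) powr p \<le> lp_norm p f powr p"
    using lp_boundD[OF p f order_refl, of "{i}"] by simp
  then show ?thesis using p powr_mono2[of "1/p" "cmod (f i) powr p" "lp_norm p f powr p"]
    by (simp add: powr_powr)
qed

lemma lp_norm_eq_0:
  assumes "1 \<le> p" "f \<in> lp p" "lp_norm p f = 0"
  shows "f = 0"
  using norm_le_lp_norm[OF assms(1,2)] assms(3) by (auto simp: fun_eq_iff)

lemma lp_cscale:
  assumes p: "1 \<le> p" and f: "f \<in> lp p"
  shows "cscale c f \<in> lp p" "lp_norm p (cscale c f) = cmod c * lp_norm p f"
proof -
  have eq: "(\<lambda>i. cmod (cscale c f i) powr p) = (\<lambda>i. cmod c powr p * cmod (f i) powr p)"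
    by (simp add: cscale_def norm_mult powr_mult)
  show "cscale c f \<in> lp p"
    using f unfolding lp_def by (simp add: eq summable_on_cmult_right)
  have "0 \<le> (\<Sum>\<^sub>\<infinity>i. cmod (f i) powr p)" by (rule infsum_nonneg) simp
  then show "lp_norm p (cscale c f) = cmod c * lp_norm p f"
    unfolding lp_norm_def eq using p by (simp add: infsum_cmult_right' powr_mult powr_powr)
qed

text \<open>Minkowski's inequality from convexity alone: \<open>f + g\<close> divided by the sum of
  the norms is a convex combination of the normalised \<open>f\<close> and \<open>g\<close>, with
  weights proportional to their norms.\<close>

lemma lp_add:
  assumes p: "1 \<le> p" and f: "f \<in> lp p" and g: "g \<in> lp p"
  shows "f + g \<in> lp p" "lp_norm p (f + g) \<le> lp_norm p f + lp_norm p g"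
proof -
  define A B where "A = lp_norm p f" and "B = lp_norm p g"
  have nn: "0 \<le> A" "0 \<le> B" by (simp_all add: A_def B_def)
  have main: "(\<Sum>i\<in>S. cmod ((f + g) i) powr p) \<le> (A + B) powr p" if S: "finite S" for S
  proof (cases "A = 0 \<or> B = 0")
    case True
    then consider "f = 0" "A = 0" | "g = 0" "B = 0"
      using lp_norm_eq_0[OF p] f g A_def B_def by metis
    then show ?thesis
      using lp_boundD[OF p f order_refl S] lp_boundD[OF p g order_refl S]
      by cases (simp_all add: A_def B_def)
  next
    case False
    then have pos: "A > 0" "B > 0" using nn by auto
    define t where "t = A / (A + B)"
    have t: "0 \<le> t" "t \<le> 1" "1 - t = B / (A + B)" using pos by (auto simp: t_def field_simps)
    have "cmod ((f + g) i) powr p \<le>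
        (A + B) powr p * (t * (cmod (f i) / A) powr p + (1 - t) * (cmod (g i) / B) powr p)" for i
    proof -
      have "cmod ((f + g) i) \<le> cmod (f i) + cmod (g i)" by (simp add: norm_triangle_ineq)
      also have "\<dots> = (A + B) * (t * (cmod (f i) / A) + (1 - t) * (cmod (g i) / B))"
      proof -
        have "(A + B) * (t * (cmod (f i) / A)) = cmod (f i)" "(A + B) * ((1 - t) * (cmod (g i) / B)) = cmod (g i)"
          unfolding t(3) using pos by (simp_all add: t_def)
        then show ?thesis by (simp only: distrib_left)
      qed
      finally have "cmod ((f + g) i) powr p \<le>
          ((A + B) * (t * (cmod (f i) / A) + (1 - t) * (cmod (g i) / B))) powr p"
        using p by (intro powr_mono2) auto
      also have "\<dots> = (A + B) powr p * (t * (cmod (f i) / A) + (1 - t) * (cmod (g i) / B)) powr p"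
        by (rule powr_mult)
      also have "\<dots> \<le> (A + B) powr p * (t * (cmod (f i) / A) powr p + (1 - t) * (cmod (g i) / B) powr p)"
        using pos t p by (intro mult_left_mono powr_convex_nonneg) auto
      finally show ?thesis .
    qed
    then have "(\<Sum>i\<in>S. cmod ((f + g) i) powr p) \<le> (\<Sum>i\<in>S. (A + B) powr p *
        (t * (cmod (f i) / A) powr p + (1 - t) * (cmod (g i) / B) powr p))"
      by (intro sum_mono)
    also have "\<dots> = (A + B) powr p * (t * ((\<Sum>i\<in>S. cmod (f i) powr p) / A powr p)
        + (1 - t) * ((\<Sum>i\<in>S. cmod (g i) powr p) / B powr p))"
      by (simp only: powr_divide sum.distrib sum_divide_distrib flip: sum_distrib_left)
    also have "\<dots> \<le> (A + B) powr p * (t * 1 + (1 - t) * 1)"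
    proof -
      have "(\<Sum>i\<in>S. cmod (f i) powr p) / A powr p \<le> 1" "(\<Sum>i\<in>S. cmod (g i) powr p) / B powr p \<le> 1"
        using pos lp_boundD[OF p f order_refl S] lp_boundD[OF p g order_refl S]
        by (simp_all add: A_def B_def)
      then show ?thesis using t by (intro mult_left_mono add_mono) simp_all
    qed
    finally show ?thesis by simp
  qed
  show "f + g \<in> lp p" "lp_norm p (f + g) \<le> lp_norm p f + lp_norm p g"
    using lp_boundI[OF p add_nonneg_nonneg[OF nn] main] by (simp_all only: A_def B_def)
qed

lemma cscale_uminus: "- f = cscale (-1) f"
  by (simp add: cscale_def fun_eq_iff)

lemma lp_zero [simp]: "0 \<in> lp p" "lp_norm p 0 = 0"
  by (simp_all add: lp_def lp_norm_def)

lemma lp_minus: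
  assumes p: "1 \<le> p" and f: "f \<in> lp p"
  shows "- f \<in> lp p" "lp_norm p (- f) = lp_norm p f"
  using lp_cscale[OF assms, of "-1"] by (simp_all flip: cscale_uminus)

lemma lp_diff:
  assumes p: "1 \<le> p" and f: "f \<in> lp p" and g: "g \<in> lp p"
  shows "f - g \<in> lp p" "lp_norm p (f - g) \<le> lp_norm p f + lp_norm p g"
  using lp_add[OF p f lp_minus(1)[OF p g]] lp_minus[OF p g] by simp_all

lemma lp_sum:
  assumes p: "1 \<le> p" and f: "\<And>n. n \<in> S \<Longrightarrow> f n \<in> lp p"
  shows "(\<Sum>n\<in>S. f n) \<in> lp p \<and> lp_norm p (\<Sum>n\<in>S. f n) \<le> (\<Sum>n\<in>S. lp_norm p (f n))"
proof (cases "finite S")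
  case True
  then show ?thesis using f
  proof (induction S)
    case empty then show ?case by (simp flip: zero_fun_def)
  next
    case (insert n S)
    then show ?case
      using lp_add[OF p, of "f n" "sum f S"] by (auto simp del: plus_fun_apply)
  qed
qed (simp flip: zero_fun_def)

lemma lp_subspace: "1 \<le> p \<Longrightarrow> cfun.subspace (lp p)"
  unfolding cfun.subspace_def by (auto intro: lp_add lp_cscale)

lemma unit_seq_lp:
  assumes "1 \<le> p"
  shows "unit_seq j \<in> lp p" "lp_norm p (unit_seq j) = 1"
proof -
  have "(\<Sum>i\<in>S. cmod (unit_seq j i) powr p) \<le> 1 powr p" if "finite S" for S
  proof -
    have "(\<Sum>i\<in>S. cmod (unit_seq j i) powr p) = (\<Sum>i\<in>S. if i = j then 1 else 0)"
      by (intro sum.cong) (auto simp: unit_seq_def)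
    then show ?thesis using that by simp
  qed
  from lp_boundI[OF assms _ this] have *: "unit_seq j \<in> lp p" "lp_norm p (unit_seq j) \<le> 1" by simp_all
  show "unit_seq j \<in> lp p" by fact
  show "lp_norm p (unit_seq j) = 1"
    using *(2) norm_le_lp_norm[OF assms *(1), of j] by (simp add: unit_seq_def)
qed

text \<open>Each finite sum passes to the pointwise limit. Membership of the limit comes along with
  the bound, which is how an operator given coordinate by coordinate is shown to map into
  \<open>lp p\<close>.\<close>

lemma lp_fatou:
  assumes p: "1 \<le> p" and B: "0 \<le> B"
    and g: "\<And>k. g k \<in> lp p" "eventually (\<lambda>k. lp_norm p (g k) \<le> B) sequentially"
    and lim: "\<And>i. (\<lambda>k. g k i) \<longlonglongrightarrow> f i"
  shows "f \<in> lp p" "lp_norm p f \<le> B"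
proof -
  have "(\<Sum>i\<in>S. cmod (f i) powr p) \<le> B powr p" if S: "finite S" for S
  proof (rule tendsto_upperbound)
    show "(\<lambda>k. \<Sum>i\<in>S. cmod (g k i) powr p) \<longlonglongrightarrow> (\<Sum>i\<in>S. cmod (f i) powr p)"
      using p by (intro tendsto_sum tendsto_powr' tendsto_norm lim) auto
    show "\<forall>\<^sub>F k in sequentially. (\<Sum>i\<in>S. cmod (g k i) powr p) \<le> B powr p"
      using g(2) by eventually_elim (use lp_boundD[OF p g(1) _ S] in auto)
  qed simp
  from lp_boundI[OF p B this] show "f \<in> lp p" "lp_norm p f \<le> B" by auto
qed

lemma lp_mono:
  assumes p: "1 \<le> p" and g: "g \<in> lp p" and le: "\<And>i. cmod (f i) \<le> cmod (g i)"
  shows "f \<in> lp p" "lp_norm p f \<le> lp_norm p g"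
proof -
  have "(\<Sum>i\<in>S. cmod (f i) powr p) \<le> lp_norm p g powr p" if "finite S" for S
  proof (rule order_trans[OF sum_mono lp_boundD[OF p g order_refl that]])
    show "cmod (f i) powr p \<le> cmod (g i) powr p" for i
      using le[of i] p by (intro powr_mono2) simp_all
  qed
  from lp_boundI[OF p _ this] show "f \<in> lp p" "lp_norm p f \<le> lp_norm p g" by auto
qed

text \<open>A sequence in \<open>lp p\<close> acts on \<open>lp p\<close> as a functional of norm at
  most its own norm. This is what turns the rows of a kernel into functionals.\<close>

lemma lp_pairing:
  assumes p: "1 \<le> p" "p \<le> 2" and f: "f \<in> lp p" and g: "g \<in> lp p" and S: "finite S"
  shows "(\<Sum>i\<in>S. cmod (f i * g i)) \<le> lp_norm p f * lp_norm p g"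
proof (cases "lp_norm p f = 0 \<or> lp_norm p g = 0")
  case True
  then have "f = 0 \<or> g = 0" using lp_norm_eq_0 f g p by blast
  then show ?thesis by auto
next
  case False
  define A B where "A = lp_norm p f" and "B = lp_norm p g"
  have pos: "A > 0" "B > 0" using False by (auto simp: A_def B_def less_le)
  have sq: "x * x \<le> x powr p" if "0 \<le> x" "x \<le> 1" for x :: real
    using powr_mono'[of p 2 x] that p by (cases "x = 0") (auto simp: powr_numeral power2_eq_square)
  have am_gm: "x * y \<le> (x * x + y * y) / 2" for x y :: real
    using sum_squares_bound[of x y] by (simp add: power2_eq_square)
  have "cmod (f i * g i) \<le> A * B * (((cmod (f i) / A) powr p + (cmod (g i) / B) powr p) / 2)" for i
  proof -
    let ?x = "cmod (f i) / A" and ?y = "cmod (g i) / B"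
    have x: "0 \<le> ?x" "?x \<le> 1" and y: "0 \<le> ?y" "?y \<le> 1"
      using norm_le_lp_norm[OF p(1)] f g pos by (auto simp: A_def B_def)
    (* p \<le> 2 enters here: numbers in [0, 1] satisfy x^2 \<le> x^p, so no dual exponent is needed *)
    have "?x * ?y \<le> (?x * ?x + ?y * ?y) / 2"
      by (rule am_gm)
    also have "\<dots> \<le> (?x powr p + ?y powr p) / 2"
      by (intro divide_right_mono add_mono sq x y) simp
    finally have "A * B * (?x * ?y) \<le> A * B * ((?x powr p + ?y powr p) / 2)"
      using pos by (intro mult_left_mono) auto
    then show ?thesis using pos by (simp add: norm_mult)
  qed
  then have "(\<Sum>i\<in>S. cmod (f i * g i)) \<le>
      (\<Sum>i\<in>S. A * B * (((cmod (f i) / A) powr p + (cmod (g i) / B) powr p) / 2))"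
    by (intro sum_mono)
  also have "\<dots> = A * B * (((\<Sum>i\<in>S. cmod (f i) powr p) / A powr p
      + (\<Sum>i\<in>S. cmod (g i) powr p) / B powr p) / 2)"
    by (simp only: powr_divide sum.distrib flip: sum_distrib_left sum_divide_distrib)
  also have "\<dots> \<le> A * B * ((1 + 1) / 2)"
  proof -
    have "(\<Sum>i\<in>S. cmod (f i) powr p) / A powr p \<le> 1" "(\<Sum>i\<in>S. cmod (g i) powr p) / B powr p \<le> 1"
      using pos lp_boundD[OF p(1) f order_refl S] lp_boundD[OF p(1) g order_refl S]
      by (simp_all add: A_def B_def)
    then show ?thesis using pos by (intro mult_left_mono divide_right_mono add_mono) simp_all
  qed
  finally show ?thesis by (simp add: A_def B_def)
qed

section \<open>Truncation to the first k coordinates in the enumeration of the integers\<close>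

definition lp_cut :: "nat \<Rightarrow> (int \<Rightarrow> complex) \<Rightarrow> int \<Rightarrow> complex"
  where "lp_cut k f = (\<Sum>n<k. cscale (f (int_decode n)) (unit_seq (int_decode n)))"

lemma sum_fun_eval: "(\<Sum>n\<in>S. g n) i = (\<Sum>n\<in>S. g n i)" for g :: "'b \<Rightarrow> 'a \<Rightarrow> complex"
  by (induction S rule: infinite_finite_induct) auto

lemma lp_cut_apply: "lp_cut k f i = (if int_encode i < k then f i else 0)"
proof -
  have "lp_cut k f i = (\<Sum>n<k. if n = int_encode i then f i else 0)"
    unfolding lp_cut_def sum_fun_eval
    by (intro sum.cong) (auto simp: cscale_def unit_seq_def)
  then show ?thesis by simp
qed

lemma lp_cut_lp:
  assumes "1 \<le> p" "f \<in> lp p"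
  shows "lp_cut k f \<in> lp p" "lp_norm p (lp_cut k f) \<le> lp_norm p f"
  by (rule lp_mono[OF assms]; simp add: lp_cut_apply)+

lemma sum_int_encode_le_suminf:
  fixes c :: "int \<Rightarrow> real"
  assumes "summable (\<lambda>n. c (int_decode n))" "\<And>i. 0 \<le> c i" "finite S"
  shows "(\<Sum>i\<in>S. c i) \<le> (\<Sum>n. c (int_decode n))"
proof -
  have "(\<Sum>i\<in>S. c i) = (\<Sum>n\<in>int_encode ` S. c (int_decode n))"
    by (subst sum.reindex) (auto intro: inj_on_subset[OF inj_int_encode])
  also have "\<dots> \<le> (\<Sum>n. c (int_decode n))"
    using assms by (intro sum_le_suminf) auto
  finally show ?thesis .
qed

lemma summable_int_decode:
  fixes c :: "int \<Rightarrow> real"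
  assumes "c summable_on UNIV"
  shows "summable (\<lambda>n. c (int_decode n))"
proof -
  have "(c \<circ> int_decode) summable_on UNIV"
    using assms bij_int_decode by (metis summable_on_reindex bij_def)
  then show ?thesis
    using summable_on_imp_summable[of "\<lambda>n. c (int_decode n)"] by (simp add: o_def)
qed

lemma lp_cut_tendsto:
  assumes p: "1 \<le> p" and f: "f \<in> lp p"
  shows "(\<lambda>k. lp_norm p (f - lp_cut k f)) \<longlonglongrightarrow> 0"
proof -
  let ?h = "\<lambda>n. cmod (f (int_decode n)) powr p"
  have sm: "summable ?h"
    using summable_int_decode[of "\<lambda>i. cmod (f i) powr p"] f by (simp add: lp_def)
  have "lp_norm p (f - lp_cut k f) \<le> (suminf ?h - (\<Sum>n<k. ?h n)) powr (1/p)" for k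
  proof (rule lp_boundI(2)[OF p])
    fix S :: "int set" assume S: "finite S"
    have "(\<Sum>i\<in>S. cmod ((f - lp_cut k f) i) powr p) =
        (\<Sum>i\<in>S. cmod (if int_encode i < k then 0 else f i) powr p)"
      by (intro sum.cong) (auto simp: lp_cut_apply)
    also have "\<dots> = (\<Sum>i\<in>{i\<in>S. k \<le> int_encode i}. cmod (f i) powr p)"
      using S p by (intro sum.mono_neutral_cong_right) auto
    also have "\<dots> = (\<Sum>n\<in>int_encode ` {i\<in>S. k \<le> int_encode i}. ?h n)"
      by (subst sum.reindex) (auto intro: inj_on_subset[OF inj_int_encode])
    \<comment> \<open>The codes that occur are all at least \<open>k\<close>, hence disjoint from
      \<open>{..<k}\<close>. Adding and subtracting the initial segment makes the finite sum
      comparable with the full series.\<close>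
    also have "\<dots> = (\<Sum>n\<in>int_encode ` {i\<in>S. k \<le> int_encode i} \<union> {..<k}. ?h n) - (\<Sum>n<k. ?h n)"
      using S by (subst sum.union_disjoint) auto
    also have "\<dots> \<le> suminf ?h - (\<Sum>n<k. ?h n)"
      using sm S by (intro diff_right_mono sum_le_suminf) auto
    finally show "(\<Sum>i\<in>S. cmod ((f - lp_cut k f) i) powr p) \<le>
        ((suminf ?h - (\<Sum>n<k. ?h n)) powr (1/p)) powr p"
      using p sum_le_suminf[OF sm, of "{..<k}"] by (simp add: powr_powr)
  qed simp
  moreover have "(\<lambda>k. (suminf ?h - (\<Sum>n<k. ?h n)) powr (1/p)) \<longlonglongrightarrow> 0"
  proof -
    have "(\<lambda>k. suminf ?h - (\<Sum>n<k. ?h n)) \<longlonglongrightarrow> suminf ?h - suminf ?h"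
      by (intro tendsto_diff tendsto_const summable_LIMSEQ[OF sm])
    then show ?thesis
      using tendsto_powr'[of "\<lambda>k. suminf ?h - (\<Sum>n<k. ?h n)" 0 sequentially "\<lambda>_. 1/p" "1/p"] p
        sum_le_suminf[OF sm] by simp
  qed
  ultimately show ?thesis
    by (rule_tac tendsto_sandwich[OF _ _ tendsto_const]) simp_all
qed

section \<open>Determinants of matrices\<close>

text \<open>\<open>M * N\<close> and \<open>N * M\<close> have the same determinant, and both are
  block triangular: one has \<open>1 + B * A\<close> on its diagonal, the other
  \<open>1 + A * B\<close>. Nothing is inverted, so the identity holds over any integral
  domain.\<close>

lemma det_one_plus_mult_commute:
  fixes A B :: "'a :: idom mat"
  assumes A: "A \<in> carrier_mat n m" and B: "B \<in> carrier_mat m n"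
  shows "Determinant.det (1\<^sub>m n + A * B) = Determinant.det (1\<^sub>m m + B * A)"
proof -
  define M where "M = four_block_mat (1\<^sub>m n) (- A) B (1\<^sub>m m)"
  define N where "N = four_block_mat (1\<^sub>m n) A (0\<^sub>m m n) (1\<^sub>m m)"
  have carr: "M \<in> carrier_mat (n + m) (n + m)" "N \<in> carrier_mat (n + m) (n + m)"
    using A B unfolding M_def N_def by (auto intro: four_block_carrier_mat)
  have "M * N = four_block_mat (1\<^sub>m n) (0\<^sub>m n m) B (1\<^sub>m m + B * A)"
    unfolding M_def N_def
    by (subst mult_four_block_mat[of _ n n _ m _ m _ _ n _ m])
      (use A B in \<open>auto simp: comm_add_mat[of "B * A" m m]\<close>)
  then have "Determinant.det (M * N) = Determinant.det (1\<^sub>m m + B * A)"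
    using A B by (simp add: det_four_block_mat_upper_right_zero[of _ n _ m])
  moreover have "N * M = four_block_mat (1\<^sub>m n + A * B) (0\<^sub>m n m) B (1\<^sub>m m)"
    unfolding M_def N_def
    by (subst mult_four_block_mat[of _ n n _ m _ m _ _ n _ m])
      (use A B in \<open>auto simp: uminus_l_inv_mat\<close>)
  then have "Determinant.det (N * M) = Determinant.det (1\<^sub>m n + A * B)"
    using A B by (simp add: det_four_block_mat_upper_right_zero[of _ n _ m])
  ultimately show ?thesis
    using det_mult[OF carr] det_mult[OF carr(2,1)] by (simp add: mult.commute)
qed

text \<open>The matrix determinant lemma in quantitative form: \<open>a\<close> is \<open>v\<close>
  applied to the solution \<open>w\<close> of \<open>Y w = u\<close>, and coercivity gives both the
  solvability and a bound on \<open>N w\<close>. The abstract \<open>N\<close> stands for the norm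
  of \<open>lp p\<close> on vectors supported on \<open>k\<close> coordinates; measured in this way
  the bound does not deteriorate with \<open>k\<close>.\<close>

lemma det_rank_one_update:
  fixes Y :: "nat \<Rightarrow> nat \<Rightarrow> complex" and u v :: "nat \<Rightarrow> complex" and N :: "(nat \<Rightarrow> complex) \<Rightarrow> real"
  assumes \<delta>: "0 < \<delta>"
    and coercive: "\<And>x. \<delta> * N x \<le> N (\<lambda>i. if i < k then \<Sum>j<k. Y i j * x j else 0)"
    and pos: "\<And>x i. i < k \<Longrightarrow> x i \<noteq> 0 \<Longrightarrow> N x > 0"
    and N0: "N (\<lambda>_. 0) = 0"
    and v: "\<And>x. cmod (\<Sum>i<k. v i * x i) \<le> c * N x" and c: "0 \<le> c"
  shows "\<exists>a. Determinant.det (mat k k (\<lambda>(i, j). Y i j + u i * v j)) =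
      Determinant.det (mat k k (\<lambda>(i, j). Y i j)) * (1 + a) \<and>
    \<delta> * cmod a \<le> c * N (\<lambda>i. if i < k then u i else 0)"
proof -
  let ?Y = "mat k k (\<lambda>(i, j). Y i j)"
  have Y: "?Y \<in> carrier_mat k k" by simp
  have app: "vec_index (?Y *\<^sub>v w) i = (\<Sum>j<k. Y i j * vec_index w j)" if "w \<in> carrier_vec k" "i < k" for w i
    using that by (auto simp: scalar_prod_def lessThan_atLeast0 intro!: sum.cong)
  \<comment> \<open>A nonzero vector in the kernel of \<open>?Y\<close> would have positive
    \<open>N\<close> while its image has \<open>N\<close> equal to 0, against coercivity.\<close>
  have "Determinant.det ?Y \<noteq> 0"
  proof
    assume "Determinant.det ?Y = 0"
    then obtain w where w: "w \<in> carrier_vec k" "w \<noteq> 0\<^sub>v k" "?Y *\<^sub>v w = 0\<^sub>v k"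
      using det_0_iff_vec_prod_zero_field[OF Y] by auto
    from w(1,2) obtain i where i: "i < k" "vec_index w i \<noteq> 0" by (auto simp: vec_eq_iff)
    have "(\<lambda>i. if i < k then \<Sum>j<k. Y i j * vec_index w j else 0) = (\<lambda>_. 0)"
      using app[OF w(1)] w(3) by (auto simp: fun_eq_iff)
    then have "\<delta> * N (\<lambda>j. vec_index w j) \<le> 0" using coercive[of "\<lambda>j. vec_index w j"] N0 by simp
    moreover have "N (\<lambda>j. vec_index w j) > 0" using pos[of i "\<lambda>j. vec_index w j"] i by simp
    ultimately show False using \<delta> by (simp add: mult_le_0_iff)
  qed
  then obtain Z where Z: "Z \<in> carrier_mat k k" "?Y * Z = 1\<^sub>m k"
    using det_non_zero_imp_unit[OF Y, of "()"] unfolding Units_def by (auto simp: ring_mat_simps)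
  define U where "U = mat k 1 (\<lambda>(i, j). u i)"
  define V where "V = mat 1 k (\<lambda>(i, j). v j)"
  have UV: "U \<in> carrier_mat k 1" "V \<in> carrier_mat 1 k" by (auto simp: U_def V_def)
  define W where "W = Z * U"
  have W: "W \<in> carrier_mat k 1" using Z UV by (auto simp: W_def)
  have YW: "?Y * W = U"
    unfolding W_def using assoc_mult_mat[OF Y Z(1) UV(1)] Z UV by simp
  define w where "w i = W $$ (i, 0)" for i
  define a where "a = (\<Sum>i<k. v i * w i)"
  have "mat k k (\<lambda>(i, j). Y i j + u i * v j) = ?Y + U * V"
    by (intro eq_matI) (auto simp: U_def V_def scalar_prod_def)
  \<comment> \<open>Factoring out \<open>?Y\<close> leaves a rank-one perturbation of the identity,
    and exchanging its two factors reduces that determinant to a 1 by 1 matrix.\<close>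
  also have "\<dots> = ?Y * (1\<^sub>m k + W * V)"
  proof -
    have "?Y * (1\<^sub>m k + W * V) = ?Y * 1\<^sub>m k + ?Y * (W * V)"
      using Y W UV by (intro mult_add_distrib_mat) auto
    also have "?Y * (W * V) = U * V" using assoc_mult_mat[OF Y W UV(2)] YW by simp
    finally show ?thesis by simp
  qed
  finally have "Determinant.det (mat k k (\<lambda>(i, j). Y i j + u i * v j)) =
      Determinant.det ?Y * Determinant.det (1\<^sub>m k + W * V)"
    using det_mult[OF Y, of "1\<^sub>m k + W * V"] W UV by simp
  also have "Determinant.det (1\<^sub>m k + W * V) = Determinant.det (1\<^sub>m 1 + V * W)"
    by (rule det_one_plus_mult_commute[OF W UV(2)])
  also have "\<dots> = 1 + a"
    using UV W by (subst det_single) (auto simp: V_def scalar_prod_def a_def w_def lessThan_atLeast0 intro!: sum.cong)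
  finally have "Determinant.det (mat k k (\<lambda>(i, j). Y i j + u i * v j)) = Determinant.det ?Y * (1 + a)" .
  moreover have "\<delta> * cmod a \<le> c * N (\<lambda>i. if i < k then u i else 0)"
  proof -
    have "(\<Sum>j<k. Y i j * w j) = u i" if "i < k" for i
    proof -
      have "u i = (?Y * W) $$ (i, 0)" using that by (simp add: YW U_def)
      also have "\<dots> = (\<Sum>j<k. Y i j * w j)"
        using that W by (auto simp: scalar_prod_def w_def lessThan_atLeast0 intro!: sum.cong)
      finally show ?thesis by simp
    qed
    then have "(\<lambda>i. if i < k then \<Sum>j<k. Y i j * w j else 0) = (\<lambda>i. if i < k then u i else 0)"
      by auto
    then have "\<delta> * N w \<le> N (\<lambda>i. if i < k then u i else 0)"
      using coercive[of w] by simp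
    then have "c * (\<delta> * N w) \<le> c * N (\<lambda>i. if i < k then u i else 0)"
      using c by (rule mult_left_mono)
    moreover have "\<delta> * cmod a \<le> \<delta> * (c * N w)"
      unfolding a_def using v[of w] \<delta> by (intro mult_left_mono) auto
    ultimately show ?thesis by (simp add: mult.left_commute)
  qed
  ultimately show ?thesis by blast
qed

lemma tendsto_det:
  fixes A :: "'b \<Rightarrow> nat \<Rightarrow> nat \<Rightarrow> complex"
  assumes "\<And>i j. i < k \<Longrightarrow> j < k \<Longrightarrow> ((\<lambda>n. A n i j) \<longlongrightarrow> L i j) F"
  shows "((\<lambda>n. Determinant.det (mat k k (\<lambda>(i, j). A n i j))) \<longlongrightarrow>
    Determinant.det (mat k k (\<lambda>(i, j). L i j))) F"
proof -
  have eq: "Determinant.det (mat k k (\<lambda>(i, j). M i j)) =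
      (\<Sum>\<pi>\<in>{\<pi>. \<pi> permutes {0..<k}}. signof \<pi> * (\<Prod>i=0..<k. M i (\<pi> i)))" for M :: "nat \<Rightarrow> nat \<Rightarrow> complex"
    unfolding det_def'[OF mat_carrier]
    by (intro sum.cong prod.cong arg_cong2[where f = "(*)"] refl) (auto simp: permutes_in_image[of _ "{0..<k}", simplified])
  show ?thesis unfolding eq
    by (intro tendsto_sum tendsto_mult tendsto_const tendsto_prod assms) (auto simp: permutes_in_image[of _ "{0..<k}", simplified])
qed

section \<open>Triangular form: eigenvalues, determinants and traces of powers\<close>

lemma upper_triangular_pow:
  fixes B :: "'a :: comm_ring_1 mat"
  assumes B: "B \<in> carrier_mat n n" and ut: "upper_triangular B"
  shows "(\<forall>i<n. \<forall>j<i. (B ^\<^sub>m m) $$ (i, j) = 0) \<and> (\<forall>i<n. (B ^\<^sub>m m) $$ (i, i) = (B $$ (i, i)) ^ m)"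
proof (induction m)
  case (Suc m)
  have P: "B ^\<^sub>m m \<in> carrier_mat n n" using B by simp
  have ent: "(B ^\<^sub>m Suc m) $$ (i, j) = (\<Sum>l<n. (B ^\<^sub>m m) $$ (i, l) * B $$ (l, j))"
    if "i < n" "j < n" for i j
    using that P B by (auto simp: scalar_prod_def lessThan_atLeast0 intro!: sum.cong)
  \<comment> \<open>On or below the diagonal only \<open>l = i = j\<close> survives: for
    \<open>l < i\<close> the entry of the power vanishes, for \<open>l > j\<close> the entry of
    \<open>B\<close>.\<close>
  have zero: "(B ^\<^sub>m m) $$ (i, l) * B $$ (l, j) = 0" if "i < n" "l < n" "j \<le> i" "l \<noteq> i \<or> j \<noteq> i" for i j l
  proof (cases "l < i")
    case True
    then show ?thesis using Suc that by simp
  next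
    case False
    then have "j < l" using that by auto
    then show ?thesis using upper_triangularD[OF ut] that B by auto
  qed
  show ?case
  proof (intro conjI allI impI)
    fix i j assume ij: "i < n" "j < i"
    then show "(B ^\<^sub>m Suc m) $$ (i, j) = 0"
      by (subst ent) (auto intro!: sum.neutral zero)
  next
    fix i assume i: "i < n"
    have "(B ^\<^sub>m Suc m) $$ (i, i) = (\<Sum>l\<in>{i}. (B ^\<^sub>m m) $$ (i, l) * B $$ (l, i))"
      unfolding ent[OF i i] by (intro sum.mono_neutral_right) (auto simp: i intro!: zero)
    then show "(B ^\<^sub>m Suc m) $$ (i, i) = (B $$ (i, i)) ^ Suc m" using Suc i by simp
  qed
qed (use B in auto)

lemma trace_similar:
  fixes C P Q :: "'a :: comm_ring_1 mat"
  assumes C: "C \<in> carrier_mat n n" and P: "P \<in> carrier_mat n n" and Q: "Q \<in> carrier_mat n n"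
    and QP: "Q * P = 1\<^sub>m n"
  shows "(\<Sum>i<n. (P * C * Q) $$ (i, i)) = (\<Sum>i<n. C $$ (i, i))"
proof -
  have comm: "(\<Sum>i<n. (X * Y) $$ (i, i)) = (\<Sum>i<n. (Y * X) $$ (i, i))"
    if X: "X \<in> carrier_mat n n" and Y: "Y \<in> carrier_mat n n" for X Y :: "'a mat"
  proof -
    have e: "(\<Sum>i<n. (X * Y) $$ (i, i)) = (\<Sum>i<n. \<Sum>j<n. X $$ (i, j) * Y $$ (j, i))"
      if X: "X \<in> carrier_mat n n" and Y: "Y \<in> carrier_mat n n" for X Y :: "'a mat"
      using X Y by (intro sum.cong) (auto simp: scalar_prod_def lessThan_atLeast0 intro!: sum.cong)
    show ?thesis unfolding e[OF X Y] e[OF Y X]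
      by (subst sum.swap) (simp add: mult.commute)
  qed
  have "(\<Sum>i<n. (P * C * Q) $$ (i, i)) = (\<Sum>i<n. (Q * (P * C)) $$ (i, i))"
    using C P Q by (intro comm) auto
  also have "Q * (P * C) = C"
    using C P Q QP by (simp flip: assoc_mult_mat[OF Q P C])
  finally show ?thesis .
qed

text \<open>One list, with multiplicities, has to serve the determinant, the traces of all powers
  and the spectral bound. The diagonal of a Schur form does: similarity preserves determinant and
  trace, and a triangular matrix shows both on its diagonal.\<close>

lemma eigenvalues_det_trace:
  fixes A :: "complex mat"
  assumes A: "A \<in> carrier_mat n n"
  obtains e :: "nat \<Rightarrow> complex" where
    "\<And>z. Determinant.det (1\<^sub>m n + z \<cdot>\<^sub>m A) = (\<Prod>i<n. 1 + z * e i)"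
    "\<And>m. (\<Sum>i<n. (A ^\<^sub>m m) $$ (i, i)) = (\<Sum>i<n. e i ^ m)"
    "\<And>i. i < n \<Longrightarrow> eigenvalue A (e i)"
proof -
  from char_poly_factorized[OF A] obtain es where
    es: "char_poly A = (\<Prod>a\<leftarrow>es. [:- a, 1:])" and len: "length es = n" by blast
  obtain B P Q where "schur_decomposition A es = (B, P, Q)" by (metis prod_cases3)
  from schur_decomposition[OF A es this] have
    sim: "similar_mat_wit A B P Q" and ut: "upper_triangular B" and diag: "diag_mat B = es" by auto
  note w = similar_mat_witD2[OF A sim]
  define e where "e = (\<lambda>i. B $$ (i, i))"
  have es_e: "es = map e [0..<n]" using diag w by (simp add: diag_mat_def e_def)
  show ?thesis
  proof (rule that)
    fix z
    have *: "1\<^sub>m n + z \<cdot>\<^sub>m A = P * (1\<^sub>m n + z \<cdot>\<^sub>m B) * Q"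
    proof -
      have "P * (1\<^sub>m n + z \<cdot>\<^sub>m B) = P * 1\<^sub>m n + P * (z \<cdot>\<^sub>m B)"
        using w by (intro mult_add_distrib_mat) auto
      also have "\<dots> = P + z \<cdot>\<^sub>m (P * B)" using w by (simp add: mult_smult_distrib[of _ n n])
      finally have "P * (1\<^sub>m n + z \<cdot>\<^sub>m B) * Q = P * Q + z \<cdot>\<^sub>m (P * B) * Q"
        using w by (simp add: add_mult_distrib_mat[of _ n n])
      also have "z \<cdot>\<^sub>m (P * B) * Q = z \<cdot>\<^sub>m (P * B * Q)"
        using w by (intro mult_smult_assoc_mat[of _ n n]) auto
      finally show ?thesis using w(1,3) by simp
    qed
    have "similar_mat (1\<^sub>m n + z \<cdot>\<^sub>m A) (1\<^sub>m n + z \<cdot>\<^sub>m B)"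
      unfolding similar_mat_def
      by (intro exI, rule similar_mat_witI[OF _ _ *]) (use w in auto)
    then have "Determinant.det (1\<^sub>m n + z \<cdot>\<^sub>m A) = Determinant.det (1\<^sub>m n + z \<cdot>\<^sub>m B)"
      by (rule det_similar)
    also have "\<dots> = prod_list (diag_mat (1\<^sub>m n + z \<cdot>\<^sub>m B))"
      using w ut by (intro det_upper_triangular[of _ n]) (auto simp: upper_triangular_def)
    also have "\<dots> = (\<Prod>i<n. 1 + z * e i)"
      using w by (simp add: prod_list_diag_prod e_def lessThan_atLeast0)
    finally show "Determinant.det (1\<^sub>m n + z \<cdot>\<^sub>m A) = (\<Prod>i<n. 1 + z * e i)" .
  next
    fix m
    have "A ^\<^sub>m m = P * (B ^\<^sub>m m) * Q" by (rule similar_mat_wit_pow_id[OF sim])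
    then have "(\<Sum>i<n. (A ^\<^sub>m m) $$ (i, i)) = (\<Sum>i<n. (B ^\<^sub>m m) $$ (i, i))"
      using trace_similar[of "B ^\<^sub>m m" n P Q] w by simp
    then show "(\<Sum>i<n. (A ^\<^sub>m m) $$ (i, i)) = (\<Sum>i<n. e i ^ m)"
      using upper_triangular_pow[of B n m] ut w by (simp add: e_def)
  next
    fix i assume "i < n"
    then have "poly (char_poly A) (e i) = 0"
      unfolding es es_e by (simp add: poly_prod_list prod_list_zero_iff o_def)
    then show "eigenvalue A (e i)" using eigenvalue_root_char_poly[OF A] by simp
  qed
qed

text \<open>If the bound depends on the row, the sum of the moduli of an eigenvector is estimated;
  if it depends on the column, the largest modulus. These are the operator norms on l^1 and
  l^infinity. Either way only the total of \<open>c\<close> enters, which stays bounded as sections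
  grow.\<close>

lemma eigenvalue_bound:
  fixes A :: "complex mat" and c :: "nat \<Rightarrow> real"
  assumes A: "A \<in> carrier_mat n n" and ev: "eigenvalue A e"
    and c: "\<And>i. 0 \<le> c i"
    and bound: "(\<forall>i<n. \<forall>j<n. cmod (A $$ (i, j)) \<le> c i) \<or> (\<forall>i<n. \<forall>j<n. cmod (A $$ (i, j)) \<le> c j)"
  shows "cmod e \<le> (\<Sum>i<n. c i)"
proof -
  from ev A obtain v where v: "v \<in> carrier_vec n" "v \<noteq> 0\<^sub>v n" "A *\<^sub>v v = e \<cdot>\<^sub>v v"
    by (auto simp: eigenvalue_def eigenvector_def)
  define x where "x i = cmod (vec_index v i)" for i
  have eq: "cmod e * x i \<le> (\<Sum>j<n. cmod (A $$ (i, j)) * x j)" if i: "i < n" for i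
  proof -
    have "e * vec_index v i = vec_index (A *\<^sub>v v) i" using v i by simp
    also have "\<dots> = (\<Sum>j<n. A $$ (i, j) * vec_index v j)"
      using A v(1) i by (auto simp: scalar_prod_def lessThan_atLeast0 intro!: sum.cong)
    finally have "cmod e * x i = cmod (\<Sum>j<n. A $$ (i, j) * vec_index v j)"
      by (simp add: x_def flip: norm_mult)
    also have "\<dots> \<le> (\<Sum>j<n. cmod (A $$ (i, j)) * x j)"
      unfolding x_def by (rule order_trans[OF norm_sum]) (simp add: norm_mult)
    finally show ?thesis .
  qed
  from v(1,2) obtain i0 where i0: "i0 < n" "x i0 > 0" by (auto simp: vec_eq_iff x_def)
  have x: "0 \<le> x i" for i by (simp add: x_def)
  from bound show ?thesis
  proof
    assume *: "\<forall>i<n. \<forall>j<n. cmod (A $$ (i, j)) \<le> c i"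
    have "cmod e * (\<Sum>i<n. x i) \<le> (\<Sum>i<n. \<Sum>j<n. cmod (A $$ (i, j)) * x j)"
      unfolding sum_distrib_left by (intro sum_mono eq) auto
    also have "\<dots> \<le> (\<Sum>i<n. \<Sum>j<n. c i * x j)"
      using * x by (intro sum_mono mult_right_mono) auto
    also have "\<dots> = (\<Sum>i<n. c i) * (\<Sum>i<n. x i)" by (simp add: sum_product)
    finally show ?thesis using i0 x by (auto dest!: mult_right_le_imp_le intro!: sum_pos2[of _ i0])
  next
    assume *: "\<forall>i<n. \<forall>j<n. cmod (A $$ (i, j)) \<le> c j"
    have fin: "finite (x ` {..<n})" "x ` {..<n} \<noteq> {}" using i0 by auto
    from Max_in[OF fin] obtain i where i: "i < n" "x i = Max (x ` {..<n})"
      by (metis imageE lessThan_iff)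
    then have mx: "x j \<le> x i" if "j < n" for j using that fin by auto
    have "cmod e * x i \<le> (\<Sum>j<n. cmod (A $$ (i, j)) * x j)" by (rule eq[OF i(1)])
    also have "\<dots> \<le> (\<Sum>j<n. c j * x i)"
      using * x c mx i by (intro sum_mono mult_mono) auto
    also have "\<dots> = (\<Sum>j<n. c j) * x i" by (simp add: sum_distrib_right)
    finally show ?thesis using mx[of i0] i0 by (auto dest!: mult_right_le_imp_le)
  qed
qed

lemma exp_log_series:
  assumes "cmod w < 1"
  shows "summable (\<lambda>n. (-1) ^ (Suc n + 1) / of_nat (Suc n) * w ^ Suc n)"
    "exp (\<Sum>n. (-1) ^ (Suc n + 1) / of_nat (Suc n) * w ^ Suc n) = 1 + w"
proof -
  have "(\<lambda>n. (-1) ^ (n + 1) / of_nat n * w ^ n) sums ln (1 + w)" using Ln_series[OF assms] by simp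
  \<comment> \<open>The term with index 0 is 0 because division by zero yields 0, so the shifted
    series has the same sum.\<close>
  then have *: "(\<lambda>n. (-1) ^ (Suc n + 1) / of_nat (Suc n) * w ^ Suc n) sums ln (1 + w)"
    by (subst sums_Suc_iff) simp
  show "summable (\<lambda>n. (-1) ^ (Suc n + 1) / of_nat (Suc n) * w ^ Suc n)"
    using * by (rule sums_summable)
  have "1 + w \<noteq> 0" using assms by (metis add.inverse_unique norm_minus_cancel norm_one order_less_irrefl)
  then show "exp (\<Sum>n. (-1) ^ (Suc n + 1) / of_nat (Suc n) * w ^ Suc n) = 1 + w"
    unfolding sums_unique[OF *, symmetric] by simp
qed

text \<open>By the spectral bound each \<open>z * e i\<close> has modulus below 1, so every factor
  \<open>1 + z * e i\<close> is the exponential of its logarithm series. Exchanging the finite sum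
  with the series turns powers of eigenvalues into traces.\<close>

lemma det_eq_exp_trace:
  fixes A :: "complex mat" and c :: "nat \<Rightarrow> real"
  assumes A: "A \<in> carrier_mat n n"
    and c: "\<And>i. 0 \<le> c i"
    and bound: "(\<forall>i<n. \<forall>j<n. cmod (A $$ (i, j)) \<le> c i) \<or> (\<forall>i<n. \<forall>j<n. cmod (A $$ (i, j)) \<le> c j)"
    and z: "cmod z * (\<Sum>i<n. c i) < 1"
  shows "Determinant.det (1\<^sub>m n + z \<cdot>\<^sub>m A) =
    exp (\<Sum>m. (-1) ^ (Suc m + 1) / of_nat (Suc m) * z ^ Suc m * (\<Sum>i<n. (A ^\<^sub>m Suc m) $$ (i, i)))"
proof -
  obtain e where e: "\<And>z. Determinant.det (1\<^sub>m n + z \<cdot>\<^sub>m A) = (\<Prod>i<n. 1 + z * e i)"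
    "\<And>m. (\<Sum>i<n. (A ^\<^sub>m m) $$ (i, i)) = (\<Sum>i<n. e i ^ m)"
    "\<And>i. i < n \<Longrightarrow> eigenvalue A (e i)"
    using eigenvalues_det_trace[OF A] by blast
  have small: "cmod (z * e i) < 1" if "i < n" for i
    using mult_left_mono[OF eigenvalue_bound[OF A e(3)[OF that] c bound], of "cmod z"] z
    by (simp add: norm_mult)
  let ?t = "\<lambda>i m. (-1) ^ (Suc m + 1) / of_nat (Suc m) * (z * e i) ^ Suc m"
  have "(\<Prod>i<n. 1 + z * e i) = (\<Prod>i<n. exp (\<Sum>m. ?t i m))"
    by (intro prod.cong refl exp_log_series(2)[symmetric] small) simp
  also have "\<dots> = exp (\<Sum>i<n. \<Sum>m. ?t i m)" by (simp add: exp_sum)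
  also have "(\<Sum>i<n. \<Sum>m. ?t i m) = (\<Sum>m. \<Sum>i<n. ?t i m)"
    by (intro suminf_sum[symmetric] exp_log_series(1) small) simp
  also have "(\<lambda>m. \<Sum>i<n. ?t i m) =
      (\<lambda>m. (-1) ^ (Suc m + 1) / of_nat (Suc m) * z ^ Suc m * (\<Sum>i<n. e i ^ Suc m))"
    by (simp only: power_mult_distrib sum_distrib_left mult.assoc)
  finally show ?thesis by (simp only: e)
qed

section \<open>Matrix powers as sums over walks\<close>

lemma pow_mat_paths:
  fixes K :: "nat \<Rightarrow> nat \<Rightarrow> complex"
  assumes "a < n" "b < n"
  shows "(mat n n (\<lambda>(i, j). K i j) ^\<^sub>m m) $$ (a, b) =
    (\<Sum>j\<in>{j \<in> {0..m} \<rightarrow>\<^sub>E {..<n}. j 0 = a \<and> j m = b}. \<Prod>s=1..m. K (j (s - 1)) (j s))"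
  using assms
proof (induction m arbitrary: b)
  case 0
  \<comment> \<open>The product over a walk of length 0 is empty; the single constant walk, present
    only for \<open>a = b\<close>, gives the entries of the identity matrix.\<close>
  have "{j \<in> {0..0::nat} \<rightarrow>\<^sub>E {..<n}. j 0 = a \<and> j 0 = b} = (if a = b then {\<lambda>x\<in>{0}. a} else {})"
    using 0 by (auto simp: PiE_def extensional_def fun_eq_iff)
  then show ?case using 0 by simp
next
  case (Suc m)
  let ?A = "mat n n (\<lambda>(i, j). K i j)"
  let ?P = "\<lambda>m b. {j \<in> {0..m} \<rightarrow>\<^sub>E {..<n}. j 0 = a \<and> j m = b}"
  have fin: "finite (?P m c)" for c by (rule finite_subset[OF _ finite_PiE[of "{0..m}" "\<lambda>_. {..<n}"]]) auto
  have "(?A ^\<^sub>m Suc m) $$ (a, b) = (\<Sum>c<n. (?A ^\<^sub>m m) $$ (a, c) * K c b)"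
    using Suc.prems by (auto simp: scalar_prod_def lessThan_atLeast0 intro!: sum.cong)
  also have "\<dots> = (\<Sum>c<n. \<Sum>j\<in>?P m c. (\<Prod>s=1..m. K (j (s - 1)) (j s)) * K c b)"
    using Suc by (simp add: sum_distrib_right)
  also have "\<dots> = (\<Sum>(c, j)\<in>Sigma {..<n} (?P m). (\<Prod>s=1..m. K (j (s - 1)) (j s)) * K c b)"
    using fin by (subst sum.Sigma) auto
  also have "\<dots> = (\<Sum>j\<in>?P (Suc m) b. \<Prod>s=1..Suc m. K (j (s - 1)) (j s))"
  proof (rule sum.reindex_bij_witness[where i = "\<lambda>j. (j m, restrict j {0..m})"
        and j = "\<lambda>(c, j). j(Suc m := b)"])
    fix cj assume cj: "cj \<in> Sigma {..<n} (?P m)"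
    obtain c j where [simp]: "cj = (c, j)" by (cases cj)
    from cj have j: "j \<in> {0..m} \<rightarrow>\<^sub>E {..<n}" "j 0 = a" "j m = c" by auto
    \<comment> \<open>Since \<open>j\<close> is extensional, its value at \<open>Suc m\<close> is
      fixed; restricting the extended walk to \<open>{0..m}\<close> therefore recovers
      \<open>j\<close> exactly.\<close>
    have "j (Suc m) = undefined" using j(1) by (auto simp: PiE_def extensional_def)
    then show "(\<lambda>j. (j m, restrict j {0..m})) (case cj of (c, j) \<Rightarrow> j(Suc m := b)) = cj"
      using j by (auto simp: fun_eq_iff PiE_def extensional_def restrict_def)
    show "(case cj of (c, j) \<Rightarrow> j(Suc m := b)) \<in> ?P (Suc m) b"
      using j Suc.prems by (auto simp: PiE_def extensional_def Pi_def le_Suc_eq)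
    have "(\<Prod>s=1..m. K ((j(Suc m := b)) (s - 1)) ((j(Suc m := b)) s)) = (\<Prod>s=1..m. K (j (s - 1)) (j s))"
      by (intro prod.cong) auto
    then show "(\<Prod>s=1..Suc m. K ((case cj of (c, j) \<Rightarrow> j(Suc m := b)) (s - 1)) ((case cj of (c, j) \<Rightarrow> j(Suc m := b)) s))
      = (case cj of (c, j) \<Rightarrow> (\<Prod>s=1..m. K (j (s - 1)) (j s)) * K c b)"
      using j by (simp add: prod.nat_ivl_Suc')
  next
    fix j assume j: "j \<in> ?P (Suc m) b"
    then show "(case (j m, restrict j {0..m}) of (c, j) \<Rightarrow> j(Suc m := b)) = j"
      by (auto simp: fun_eq_iff PiE_def extensional_def restrict_def le_Suc_eq)
    show "(j m, restrict j {0..m}) \<in> Sigma {..<n} (?P m)"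
      using j by (auto simp: PiE_def Pi_def)
  qed
  finally show ?case .
qed

lemma trace_pow_mat:
  fixes K :: "nat \<Rightarrow> nat \<Rightarrow> complex"
  shows "(\<Sum>i<n. (mat n n (\<lambda>(i, j). K i j) ^\<^sub>m m) $$ (i, i)) =
    (\<Sum>j\<in>{j \<in> {0..m} \<rightarrow>\<^sub>E {..<n}. j 0 = j m}. \<Prod>s=1..m. K (j (s - 1)) (j s))"
proof -
  let ?P = "\<lambda>i. {j \<in> {0..m} \<rightarrow>\<^sub>E {..<n}. j 0 = i \<and> j m = i}"
  have fin: "finite (?P i)" for i by (rule finite_subset[OF _ finite_PiE[of "{0..m}" "\<lambda>_. {..<n}"]]) auto
  have "{j \<in> {0..m} \<rightarrow>\<^sub>E {..<n}. j 0 = j m} = (\<Union>i<n. ?P i)" by (auto simp: PiE_def Pi_def)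
  then show ?thesis
    using fin by (simp add: pow_mat_paths) (subst sum.UNION_disjoint, auto)
qed

section \<open>Functionals and nuclear operators\<close>

abbreviation "lp_dual p \<equiv> dual_space (lp p) (lp_norm p)"
abbreviation "lp_dnorm p \<equiv> dual_norm (lp p) (lp_norm p)"

context
  fixes p :: real
  assumes p: "1 \<le> p"
begin

lemma dual_add: "\<phi> \<in> lp_dual p \<Longrightarrow> x \<in> lp p \<Longrightarrow> y \<in> lp p \<Longrightarrow> \<phi> (x + y) = \<phi> x + \<phi> y"
  and dual_cscale: "\<phi> \<in> lp_dual p \<Longrightarrow> x \<in> lp p \<Longrightarrow> \<phi> (cscale c x) = c * \<phi> x"
  unfolding dual_space_def by blast+

lemma dual_zero: "\<phi> \<in> lp_dual p \<Longrightarrow> \<phi> 0 = 0"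
  using dual_add[of \<phi> 0 0] by simp

lemma dual_diff: "\<phi> \<in> lp_dual p \<Longrightarrow> x \<in> lp p \<Longrightarrow> y \<in> lp p \<Longrightarrow> \<phi> (x - y) = \<phi> x - \<phi> y"
  using dual_add[of \<phi> "x - y" y] lp_diff(1)[OF p, of x y] by simp

lemma dual_sum_arg:
  assumes "\<phi> \<in> lp_dual p" "\<And>n. n \<in> S \<Longrightarrow> x n \<in> lp p"
  shows "\<phi> (\<Sum>n\<in>S. x n) = (\<Sum>n\<in>S. \<phi> (x n))"
  using assms(2)
proof (induction S rule: infinite_finite_induct)
  case (insert n S)
  then show ?case using dual_add[OF assms(1), of "x n" "sum x S"] lp_sum[OF p, of S x]
    by (simp del: plus_fun_apply)
qed (simp_all add: dual_zero[OF assms(1)])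

text \<open>Boundedness of the functional makes the set under \<open>SUP\<close> bounded above, so
  the supremum is a genuine one. Scaling to norm 1 then gives the inequality; vectors of norm 0
  cannot be scaled and are handled by the bound in \<open>dual_space\<close>.\<close>

lemma dual_bound:
  assumes \<phi>: "\<phi> \<in> lp_dual p"
  shows "x \<in> lp p \<Longrightarrow> cmod (\<phi> x) \<le> lp_dnorm p \<phi> * lp_norm p x" and "0 \<le> lp_dnorm p \<phi>"
proof -
  obtain C where C: "\<And>x. x \<in> lp p \<Longrightarrow> cmod (\<phi> x) \<le> C * lp_norm p x"
    using \<phi> unfolding dual_space_def by blast
  have bdd: "bdd_above ((\<lambda>x. cmod (\<phi> x)) ` {x \<in> lp p. lp_norm p x \<le> 1})"
  proof (rule bdd_aboveI2)
    fix x :: "'a \<Rightarrow> complex" assume x: "x \<in> {x \<in> lp p. lp_norm p x \<le> 1}"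
    then have "cmod (\<phi> x) \<le> C * lp_norm p x" using C by simp
    also have "\<dots> \<le> \<bar>C\<bar> * 1" using x by (intro mult_mono) auto
    finally show "cmod (\<phi> x) \<le> \<bar>C\<bar> * 1" .
  qed
  have le: "cmod (\<phi> x) \<le> lp_dnorm p \<phi>" if "x \<in> lp p" "lp_norm p x \<le> 1" for x
    unfolding dual_norm_def using that by (intro cSUP_upper[OF _ bdd]) auto
  show "0 \<le> lp_dnorm p \<phi>" using le[of 0] by (simp add: dual_zero[OF \<phi>])
  assume x: "x \<in> lp p"
  show "cmod (\<phi> x) \<le> lp_dnorm p \<phi> * lp_norm p x"
  proof (cases "lp_norm p x = 0")
    case True
    then show ?thesis using C[OF x] by simp
  next
    case False
    let ?n = "lp_norm p x"
    have pos: "?n > 0" using False by (simp add: less_le)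
    let ?u = "cscale (of_real (1 / ?n)) x"
    have "cmod (\<phi> ?u) \<le> lp_dnorm p \<phi>"
      using pos lp_cscale[OF p x, of "of_real (1 / ?n)"] by (intro le) (auto simp: norm_divide)
    then show ?thesis
      using pos by (simp add: dual_cscale[OF \<phi> x] norm_mult norm_divide field_simps)
  qed
qed

lemma dual_normI:
  fixes \<phi> :: "('a \<Rightarrow> complex) \<Rightarrow> complex"
  assumes "\<And>x. x \<in> lp p \<Longrightarrow> cmod (\<phi> x) \<le> C * lp_norm p x" "0 \<le> C"
  shows "lp_dnorm p \<phi> \<le> C"
  unfolding dual_norm_def
proof (rule cSUP_least)
  show "{x \<in> lp p. lp_norm p x \<le> 1} \<noteq> {}" using lp_zero[of p] by (metis (mono_tags) mem_Collect_eq empty_iff zero_le_one)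
  fix x :: "'a \<Rightarrow> complex" assume "x \<in> {x \<in> lp p. lp_norm p x \<le> 1}"
  then show "cmod (\<phi> x) \<le> C"
    using assms(1)[of x] mult_left_mono[of "lp_norm p x" 1 C] assms(2) by auto
qed

section \<open>Construction of functionals and of dual bases in finite dimension\<close>

lemma dual_eval: "(\<lambda>x. x i) \<in> lp_dual p"
  unfolding dual_space_def using norm_le_lp_norm[OF p] by (auto simp: cscale_def intro!: exI[of _ 1])

lemma dual_lincomb:
  assumes "\<phi> \<in> lp_dual p" "\<psi> \<in> lp_dual p"
  shows "(\<lambda>x. c * \<phi> x + d * \<psi> x) \<in> lp_dual p"
proof -
  have "cmod (c * \<phi> x + d * \<psi> x) \<le> (cmod c * lp_dnorm p \<phi> + cmod d * lp_dnorm p \<psi>) * lp_norm p x"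
    if "x \<in> lp p" for x
  proof -
    have "cmod (c * \<phi> x + d * \<psi> x) \<le> cmod c * cmod (\<phi> x) + cmod d * cmod (\<psi> x)"
      by (rule order_trans[OF norm_triangle_ineq]) (simp add: norm_mult)
    also have "\<dots> \<le> cmod c * (lp_dnorm p \<phi> * lp_norm p x) + cmod d * (lp_dnorm p \<psi> * lp_norm p x)"
      by (intro add_mono mult_left_mono dual_bound assms that) auto
    finally show ?thesis by (simp add: algebra_simps)
  qed
  then have "\<exists>C. \<forall>x\<in>lp p. cmod (c * \<phi> x + d * \<psi> x) \<le> C * lp_norm p x" by blast
  then show ?thesis
    unfolding dual_space_def
    using dual_add[OF assms(1)] dual_add[OF assms(2)] dual_cscale[OF assms(1)] dual_cscale[OF assms(2)]
    by (simp add: algebra_simps del: plus_fun_apply)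
qed

lemma dual_sum:
  assumes "\<And>n. n \<in> S \<Longrightarrow> \<phi> n \<in> lp_dual p"
  shows "(\<lambda>x. \<Sum>n\<in>S. c n * \<phi> n x) \<in> lp_dual p"
  using assms
proof (induction S rule: infinite_finite_induct)
  case (insert n S)
  then show ?case using dual_lincomb[of "\<phi> n" "\<lambda>x. \<Sum>n\<in>S. c n * \<phi> n x" "c n" 1] by simp
qed (auto simp: dual_space_def intro!: exI[of _ 0])

text \<open>Evaluations at coordinates are bounded and separate the points of \<open>lp p\<close>.
  Elimination with suitable coordinates, one basis vector at a time, produces the dual
  family.\<close>

lemma dual_basis:
  fixes b :: "nat \<Rightarrow> 'a \<Rightarrow> complex"
  assumes "inj_on b {..<n}" "cfun.independent (b ` {..<n})" "b ` {..<n} \<subseteq> lp p"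
  shows "\<exists>L. \<forall>i<n. L i \<in> lp_dual p \<and> (\<forall>j<n. L i (b j) = (if i = j then 1 else 0))"
  using assms
proof (induction n)
  case (Suc n)
  have bn: "b n \<notin> b ` {..<n}" and inj: "inj_on b {..<n}"
    using Suc.prems(1) by (simp_all add: lessThan_Suc)
  have ind: "cfun.independent (b ` {..<n})" "b n \<notin> cfun.span (b ` {..<n})"
    using Suc.prems(2) bn by (simp_all add: lessThan_Suc cfun.independent_insert)
  have V: "b j \<in> lp p" if "j \<le> n" for j using Suc.prems(3) that by auto
  obtain L where L: "\<And>i. i < n \<Longrightarrow> L i \<in> lp_dual p"
      "\<And>i j. i < n \<Longrightarrow> j < n \<Longrightarrow> L i (b j) = (if i = j then 1 else 0)"
    using Suc.IH[OF inj ind(1)] Suc.prems(3) by (auto simp: lessThan_Suc)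
  \<comment> \<open>\<open>b'\<close> is the part of \<open>b n\<close> annihilated by all
    functionals found so far. It is nonzero by independence, and any coordinate \<open>a\<close> at
    which it does not vanish serves as pivot.\<close>
  define b' where "b' = b n - (\<Sum>i<n. cscale (L i (b n)) (b i))"
  have "(\<Sum>i<n. cscale (L i (b n)) (b i)) \<in> cfun.span (b ` {..<n})"
    by (intro cfun.span_sum cfun.span_scale cfun.span_base) auto
  then have "b' \<noteq> 0" using ind(2) by (auto simp: b'_def)
  then obtain a where a: "b' a \<noteq> 0" by (auto simp: fun_eq_iff)
  have b'a: "b' a = b n a - (\<Sum>i<n. L i (b n) * b i a)"
    by (simp add: b'_def sum_fun_eval cscale_def)
  \<comment> \<open>Evaluation at the pivot after the same projection, normalised: 0 on the earlier
    \<open>b j\<close> and 1 on \<open>b n\<close>.\<close>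
  define M where "M = (\<lambda>x. 1 / b' a * x a + (- 1 / b' a) * (\<Sum>i<n. b i a * L i x))"
  have M: "M \<in> lp_dual p"
    unfolding M_def by (intro dual_lincomb dual_eval dual_sum L(1)) auto
  have M_eq: "M x = (x a - (\<Sum>i<n. L i x * b i a)) / b' a" for x
    by (simp add: M_def diff_divide_distrib mult.commute)
  have Mn: "M (b n) = 1" using a unfolding M_eq b'a[symmetric] by simp
  have Mj: "M (b j) = 0" if "j < n" for j
  proof -
    have "(\<Sum>i<n. L i (b j) * b i a) = (\<Sum>i<n. if i = j then b i a else 0)"
      using that by (intro sum.cong) (auto simp: L(2))
    then show ?thesis using that by (simp add: M_eq)
  qed
  \<comment> \<open>Only the values at \<open>b n\<close> need repair, and a multiple of
    \<open>M\<close> changes nothing on the earlier basis vectors.\<close>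
  define L' where "L' i = (if i < n then (\<lambda>x. 1 * L i x + (- L i (b n)) * M x) else M)" for i
  have "L' i \<in> lp_dual p" for i
    unfolding L'_def using dual_lincomb[OF L(1) M, of i 1 "- L i (b n)"] M by (simp del: mult_minus_left)
  moreover have "L' i (b j) = (if i = j then 1 else 0)" if "i < Suc n" "j < Suc n" for i j
    using that L(2) Mn Mj by (auto simp: L'_def less_Suc_eq)
  ultimately show ?case by blast
qed simp

lemma span_subset_lp: "S \<subseteq> lp p \<Longrightarrow> cfun.span S \<subseteq> lp p"
  by (rule cfun.span_minimal[OF _ lp_subspace[OF p]])

lemma dual_basis_expand:
  fixes n :: nat
  assumes L: "\<And>i. i < n \<Longrightarrow> L i \<in> lp_dual p"
    and Lb: "\<And>i j. i < n \<Longrightarrow> j < n \<Longrightarrow> L i (b j) = (if i = j then 1 else 0)"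
    and b: "b ` {..<n} \<subseteq> lp p" and v: "v \<in> cfun.span (b ` {..<n})"
  shows "v = (\<Sum>i<n. cscale (L i v) (b i))"
proof -
  have "v \<in> lp p \<and> v = (\<Sum>i<n. cscale (L i v) (b i))"
    using v
  proof (rule cfun.span_induct)
    show "cfun.subspace {v. v \<in> lp p \<and> v = (\<Sum>i<n. cscale (L i v) (b i))}"
    proof (rule cfun.subspaceI, goal_cases)
      case 1
      have "(\<Sum>i<n. cscale (L i 0) (b i)) = 0"
        by (intro sum.neutral) (simp add: dual_zero[OF L])
      then show ?case by simp
    next
      case (2 x y)
      have "(\<Sum>i<n. cscale (L i (x + y)) (b i)) =
          (\<Sum>i<n. cscale (L i x) (b i)) + (\<Sum>i<n. cscale (L i y) (b i))"
        using 2 by (simp add: dual_add[OF L] cfun.scale_left_distrib sum.distrib)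
      then show ?case using 2 lp_add(1)[OF p, of x y] by simp
    next
      case (3 c x)
      have "(\<Sum>i<n. cscale (L i (cscale c x)) (b i)) = cscale c (\<Sum>i<n. cscale (L i x) (b i))"
        unfolding cfun.scale_sum_right using 3 by (intro sum.cong refl) (simp add: dual_cscale[OF L])
      then show ?case using 3 lp_cscale(1)[OF p, of x c] by simp
    qed
  next
    fix x assume "x \<in> b ` {..<n}"
    then obtain j where j: "j < n" "x = b j" by auto
    have "(\<Sum>i<n. cscale (L i (b j)) (b i)) = (\<Sum>i\<in>{j}. cscale (L i (b j)) (b i))"
      using j by (intro sum.mono_neutral_right) (auto simp: Lb)
    then show "x \<in> lp p \<and> x = (\<Sum>i<n. cscale (L i x) (b i))"
      using j b by (auto simp: Lb)
  qed
  then show ?thesis by blast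
qed

text \<open>Bounded coordinates on a finite-dimensional subspace. It is applied to the range of a
  finite-rank \<open>F\<close>, to the summand \<open>M\<close> of a decomposition, and to the part
  of \<open>M\<close> inside the kernel of \<open>F\<close>.\<close>

lemma finite_dim_dual_basis:
  fixes U :: "('a \<Rightarrow> complex) set"
  assumes U: "cfun.subspace U" "U \<subseteq> lp p" and S: "finite S" "U \<subseteq> cfun.span S"
  obtains n :: nat and b L where "inj_on b {..<n}" "cfun.independent (b ` {..<n})" "cfun.span (b ` {..<n}) = U"
    "\<And>i. i < n \<Longrightarrow> L i \<in> lp_dual p"
    "\<And>i j. i < n \<Longrightarrow> j < n \<Longrightarrow> L i (b j) = (if i = j then 1 else 0)"
    "\<And>v. v \<in> U \<Longrightarrow> v = (\<Sum>i<n. cscale (L i v) (b i))"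
proof -
  obtain B where B: "B \<subseteq> U" "cfun.independent B" "U \<subseteq> cfun.span B"
    using cfun.maximal_independent_subset[of U] by blast
  have "finite B"
    using cfun.independent_span_bound[OF S(1) B(2) subset_trans[OF B(1) S(2)]] by (rule conjunct1)
  then obtain b where "bij_betw b {0..<card B} B" using ex_bij_betw_nat_finite by blast
  then have b: "inj_on b {..<card B}" "b ` {..<card B} = B"
    by (auto simp: bij_betw_def lessThan_atLeast0)
  have bV: "b ` {..<card B} \<subseteq> lp p" unfolding b(2) by (rule subset_trans[OF B(1) U(2)])
  have ind: "cfun.independent (b ` {..<card B})" using b(2) B(2) by simp
  obtain L where L: "\<And>i. i < card B \<Longrightarrow> L i \<in> lp_dual p"
    "\<And>i j. i < card B \<Longrightarrow> j < card B \<Longrightarrow> L i (b j) = (if i = j then 1 else 0)"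
    using dual_basis[OF b(1) ind bV] by metis
  have span: "cfun.span (b ` {..<card B}) = U"
    unfolding b(2) using B(3) cfun.span_minimal[OF B(1) U(1)] by (rule subset_antisym[rotated])
  show ?thesis
  proof (rule that[OF b(1) ind span L])
    show "v = (\<Sum>i<card B. cscale (L i v) (b i))" if "v \<in> U" for v
      by (rule dual_basis_expand[OF L bV]) (simp_all add: span that)
  qed
qed

lemma linear_image_subspace:
  assumes lin: "linear_op_on (lp p) F"
  shows "cfun.subspace (F ` lp p)"
proof (rule cfun.subspaceI)
  have Fadd: "F (x + y) = F x + F y" if "x \<in> lp p" "y \<in> lp p" for x y
    using lin that unfolding linear_op_on_def by blast
  have Fsc: "F (cscale c x) = cscale c (F x)" if "x \<in> lp p" for c x
    using lin that unfolding linear_op_on_def by blast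
  have "F 0 = 0" using Fsc[of 0 0] by simp
  then show "0 \<in> F ` lp p" by (metis imageI lp_zero(1))
  show "x + y \<in> F ` lp p" if "x \<in> F ` lp p" "y \<in> F ` lp p" for x y
  proof -
    from that obtain a c where "x = F a" "a \<in> lp p" "y = F c" "c \<in> lp p" by blast
    then show ?thesis using Fadd[of a c] lp_add(1)[OF p, of a c] by (metis imageI)
  qed
  show "cscale c x \<in> F ` lp p" if "x \<in> F ` lp p" for c x
  proof -
    from that obtain a where "x = F a" "a \<in> lp p" by blast
    then show ?thesis using Fsc[of a c] lp_cscale(1)[OF p, of a c] by (metis imageI)
  qed
qed

section \<open>Rank-one terms and nuclear representations\<close>

lemma rank_one_bound:
  assumes "\<phi> \<in> lp_dual p" "y \<in> lp p" "x \<in> lp p"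
  shows "cscale (\<phi> x) y \<in> lp p" "lp_norm p (cscale (\<phi> x) y) \<le> lp_dnorm p \<phi> * lp_norm p y * lp_norm p x"
  using lp_cscale[OF p assms(2), of "\<phi> x"] mult_right_mono[OF dual_bound(1)[OF assms(1,3)], of "lp_norm p y"]
  by (simp_all add: ac_simps)

lemma rank_one_sum_bound:
  fixes x :: "'a \<Rightarrow> complex"
  assumes "\<And>n. n \<in> S \<Longrightarrow> \<phi> n \<in> lp_dual p" "\<And>n. n \<in> S \<Longrightarrow> y n \<in> lp p" "x \<in> lp p"
  shows "(\<Sum>n\<in>S. cscale (\<phi> n x) (y n)) \<in> lp p"
    "lp_norm p (\<Sum>n\<in>S. cscale (\<phi> n x) (y n)) \<le> (\<Sum>n\<in>S. lp_dnorm p (\<phi> n) * lp_norm p (y n)) * lp_norm p x"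
proof -
  have *: "(\<Sum>n\<in>S. cscale (\<phi> n x) (y n)) \<in> lp p \<and>
      lp_norm p (\<Sum>n\<in>S. cscale (\<phi> n x) (y n)) \<le> (\<Sum>n\<in>S. lp_norm p (cscale (\<phi> n x) (y n)))"
    by (intro lp_sum[OF p] rank_one_bound assms)
  then show "(\<Sum>n\<in>S. cscale (\<phi> n x) (y n)) \<in> lp p" by blast
  have "(\<Sum>n\<in>S. lp_norm p (cscale (\<phi> n x) (y n))) \<le> (\<Sum>n\<in>S. lp_dnorm p (\<phi> n) * lp_norm p (y n)) * lp_norm p x"
    unfolding sum_distrib_right by (intro sum_mono rank_one_bound assms)
  with * show "lp_norm p (\<Sum>n\<in>S. cscale (\<phi> n x) (y n)) \<le> (\<Sum>n\<in>S. lp_dnorm p (\<phi> n) * lp_norm p (y n)) * lp_norm p x"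
    by linarith
qed

lemma nuclear_repD:
  assumes "nuclear_rep (lp p) (lp_norm p) T \<phi> y"
  shows "\<phi> n \<in> lp_dual p" "y n \<in> lp p" "summable (\<lambda>n. lp_dnorm p (\<phi> n) * lp_norm p (y n))"
    "x \<in> lp p \<Longrightarrow> (\<lambda>k. lp_norm p (T x - (\<Sum>n<k. cscale (\<phi> n x) (y n)))) \<longlonglongrightarrow> 0"
  using assms unfolding nuclear_rep_def by blast+

lemma weight_nonneg: "\<phi> \<in> lp_dual p \<Longrightarrow> 0 \<le> lp_dnorm p \<phi> * lp_norm p y"
  by (simp add: dual_bound(2))

lemma lp_tendsto_pointwise:
  fixes x :: "'a \<Rightarrow> complex"
  assumes "(\<lambda>k. lp_norm p (x - g k)) \<longlonglongrightarrow> 0" "x \<in> lp p" "\<And>k. g k \<in> lp p"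
  shows "(\<lambda>k. g k i) \<longlonglongrightarrow> x i"
proof -
  have "(\<lambda>k. x i - g k i) \<longlonglongrightarrow> 0"
    by (rule tendsto_0_le[OF assms(1), of _ 1])
      (use norm_le_lp_norm[OF p lp_diff(1)[OF p assms(2,3)], where i = i] in simp)
  from tendsto_diff[OF tendsto_const[of "x i"] this] show ?thesis by simp
qed

lemma nuclear_rep_pointwise:
  assumes rep: "nuclear_rep (lp p) (lp_norm p) T \<phi> y" and T: "linear_op_on (lp p) T" and x: "x \<in> lp p"
  shows "(\<lambda>k. \<Sum>n<k. \<phi> n x * y n i) \<longlonglongrightarrow> T x i"
proof -
  have "(\<lambda>k. (\<Sum>n<k. cscale (\<phi> n x) (y n)) i) \<longlonglongrightarrow> T x i"
  proof (rule lp_tendsto_pointwise[OF nuclear_repD(4)[OF rep x]])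
    show "T x \<in> lp p" using T x by (simp add: linear_op_on_def)
    show "(\<Sum>n<k. cscale (\<phi> n x) (y n)) \<in> lp p" for k
      by (rule rank_one_sum_bound(1)[OF nuclear_repD(1)[OF rep] nuclear_repD(2)[OF rep] x])
  qed
  then show ?thesis by (simp add: sum_fun_eval cscale_def)
qed

lemma nuclear_rep_bound:
  assumes rep: "nuclear_rep (lp p) (lp_norm p) T \<phi> y" and T: "linear_op_on (lp p) T" and x: "x \<in> lp p"
  shows "lp_norm p (T x) \<le> (\<Sum>n. lp_dnorm p (\<phi> n) * lp_norm p (y n)) * lp_norm p x"
proof (rule lp_fatou(2)[OF p])
  let ?w = "\<lambda>n. lp_dnorm p (\<phi> n) * lp_norm p (y n)"
  note D = nuclear_repD[OF rep]
  have w: "0 \<le> ?w n" for n by (rule weight_nonneg[OF D(1)])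
  show "0 \<le> (\<Sum>n. ?w n) * lp_norm p x" by (intro mult_nonneg_nonneg[OF suminf_nonneg] D w) simp
  show "(\<Sum>n<k. cscale (\<phi> n x) (y n)) \<in> lp p" for k by (intro rank_one_sum_bound D x)
  have "lp_norm p (\<Sum>n<k. cscale (\<phi> n x) (y n)) \<le> (\<Sum>n. ?w n) * lp_norm p x" for k
  proof -
    have "lp_norm p (\<Sum>n<k. cscale (\<phi> n x) (y n)) \<le> (\<Sum>n<k. ?w n) * lp_norm p x"
      by (intro rank_one_sum_bound D x)
    also have "\<dots> \<le> (\<Sum>n. ?w n) * lp_norm p x"
      using w by (intro mult_right_mono sum_le_suminf D) auto
    finally show ?thesis .
  qed
  then show "\<forall>\<^sub>F k in sequentially. lp_norm p (\<Sum>n<k. cscale (\<phi> n x) (y n)) \<le> (\<Sum>n. ?w n) * lp_norm p x"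
    by simp
  show "(\<lambda>k. (\<Sum>n<k. cscale (\<phi> n x) (y n)) i) \<longlonglongrightarrow> T x i" for i
    using nuclear_rep_pointwise[OF assms] by (simp add: sum_fun_eval cscale_def)
qed

text \<open>Convergence in every coordinate is enough: the weights are summable, so Fatou's lemma
  bounds the remainders in norm by the tails of the weights. Linearity and the mapping into
  \<open>lp p\<close> follow at the same time.\<close>

lemma nuclear_repI:
  fixes T :: "('a \<Rightarrow> complex) \<Rightarrow> 'a \<Rightarrow> complex"
  assumes \<phi>: "\<And>n. \<phi> n \<in> lp_dual p" and y: "\<And>n. y n \<in> lp p"
    and sm: "summable (\<lambda>n. lp_dnorm p (\<phi> n) * lp_norm p (y n))"
    and lim: "\<And>x i. x \<in> lp p \<Longrightarrow> (\<lambda>k. \<Sum>n<k. \<phi> n x * y n i) \<longlonglongrightarrow> T x i"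
  shows "linear_op_on (lp p) T" "nuclear_rep (lp p) (lp_norm p) T \<phi> y"
proof -
  let ?w = "\<lambda>n. lp_dnorm p (\<phi> n) * lp_norm p (y n)"
  have w: "0 \<le> ?w n" for n by (rule weight_nonneg[OF \<phi>])
  have R: "(\<Sum>n\<in>S. cscale (\<phi> n x) (y n)) \<in> lp p" if "x \<in> lp p" for x S
    by (intro rank_one_sum_bound \<phi> y that)
  \<comment> \<open>The segments from \<open>k\<close> to \<open>m\<close> tend coordinatewise to
    this remainder as \<open>m\<close> grows. The case \<open>k = 0\<close> is what places
    \<open>T x\<close> in \<open>lp p\<close>.\<close>
  have tail: "T x - (\<Sum>n<k. cscale (\<phi> n x) (y n)) \<in> lp p \<and>
     lp_norm p (T x - (\<Sum>n<k. cscale (\<phi> n x) (y n))) \<le> ((\<Sum>n. ?w n) - (\<Sum>n<k. ?w n)) * lp_norm p x"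
    if x: "x \<in> lp p" for x k
  proof -
    let ?g = "\<lambda>m. (\<Sum>n\<in>{k..<m}. cscale (\<phi> n x) (y n))"
    have "lp_norm p (?g m) \<le> ((\<Sum>n. ?w n) - (\<Sum>n<k. ?w n)) * lp_norm p x" if "k \<le> m" for m
    proof -
      have "lp_norm p (?g m) \<le> (\<Sum>n\<in>{k..<m}. ?w n) * lp_norm p x"
        by (intro rank_one_sum_bound \<phi> y x)
      also have "(\<Sum>n\<in>{k..<m}. ?w n) = (\<Sum>n<m. ?w n) - (\<Sum>n<k. ?w n)"
        using that by (simp add: sum_diff_nat_ivl lessThan_atLeast0)
      also have "\<dots> * lp_norm p x \<le> ((\<Sum>n. ?w n) - (\<Sum>n<k. ?w n)) * lp_norm p x"
        using w by (intro mult_right_mono diff_right_mono sum_le_suminf sm) auto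
      finally show ?thesis .
    qed
    then have ev: "\<forall>\<^sub>F m in sequentially. lp_norm p (?g m) \<le> ((\<Sum>n. ?w n) - (\<Sum>n<k. ?w n)) * lp_norm p x"
      by (auto simp: eventually_sequentially)
    have nn: "0 \<le> ((\<Sum>n. ?w n) - (\<Sum>n<k. ?w n)) * lp_norm p x"
      using w sum_le_suminf[OF sm, of "{..<k}"] by (intro mult_nonneg_nonneg) auto
    have ptw: "(\<lambda>m. ?g m i) \<longlonglongrightarrow> (T x - (\<Sum>n<k. cscale (\<phi> n x) (y n))) i" for i
    proof -
      have "(\<lambda>m. (\<Sum>n<m. \<phi> n x * y n i) - (\<Sum>n<k. \<phi> n x * y n i)) \<longlonglongrightarrow> T x i - (\<Sum>n<k. \<phi> n x * y n i)"
        by (intro tendsto_diff lim x tendsto_const)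
      moreover have "\<forall>\<^sub>F m in sequentially. (\<Sum>n<m. \<phi> n x * y n i) - (\<Sum>n<k. \<phi> n x * y n i) = ?g m i"
        unfolding eventually_sequentially
        by (intro exI[of _ k]) (simp add: sum_diff_nat_ivl lessThan_atLeast0 sum_fun_eval cscale_def)
      ultimately show ?thesis
        by (auto simp: sum_fun_eval cscale_def dest: Lim_transform_eventually)
    qed
    show ?thesis using lp_fatou[OF p nn R[OF x] ev ptw] by blast
  qed
  have TV: "T x \<in> lp p" if "x \<in> lp p" for x using tail[OF that, of 0] by simp
  show "linear_op_on (lp p) T"
    unfolding linear_op_on_def
  proof (intro conjI ballI allI)
    fix x y' :: "'a \<Rightarrow> complex" assume xy: "x \<in> lp p" "y' \<in> lp p"
    show "T (x + y') = T x + T y'"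
    proof
      fix i
      have "(\<lambda>k. (\<Sum>n<k. \<phi> n x * y n i) + (\<Sum>n<k. \<phi> n y' * y n i)) \<longlonglongrightarrow> T x i + T y' i"
        by (intro tendsto_add lim xy)
      then have "(\<lambda>k. \<Sum>n<k. \<phi> n (x + y') * y n i) \<longlonglongrightarrow> T x i + T y' i"
        by (simp add: dual_add[OF \<phi>] xy distrib_right sum.distrib del: plus_fun_apply)
      then show "T (x + y') i = (T x + T y') i"
        using LIMSEQ_unique[OF lim[OF lp_add(1)[OF p xy]]] by simp
    qed
  next
    fix c and x :: "'a \<Rightarrow> complex" assume x: "x \<in> lp p"
    show "T (cscale c x) = cscale c (T x)"
    proof
      fix i
      have "(\<lambda>k. c * (\<Sum>n<k. \<phi> n x * y n i)) \<longlonglongrightarrow> c * T x i"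
        by (intro tendsto_mult tendsto_const lim x)
      then have "(\<lambda>k. \<Sum>n<k. \<phi> n (cscale c x) * y n i) \<longlonglongrightarrow> c * T x i"
        by (simp add: dual_cscale[OF \<phi> x] sum_distrib_left mult.assoc)
      then show "T (cscale c x) i = cscale c (T x) i"
        using LIMSEQ_unique[OF lim[OF lp_cscale(1)[OF p x]]] by (simp add: cscale_def)
    qed
  qed (rule TV)
  show "nuclear_rep (lp p) (lp_norm p) T \<phi> y"
    unfolding nuclear_rep_def
  proof (intro conjI ballI allI)
    fix x :: "'a \<Rightarrow> complex" assume x: "x \<in> lp p"
    have "(\<lambda>k. ((\<Sum>n. ?w n) - (\<Sum>n<k. ?w n)) * lp_norm p x) \<longlonglongrightarrow> ((\<Sum>n. ?w n) - (\<Sum>n. ?w n)) * lp_norm p x"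
      by (intro tendsto_intros summable_LIMSEQ sm)
    then show "(\<lambda>k. lp_norm p (T x - (\<Sum>n<k. cscale (\<phi> n x) (y n)))) \<longlonglongrightarrow> 0"
      using tail[OF x] by (rule_tac tendsto_sandwich[OF _ _ tendsto_const]) simp_all
  qed (use \<phi> y sm in auto)
qed

lemma nuclear_norm_le:
  fixes T :: "('a \<Rightarrow> complex) \<Rightarrow> 'a \<Rightarrow> complex"
  assumes "nuclear_rep (lp p) (lp_norm p) T \<phi> y"
  shows "nuclear_norm (lp p) (lp_norm p) T \<le> (\<Sum>n. lp_dnorm p (\<phi> n) * lp_norm p (y n))"
  unfolding nuclear_norm_def
proof (rule cInf_lower)
  show "bdd_below {\<Sum>n. lp_dnorm p (\<phi> n) * lp_norm p (y n) | \<phi> y. nuclear_rep (lp p) (lp_norm p) T \<phi> y}"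
  proof (rule bdd_belowI[of _ 0], clarify)
    fix \<phi> y assume rep: "nuclear_rep (lp p) (lp_norm p) T \<phi> y"
    show "0 \<le> (\<Sum>n. lp_dnorm p (\<phi> n) * lp_norm p (y n))"
      by (intro suminf_nonneg nuclear_repD(3)[OF rep] weight_nonneg nuclear_repD(1)[OF rep])
  qed
qed (use assms in blast)

text \<open>The given representation certifies that the set under \<open>Inf\<close> is nonempty;
  only then does a small value of \<open>nuclear_norm\<close> produce a representation of small
  weight.\<close>

lemma nuclear_norm_lessD:
  assumes "nuclear_rep (lp p) (lp_norm p) T \<phi>' y'" "nuclear_norm (lp p) (lp_norm p) T < e"
  obtains \<phi> y where "nuclear_rep (lp p) (lp_norm p) T \<phi> y" "(\<Sum>n. lp_dnorm p (\<phi> n) * lp_norm p (y n)) < e"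
proof -
  have ne: "{\<Sum>n. lp_dnorm p (\<phi> n) * lp_norm p (y n) | \<phi> y. nuclear_rep (lp p) (lp_norm p) T \<phi> y} \<noteq> {}"
    using assms(1) by blast
  from cInf_lessD[OF ne] assms(2) show ?thesis
    unfolding nuclear_norm_def using that by blast
qed

lemma dual_compose_finite_rank:
  assumes L: "L \<in> lp_dual p" and F: "finite_rank_on (lp p) (lp_norm p) F"
  shows "(\<lambda>x. L (F x)) \<in> lp_dual p"
proof -
  from F obtain C where lin: "linear_op_on (lp p) F"
    and C: "\<And>x. x \<in> lp p \<Longrightarrow> lp_norm p (F x) \<le> C * lp_norm p x"
    unfolding finite_rank_on_def by blast
  have FV: "F x \<in> lp p" if "x \<in> lp p" for x using lin that unfolding linear_op_on_def by blast
  have "cmod (L (F x)) \<le> (lp_dnorm p L * C) * lp_norm p x" if "x \<in> lp p" for x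
    using dual_bound(1)[OF L FV[OF that]] mult_left_mono[OF C[OF that] dual_bound(2)[OF L]]
    by (simp add: mult.assoc)
  then have "\<exists>C. \<forall>x\<in>lp p. cmod (L (F x)) \<le> C * lp_norm p x" by blast
  then show ?thesis
    using lin FV unfolding dual_space_def linear_op_on_def
    by (simp add: dual_add[OF L] dual_cscale[OF L])
qed

lemma finite_rank_expand:
  fixes F :: "('a \<Rightarrow> complex) \<Rightarrow> 'a \<Rightarrow> complex"
  assumes F: "finite_rank_on (lp p) (lp_norm p) F"
  obtains n :: nat and \<psi> b where "\<And>i. i < n \<Longrightarrow> \<psi> i \<in> lp_dual p" "\<And>i. i < n \<Longrightarrow> b i \<in> lp p"
    "\<And>x. x \<in> lp p \<Longrightarrow> F x = (\<Sum>i<n. cscale (\<psi> i x) (b i))"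
proof -
  from F obtain S where lin: "linear_op_on (lp p) F" and S: "finite S" "F ` lp p \<subseteq> cfun.span S"
    unfolding finite_rank_on_def by blast
  have FV: "F ` lp p \<subseteq> lp p" using lin unfolding linear_op_on_def by blast
  obtain n :: nat and b L where "inj_on b {..<n}" "cfun.independent (b ` {..<n})"
    and span: "cfun.span (b ` {..<n}) = F ` lp p"
    and L: "\<And>i. i < n \<Longrightarrow> L i \<in> lp_dual p"
    and "\<And>i j. i < n \<Longrightarrow> j < n \<Longrightarrow> L i (b j) = (if i = j then 1 else 0)"
    and expand: "\<And>v. v \<in> F ` lp p \<Longrightarrow> v = (\<Sum>i<n. cscale (L i v) (b i))"
    by (rule finite_dim_dual_basis[OF linear_image_subspace[OF lin] FV S]) (rule that; assumption)
  show ?thesis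
  proof (rule that)
    fix i assume i: "i < n"
    have "b i \<in> F ` lp p" unfolding span[symmetric] by (rule cfun.span_base) (use i in simp)
    then show "b i \<in> lp p" using FV by blast
    show "(\<lambda>x. L i (F x)) \<in> lp_dual p" by (rule dual_compose_finite_rank[OF L[OF i] F])
  next
    fix x :: "'a \<Rightarrow> complex" assume x: "x \<in> lp p"
    show "F x = (\<Sum>i<n. cscale (L i (F x)) (b i))" by (rule expand[OF imageI[OF x]])
  qed
qed

end

section \<open>Finite sections\<close>

abbreviation unit_at :: "nat \<Rightarrow> int \<Rightarrow> complex"
  where "unit_at j \<equiv> unit_seq (int_decode j)"

text \<open>
  The determinant of \<open>I + G\<close> compressed to the first \<open>k\<close> coordinates, where \<open>int_decode\<close>
  enumerates the index set.
\<close>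

definition section_det :: "nat \<Rightarrow> ((int \<Rightarrow> complex) \<Rightarrow> int \<Rightarrow> complex) \<Rightarrow> complex"
  where "section_det k G = Determinant.det
    (mat k k (\<lambda>(i, j). (if i = j then 1 else 0) + G (unit_at j) (int_decode i)))"

context
  fixes p :: real
  assumes p: "1 \<le> p"
begin

text \<open>Truncations of a fixed vector converge in norm, so a functional is determined by its
  values on unit vectors. The limit of finite-rank sections and the uniqueness of the operator with
  a given kernel both rest on this.\<close>

lemma dual_lp_cut:
  assumes \<phi>: "\<phi> \<in> lp_dual p" and f: "f \<in> lp p"
  shows "\<phi> (lp_cut k f) = (\<Sum>n<k. f (int_decode n) * \<phi> (unit_at n))"
    "(\<lambda>k. \<phi> (lp_cut k f)) \<longlonglongrightarrow> \<phi> f"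
proof -
  show "\<phi> (lp_cut k f) = (\<Sum>n<k. f (int_decode n) * \<phi> (unit_at n))"
    unfolding lp_cut_def
    by (subst dual_sum_arg[OF p \<phi>])
      (simp_all add: lp_cscale(1)[OF p] unit_seq_lp[OF p] dual_cscale[OF p \<phi>])
  have "(\<lambda>k. \<phi> f - \<phi> (lp_cut k f)) \<longlonglongrightarrow> 0"
  proof (rule tendsto_0_le[OF lp_cut_tendsto[OF p f]], rule always_eventually, rule allI)
    fix k
    have "cmod (\<phi> (f - lp_cut k f)) \<le> lp_dnorm p \<phi> * lp_norm p (f - lp_cut k f)"
      by (intro dual_bound[OF p \<phi>] lp_diff(1)[OF p] f lp_cut_lp(1)[OF p])
    then show "norm (\<phi> f - \<phi> (lp_cut k f)) \<le> norm (lp_norm p (f - lp_cut k f)) * lp_dnorm p \<phi>"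
      by (simp add: dual_diff[OF p \<phi> f lp_cut_lp(1)[OF p f]] mult.commute)
  qed
  from tendsto_diff[OF tendsto_const[of "\<phi> f"] this]
  show "(\<lambda>k. \<phi> (lp_cut k f)) \<longlonglongrightarrow> \<phi> f" by simp
qed

text \<open>Exchanging the two factors moves \<open>k\<close> out of the shape of the matrix and
  into its entries: the size becomes the fixed number \<open>n\<close>, and a determinant of fixed
  size is continuous in its entries.\<close>

lemma section_det_finite_rank:
  fixes n :: nat
  assumes \<psi>: "\<And>i. i < n \<Longrightarrow> \<psi> i \<in> lp_dual p" and b: "\<And>i. i < n \<Longrightarrow> b i \<in> lp p"
    and F: "\<And>x. x \<in> lp p \<Longrightarrow> F x = (\<Sum>i<n. cscale (\<psi> i x) (b i))"
  shows "(\<lambda>k. section_det k F) \<longlonglongrightarrow>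
    Determinant.det (mat n n (\<lambda>(i, j). (if i = j then 1 else 0) + \<psi> i (b j)))"
proof -
  have "section_det k F =
      Determinant.det (mat n n (\<lambda>(i, j). (if i = j then 1 else 0) + \<psi> i (lp_cut k (b j))))" for k
  proof -
    define A where "A = mat k n (\<lambda>(a, l). b l (int_decode a))"
    define B where "B = mat n k (\<lambda>(l, c). \<psi> l (unit_at c))"
    have AB: "A \<in> carrier_mat k n" "B \<in> carrier_mat n k" by (auto simp: A_def B_def)
    have "mat k k (\<lambda>(i, j). (if i = j then 1 else 0) + F (unit_at j) (int_decode i)) = 1\<^sub>m k + A * B"
    proof (rule eq_matI)
      fix i j assume ij: "i < dim_row (1\<^sub>m k + A * B)" "j < dim_col (1\<^sub>m k + A * B)"
      then have ij: "i < k" "j < k" using AB by auto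
      have "F (unit_at j) (int_decode i) = (\<Sum>l<n. b l (int_decode i) * \<psi> l (unit_at j))"
        by (simp add: F[OF unit_seq_lp(1)[OF p]] sum_fun_eval cscale_def mult.commute)
      also have "\<dots> = (A * B) $$ (i, j)"
        using ij by (auto simp: A_def B_def scalar_prod_def lessThan_atLeast0 intro!: sum.cong)
      finally show "mat k k (\<lambda>(i, j). (if i = j then 1 else 0) + F (unit_at j) (int_decode i)) $$ (i, j)
          = (1\<^sub>m k + A * B) $$ (i, j)"
        using ij AB by simp
    qed (use AB in auto)
    then have "section_det k F = Determinant.det (1\<^sub>m n + B * A)"
      unfolding section_det_def by (simp add: det_one_plus_mult_commute[OF AB])
    also have "1\<^sub>m n + B * A = mat n n (\<lambda>(i, j). (if i = j then 1 else 0) + \<psi> i (lp_cut k (b j)))"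
    proof (rule eq_matI)
      fix i j assume ij: "i < dim_row (mat n n (\<lambda>(i, j). (if i = j then 1 else 0) + \<psi> i (lp_cut k (b j))))"
        "j < dim_col (mat n n (\<lambda>(i, j). (if i = j then 1 else 0) + \<psi> i (lp_cut k (b j))))"
      then have ij: "i < n" "j < n" by auto
      have "\<psi> i (lp_cut k (b j)) = (B * A) $$ (i, j)"
        using ij by (auto simp: dual_lp_cut(1)[OF \<psi> b] A_def B_def scalar_prod_def lessThan_atLeast0 intro!: sum.cong)
      then show "(1\<^sub>m n + B * A) $$ (i, j) =
          mat n n (\<lambda>(i, j). (if i = j then 1 else 0) + \<psi> i (lp_cut k (b j))) $$ (i, j)"
        using ij AB by simp
    qed (use AB in auto)
    finally show ?thesis .
  qed
  then show ?thesis
    by (simp only:) (intro tendsto_det tendsto_add tendsto_const dual_lp_cut(2) \<psi> b)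
qed

text \<open>Supplies the existence needed by \<open>finite_rank_det\<close>. \<open>M\<close> is
  spanned by a basis of the range of \<open>F\<close>, which makes it invariant, together with
  preimages of that basis, so that \<open>M\<close> and the kernel span everything. The kernel may
  still meet \<open>M\<close>, so \<open>W\<close> is cut out of it by functionals dual to a basis
  of the intersection.\<close>

lemma finite_rank_split:
  fixes F :: "('a \<Rightarrow> complex) \<Rightarrow> 'a \<Rightarrow> complex"
  assumes F: "finite_rank_on (lp p) (lp_norm p) F"
  obtains M W where "cfun.subspace M" "cfun.subspace W" "M \<inter> W = {0}"
    "{u + w | u w. u \<in> M \<and> w \<in> W} = lp p" "\<exists>S. finite S \<and> cfun.span S = M"
    "F ` M \<subseteq> M" "\<forall>w\<in>W. F w = 0"
proof -
  from F obtain S where lin: "linear_op_on (lp p) F" and S: "finite S" "F ` lp p \<subseteq> cfun.span S"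
    unfolding finite_rank_on_def by blast
  have FV: "F x \<in> lp p" if "x \<in> lp p" for x using lin that unfolding linear_op_on_def by blast
  have Fadd: "F (x + y) = F x + F y" if "x \<in> lp p" "y \<in> lp p" for x y
    using lin that unfolding linear_op_on_def by blast
  have Fsc: "F (cscale c x) = cscale c (F x)" if "x \<in> lp p" for c x
    using lin that unfolding linear_op_on_def by blast
  have F0: "F 0 = 0" using Fsc[of 0 0] by simp
  have Fdiff: "F (x - y) = F x - F y" if "x \<in> lp p" "y \<in> lp p" for x y
    using Fadd[of "x - y" y] lp_diff(1)[OF p, of x y] that by simp
  have Fsum: "F (\<Sum>i\<in>I. x i) = (\<Sum>i\<in>I. F (x i))" if "\<And>i. i \<in> I \<Longrightarrow> x i \<in> lp p" for I :: "nat set" and x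
    using that
  proof (induction I rule: infinite_finite_induct)
    case (insert n I)
    then show ?case using Fadd[of "x n" "sum x I"] lp_sum[OF p, of I x] by (simp del: plus_fun_apply)
  qed (simp_all add: F0)
  have "F ` lp p \<subseteq> lp p" using FV by auto
  then obtain n :: nat and b L where "inj_on b {..<n}" "cfun.independent (b ` {..<n})"
    and span: "cfun.span (b ` {..<n}) = F ` lp p"
    and "\<And>i. i < n \<Longrightarrow> L i \<in> lp_dual p"
    and "\<And>i j. i < n \<Longrightarrow> j < n \<Longrightarrow> L i (b j) = (if i = j then 1 else 0)"
    and L: "\<And>v. v \<in> F ` lp p \<Longrightarrow> v = (\<Sum>i<n. cscale (L i v) (b i))"
    by (rule finite_dim_dual_basis[OF p linear_image_subspace[OF p lin] _ S]) (rule that; assumption)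
  have "\<exists>g. \<forall>i<n. g i \<in> lp p \<and> F (g i) = b i"
  proof -
    have "b i \<in> F ` lp p" if "i < n" for i
      unfolding span[symmetric] by (rule cfun.span_base) (use that in auto)
    then have "\<forall>i. \<exists>x. i < n \<longrightarrow> x \<in> lp p \<and> F x = b i" by (metis imageE)
    then show ?thesis by (rule choice[THEN exE]) blast
  qed
  then obtain g where g: "\<And>i. i < n \<Longrightarrow> g i \<in> lp p" "\<And>i. i < n \<Longrightarrow> F (g i) = b i" by blast
  define G where "G = b ` {..<n} \<union> g ` {..<n}"
  define M where "M = cfun.span G"
  have bV: "b i \<in> lp p" if "i < n" for i using g[OF that] FV by metis
  have GV: "G \<subseteq> lp p" unfolding G_def using bV g(1) by auto
  have MV: "M \<subseteq> lp p" unfolding M_def by (rule span_subset_lp[OF p GV])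
  have FM: "F x \<in> M" if "x \<in> lp p" for x
  proof -
    have "F x \<in> cfun.span (b ` {..<n})" unfolding span using that by simp
    then show ?thesis unfolding M_def G_def using cfun.span_mono[of "b ` {..<n}"] by blast
  qed
  have subM: "cfun.subspace M" by (simp add: M_def)
  define K where "K = {x \<in> lp p. F x = 0}"
  have subK: "cfun.subspace K"
    unfolding K_def by (rule cfun.subspaceI) (simp_all add: F0 Fadd Fsc lp_add[OF p] lp_cscale[OF p] del: plus_fun_apply)
  have fin: "finite G" by (simp add: G_def)
  have "M \<inter> K \<subseteq> lp p" "M \<inter> K \<subseteq> cfun.span G" using MV by (auto simp: M_def)
  then obtain r :: nat and e Q where "inj_on e {..<r}" "cfun.independent (e ` {..<r})"
    and espan: "cfun.span (e ` {..<r}) = M \<inter> K"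
    and Q: "\<And>i. i < r \<Longrightarrow> Q i \<in> lp_dual p"
    and Qe: "\<And>i j. i < r \<Longrightarrow> j < r \<Longrightarrow> Q i (e j) = (if i = j then 1 else 0)"
    and Qx: "\<And>v. v \<in> M \<inter> K \<Longrightarrow> v = (\<Sum>i<r. cscale (Q i v) (e i))"
    by (rule finite_dim_dual_basis[OF p cfun.subspace_inter[OF subM subK] _ fin]) (rule that; assumption)
  define W where "W = {x \<in> K. \<forall>i<r. Q i x = 0}"
  have KV: "x \<in> lp p" if "x \<in> K" for x using that by (simp add: K_def)
  have subW: "cfun.subspace W"
    unfolding W_def
    by (rule cfun.subspaceI) (simp_all add: cfun.subspace_0[OF subK] cfun.subspace_add[OF subK]
      cfun.subspace_scale[OF subK] dual_zero[OF p Q] dual_add[OF p Q] dual_cscale[OF p Q] KV del: plus_fun_apply)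
  have e: "e i \<in> M \<inter> K" if "i < r" for i
    unfolding espan[symmetric] by (rule cfun.span_base) (use that in auto)
  show ?thesis
  proof (rule that[OF subM subW])
    show "M \<inter> W = {0}"
    proof (intro equalityI subsetI)
      fix x assume x: "x \<in> M \<inter> W"
      then have "x = (\<Sum>i<r. cscale (Q i x) (e i))" by (intro Qx) (auto simp: W_def)
      also have "\<dots> = 0" using x by (intro sum.neutral) (auto simp: W_def)
      finally show "x \<in> {0}" by simp
    qed (use cfun.subspace_0[OF subM] cfun.subspace_0[OF subW] in auto)
    show "{u + w | u w. u \<in> M \<and> w \<in> W} = lp p"
    proof (intro equalityI subsetI)
      fix x assume "x \<in> {u + w | u w. u \<in> M \<and> w \<in> W}"
      then obtain u w where "x = u + w" "u \<in> M" "w \<in> W" by blast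
      then show "x \<in> lp p" using lp_add(1)[OF p, of u w] MV KV by (auto simp: W_def)
    next
      fix x :: "'a \<Rightarrow> complex" assume x: "x \<in> lp p"
      \<comment> \<open>\<open>m\<close> has the same image under \<open>F\<close> as
        \<open>x\<close>, so \<open>x - m\<close> lies in the kernel. Below, \<open>m'\<close> takes
        off its component along \<open>M \<inter> K\<close>, and what remains is annihilated by
        every \<open>Q j\<close>.\<close>
      define m where "m = (\<Sum>i<n. cscale (L i (F x)) (g i))"
      have mM: "m \<in> M"
        unfolding m_def M_def G_def by (intro cfun.span_sum cfun.span_scale cfun.span_base) auto
      have "F m = (\<Sum>i<n. cscale (L i (F x)) (b i))"
        unfolding m_def by (subst Fsum) (simp_all add: lp_cscale[OF p] g Fsc)
      also have "\<dots> = F x" using L[of "F x"] x by simp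
      finally have y: "x - m \<in> K"
        using x mM MV lp_diff(1)[OF p, of x m] by (auto simp: K_def Fdiff)
      define m' where "m' = (\<Sum>i<r. cscale (Q i (x - m)) (e i))"
      have m': "m' \<in> M \<inter> K"
        unfolding m'_def using e
        by (intro cfun.subspace_sum[OF cfun.subspace_inter[OF subM subK]]
            cfun.subspace_scale[OF cfun.subspace_inter[OF subM subK]]) auto
      have "Q j (x - m - m') = 0" if j: "j < r" for j
      proof -
        have "Q j m' = (\<Sum>i<r. Q j (cscale (Q i (x - m)) (e i)))"
          unfolding m'_def using e KV by (intro dual_sum_arg[OF p Q[OF j]] lp_cscale(1)[OF p]) auto
        also have "\<dots> = (\<Sum>i<r. Q i (x - m) * Q j (e i))"
          using e KV by (intro sum.cong refl dual_cscale[OF p Q[OF j]]) auto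
        also have "\<dots> = (\<Sum>i<r. if i = j then Q j (x - m) else 0)"
          using j by (intro sum.cong) (auto simp: Qe)
        also have "\<dots> = Q j (x - m)" using j by simp
        finally show ?thesis using dual_diff[OF p Q[OF j], of "x - m" m'] KV y m' by auto
      qed
      then have "x - m - m' \<in> W"
        using cfun.subspace_diff[OF subK, of "x - m" m'] y m' by (auto simp: W_def)
      moreover have "m + m' \<in> M" using cfun.subspace_add[OF subM mM, of m'] m' by auto
      moreover have "x = (m + m') + (x - m - m')" by simp
      ultimately show "x \<in> {u + w | u w. u \<in> M \<and> w \<in> W}" by blast
    qed
    show "\<exists>S. finite S \<and> cfun.span S = M" using fin M_def by blast
    show "F ` M \<subseteq> M" using FM MV by blast
    show "\<forall>w\<in>W. F w = 0" by (simp add: W_def K_def)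
  qed
qed

text \<open>
  The limit does not mention \<open>M\<close>, \<open>W\<close> or the basis, so this also yields the uniqueness needed to
  evaluate the two definite descriptions in \<^const>\<open>endo_det\<close> and \<^const>\<open>finite_rank_det\<close>.
\<close>

lemma section_det_tendsto_endo:
  fixes n :: nat
  assumes F: "finite_rank_on (lp p) (lp_norm p) F"
    and M: "cfun.subspace M" and W: "cfun.subspace W"
    and MW: "{u + w | u w. u \<in> M \<and> w \<in> W} = lp p"
    and FM: "F ` M \<subseteq> M" and FW: "\<forall>w\<in>W. F w = 0"
    and b: "inj_on b {..<n}" "cfun.independent (b ` {..<n})" "cfun.span (b ` {..<n}) = M"
    and A: "A \<in> carrier_mat n n" "\<forall>j<n. b j + F (b j) = (\<Sum>i<n. cscale (A $$ (i, j)) (b i))"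
  shows "(\<lambda>k. section_det k F) \<longlonglongrightarrow> Determinant.det A"
proof -
  have MV: "M \<subseteq> lp p" and WV: "W \<subseteq> lp p"
  proof -
    have "u + 0 \<in> lp p" if "u \<in> M" for u
      unfolding MW[symmetric] using that cfun.subspace_0[OF W] by blast
    then show "M \<subseteq> lp p" by auto
    have "0 + w \<in> lp p" if "w \<in> W" for w
      unfolding MW[symmetric] using that cfun.subspace_0[OF M] by blast
    then show "W \<subseteq> lp p" by auto
  qed
  have bM: "b i \<in> M" if "i < n" for i unfolding b(3)[symmetric] by (rule cfun.span_base) (use that in auto)
  have bV: "b ` {..<n} \<subseteq> lp p" using bM MV by auto
  obtain L where L: "\<And>i. i < n \<Longrightarrow> L i \<in> lp_dual p"
    "\<And>i j. i < n \<Longrightarrow> j < n \<Longrightarrow> L i (b j) = (if i = j then 1 else 0)"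
    using dual_basis[OF p b(1,2) bV] by metis
  have lin: "linear_op_on (lp p) F" using F unfolding finite_rank_on_def by blast
  \<comment> \<open>The component of \<open>x\<close> in \<open>W\<close> is annihilated, so
    \<open>F\<close> maps the whole space, and not only \<open>M\<close>, into \<open>M\<close>;
    this gives the expansion of \<open>F\<close> along \<open>b\<close>.\<close>
  have FxM: "F x \<in> M" if x: "x \<in> lp p" for x
  proof -
    obtain u w where uw: "x = u + w" "u \<in> M" "w \<in> W" using x unfolding MW[symmetric] by blast
    have "F x = F u + F w"
      using lin uw MV WV unfolding linear_op_on_def by blast
    then show ?thesis using FM FW uw by auto
  qed
  have *: "(\<lambda>k. section_det k F) \<longlonglongrightarrow>
      Determinant.det (mat n n (\<lambda>(i, j). (if i = j then 1 else 0) + L i (F (b j))))"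
  proof (rule section_det_finite_rank[where \<psi> = "\<lambda>i x. L i (F x)" and b = b])
    show "(\<lambda>x. L i (F x)) \<in> lp_dual p" if "i < n" for i
      by (rule dual_compose_finite_rank[OF p L(1)[OF that] F])
    show "b i \<in> lp p" if "i < n" for i using bM[OF that] MV by blast
    show "F x = (\<Sum>i<n. cscale (L i (F x)) (b i))" if "x \<in> lp p" for x
      by (rule dual_basis_expand[OF p L bV]) (simp_all add: b(3) FxM[OF that])
  qed
  \<comment> \<open>Applying \<open>L i\<close> to the expansion of \<open>b j + F (b j)\<close>
    reads off the entry \<open>(i, j)\<close> of \<open>A\<close>.\<close>
  have "mat n n (\<lambda>(i, j). (if i = j then 1 else 0) + L i (F (b j))) = A"
  proof (rule eq_matI)
    fix i j assume "i < dim_row A" "j < dim_col A"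
    then have ij: "i < n" "j < n" using A(1) by auto
    have bv: "b l \<in> lp p" if "l < n" for l using bM[OF that] MV by blast
    have "(if i = j then 1 else 0) + L i (F (b j)) = L i (b j + F (b j))"
      using dual_add[OF p L(1)[OF ij(1)] bv[OF ij(2)], of "F (b j)"] FxM[OF bv[OF ij(2)]] MV L(2)[OF ij] by auto
    also have "\<dots> = (\<Sum>l<n. L i (cscale (A $$ (l, j)) (b l)))"
    proof -
      have "b j + F (b j) = (\<Sum>l<n. cscale (A $$ (l, j)) (b l))" using A(2) ij by blast
      then show ?thesis using bv by (simp only:) (intro dual_sum_arg[OF p L(1)[OF ij(1)]] lp_cscale(1)[OF p], simp)
    qed
    also have "\<dots> = (\<Sum>l<n. if l = i then A $$ (i, j) else 0)"
      using ij bv by (intro sum.cong refl) (auto simp: dual_cscale[OF p L(1)[OF ij(1)]] L(2))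
    also have "\<dots> = A $$ (i, j)" using ij by simp
    finally show "mat n n (\<lambda>(i, j). (if i = j then 1 else 0) + L i (F (b j))) $$ (i, j) = A $$ (i, j)"
      using ij by simp
  qed (use A in auto)
  with * show ?thesis by simp
qed

lemma section_det_tendsto_finite_rank_det:
  assumes F: "finite_rank_on (lp p) (lp_norm p) F"
  shows "(\<lambda>k. section_det k F) \<longlonglongrightarrow> finite_rank_det (lp p) F"
proof -
  have lin: "linear_op_on (lp p) F" using F unfolding finite_rank_on_def by blast
  have endo: "(\<lambda>k. section_det k F) \<longlonglongrightarrow> endo_det M (\<lambda>x. x + F x)"
    if M: "cfun.subspace M" and W: "cfun.subspace W"
    and MW: "{u + w | u w. u \<in> M \<and> w \<in> W} = lp p"
    and fin: "\<exists>S. finite S \<and> cfun.span S = M"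
    and FM: "F ` M \<subseteq> M" and FW: "\<forall>w\<in>W. F w = 0" for M W
  proof -
    have "u + 0 \<in> lp p" if "u \<in> M" for u
      unfolding MW[symmetric] using that cfun.subspace_0[OF W] by blast
    then have MV: "M \<subseteq> lp p" by auto
    obtain S where S: "finite S" "M \<subseteq> cfun.span S" using fin by blast
    from finite_dim_dual_basis[OF p M MV S] obtain n :: nat and b L where
      b: "inj_on b {..<n}" "cfun.independent (b ` {..<n})" "cfun.span (b ` {..<n}) = M"
      and L: "\<And>v. v \<in> M \<Longrightarrow> v = (\<Sum>i<n. cscale (L i v) (b i))"
      by metis
    have bM: "b i \<in> M" if "i < n" for i unfolding b(3)[symmetric] by (rule cfun.span_base) (use that in auto)
    define A where "A = mat n n (\<lambda>(i, j). L i (b j + F (b j)))"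
    have A: "A \<in> carrier_mat n n" "\<forall>j<n. b j + F (b j) = (\<Sum>i<n. cscale (A $$ (i, j)) (b i))"
    proof -
      show "\<forall>j<n. b j + F (b j) = (\<Sum>i<n. cscale (A $$ (i, j)) (b i))"
      proof (intro allI impI)
        fix j assume j: "j < n"
        have "b j + F (b j) \<in> M" using bM[OF j] FM by (intro cfun.subspace_add[OF M]) auto
        then show "b j + F (b j) = (\<Sum>i<n. cscale (A $$ (i, j)) (b i))"
          using L[of "b j + F (b j)"] j by (simp add: A_def)
      qed
    qed (simp add: A_def)
    note lim = section_det_tendsto_endo[OF F M W MW FM FW]
    have "endo_det M (\<lambda>x. x + F x) = Determinant.det A"
      unfolding endo_det_def
    proof (rule the_equality)
      show "\<exists>n b A'. inj_on b {..<n} \<and> cfun.independent (b ` {..<n}) \<and> cfun.span (b ` {..<n}) = M \<and>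
        A' \<in> carrier_mat n n \<and> (\<forall>j<n. b j + F (b j) = (\<Sum>i<n. cscale (A' $$ (i, j)) (b i))) \<and>
        Determinant.det A = Determinant.det A'"
        using b A by blast
    next
      fix d
      assume "\<exists>n b A. inj_on b {..<n} \<and> cfun.independent (b ` {..<n}) \<and> cfun.span (b ` {..<n}) = M \<and>
        A \<in> carrier_mat n n \<and> (\<forall>j<n. b j + F (b j) = (\<Sum>i<n. cscale (A $$ (i, j)) (b i))) \<and>
        d = Determinant.det A"
      then obtain n' :: nat and b' A' where *: "inj_on b' {..<n'}" "cfun.independent (b' ` {..<n'})" "cfun.span (b' ` {..<n'}) = M"
        "A' \<in> carrier_mat n' n'" "\<forall>j<n'. b' j + F (b' j) = (\<Sum>i<n'. cscale (A' $$ (i, j)) (b' i))"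
        "d = Determinant.det A'" by (elim exE conjE)
      show "d = Determinant.det A"
        unfolding *(6) by (rule LIMSEQ_unique[OF lim[OF *(1-5)] lim[OF b A]])
    qed
    then show ?thesis using lim[OF b A] by simp
  qed
  obtain M W where MW: "cfun.subspace M" "cfun.subspace W" "M \<inter> W = {0}"
    "{u + w | u w. u \<in> M \<and> w \<in> W} = lp p" "\<exists>S. finite S \<and> cfun.span S = M"
    "F ` M \<subseteq> M" "\<forall>w\<in>W. F w = 0"
    using finite_rank_split[OF F] by blast
  have "finite_rank_det (lp p) F = endo_det M (\<lambda>x. x + F x)"
    unfolding finite_rank_det_def
  proof (rule the_equality)
    show "\<exists>M' W. cfun.subspace M' \<and> cfun.subspace W \<and> M' \<inter> W = {0} \<and>
      {u + w |u w. u \<in> M' \<and> w \<in> W} = lp p \<and> (\<exists>S. finite S \<and> cfun.span S = M') \<and>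
      F ` M' \<subseteq> M' \<and> (\<forall>w\<in>W. F w = 0) \<and> endo_det M (\<lambda>x. x + F x) = endo_det M' (\<lambda>x. x + F x)"
      by (rule exI[of _ M], rule exI[of _ W]) (use MW in simp)
  next
    fix d
    assume "\<exists>M W. cfun.subspace M \<and> cfun.subspace W \<and> M \<inter> W = {0} \<and>
      {u + w |u w. u \<in> M \<and> w \<in> W} = lp p \<and> (\<exists>S. finite S \<and> cfun.span S = M) \<and>
      F ` M \<subseteq> M \<and> (\<forall>w\<in>W. F w = 0) \<and> d = endo_det M (\<lambda>x. x + F x)"
    then obtain M' W' where *: "cfun.subspace M'" "cfun.subspace W'"
      "{u + w |u w. u \<in> M' \<and> w \<in> W'} = lp p" "\<exists>S. finite S \<and> cfun.span S = M'"
      "F ` M' \<subseteq> M'" "\<forall>w\<in>W'. F w = 0" "d = endo_det M' (\<lambda>x. x + F x)" by blast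
    show "d = endo_det M (\<lambda>x. x + F x)"
      unfolding *(7) by (rule LIMSEQ_unique[OF endo[OF *(1-6)] endo[OF MW(1,2,4-7)]])
  qed
  then show ?thesis using endo[OF MW(1,2,4-7)] by simp
qed

end

section \<open>Perturbation of finite sections by rank-one and nuclear terms\<close>

context
  fixes p :: real
  assumes p: "1 \<le> p"
begin

text \<open>The lower bound \<open>1 - q\<close> for \<open>I + G\<close> survives compression,
  because truncation does not increase the norm. It thus serves as the coercivity constant for
  sections of every size.\<close>

lemma section_det_rank_one_update:
  assumes G: "linear_op_on (lp p) G" and q: "q < 1" "\<And>x. x \<in> lp p \<Longrightarrow> lp_norm p (G x) \<le> q * lp_norm p x"
    and \<phi>: "\<phi> \<in> lp_dual p" and y: "y \<in> lp p"
  shows "\<exists>a. section_det k (\<lambda>x. G x + cscale (\<phi> x) y) = section_det k G * (1 + a) \<and>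
    (1 - q) * cmod a \<le> lp_dnorm p \<phi> * lp_norm p y"
proof -
  \<comment> \<open>Embeds vectors of \<open>k\<close> coordinates as sequences; \<open>N\<close>
    below is the norm of \<open>lp p\<close> pulled back along this embedding.\<close>
  define em where "em x = (\<Sum>j<k. cscale (x j) (unit_at j))" for x :: "nat \<Rightarrow> complex"
  have em_apply: "em x i = (if int_encode i < k then x (int_encode i) else 0)" for x i
  proof -
    have "em x i = (\<Sum>j<k. if j = int_encode i then x j else 0)"
      unfolding em_def sum_fun_eval by (intro sum.cong) (auto simp: cscale_def unit_seq_def)
    then show ?thesis by simp
  qed
  have emV: "em x \<in> lp p" for x
    using lp_sum[OF p, of "{..<k}" "\<lambda>j. cscale (x j) (unit_at j)"]
    unfolding em_def by (simp add: lp_cscale(1)[OF p] unit_seq_lp[OF p])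
  have cut: "em (\<lambda>i. if i < k then f (int_decode i) else 0) = lp_cut k f" for f
    by (simp add: fun_eq_iff em_apply lp_cut_apply)
  have GV: "G x \<in> lp p" if "x \<in> lp p" for x using G that unfolding linear_op_on_def by blast
  have Gadd: "G (x + x') = G x + G x'" if "x \<in> lp p" "x' \<in> lp p" for x x'
    using G that unfolding linear_op_on_def by blast
  have Gsc: "G (cscale c x) = cscale c (G x)" if "x \<in> lp p" for c x
    using G that unfolding linear_op_on_def by blast
  have G_em: "G (em x) i = (\<Sum>j<k. G (unit_at j) i * x j)" for x i
  proof -
    have G0: "G 0 = 0"
      using Gsc[of 0 0] by simp
    have "G (\<Sum>j\<in>J. cscale (x j) (unit_at j)) = (\<Sum>j\<in>J. cscale (x j) (G (unit_at j)))" if "finite J" for J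
      using that
    proof (induction J)
      case (insert j J)
      have "(\<Sum>j\<in>J. cscale (x j) (unit_at j)) \<in> lp p"
        using lp_sum[OF p, of J "\<lambda>j. cscale (x j) (unit_at j)"]
        by (simp add: lp_cscale(1)[OF p] unit_seq_lp[OF p])
      then have "G (cscale (x j) (unit_at j) + (\<Sum>j\<in>J. cscale (x j) (unit_at j))) =
          G (cscale (x j) (unit_at j)) + G (\<Sum>j\<in>J. cscale (x j) (unit_at j))"
        by (rule Gadd[OF lp_cscale(1)[OF p unit_seq_lp(1)[OF p]]])
      moreover have "G (cscale (x j) (unit_at j)) = cscale (x j) (G (unit_at j))"
        by (rule Gsc[OF unit_seq_lp(1)[OF p]])
      ultimately show ?case using insert by (simp del: plus_fun_apply)
    qed (simp only: sum.empty G0)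
    then show ?thesis by (simp add: em_def sum_fun_eval cscale_def mult.commute)
  qed
  define Y where "Y i j = (if i = j then 1 else 0) + G (unit_at j) (int_decode i)" for i j
  define N where "N x = lp_norm p (em x)" for x
  have "\<exists>a. Determinant.det (mat k k (\<lambda>(i, j). Y i j + y (int_decode i) * \<phi> (unit_at j))) =
      Determinant.det (mat k k (\<lambda>(i, j). Y i j)) * (1 + a) \<and>
    (1 - q) * cmod a \<le> lp_dnorm p \<phi> * N (\<lambda>i. if i < k then y (int_decode i) else 0)"
  proof (rule det_rank_one_update[where u = "\<lambda>i. y (int_decode i)" and v = "\<lambda>j. \<phi> (unit_at j)"])
    show "0 < 1 - q" using q by simp
    show "0 \<le> lp_dnorm p \<phi>" by (rule dual_bound(2)[OF p \<phi>])
    show "N (\<lambda>_. 0) = 0"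
    proof -
      have "em (\<lambda>_. 0) = 0" by (simp add: fun_eq_iff em_apply)
      then show ?thesis by (simp add: N_def)
    qed
    show "N x > 0" if "i < k" "x i \<noteq> 0" for x i
    proof -
      have "cmod (x i) \<le> N x"
        using norm_le_lp_norm[OF p emV, of x "int_decode i"] that by (simp add: em_apply N_def)
      then show ?thesis using that by (smt (verit) zero_less_norm_iff)
    qed
    show "cmod (\<Sum>i<k. \<phi> (unit_at i) * x i) \<le> lp_dnorm p \<phi> * N x" for x
    proof -
      have "\<phi> (em x) = (\<Sum>i<k. \<phi> (unit_at i) * x i)"
        unfolding em_def
        by (subst dual_sum_arg[OF p \<phi>])
          (simp_all add: lp_cscale(1)[OF p] unit_seq_lp[OF p] dual_cscale[OF p \<phi>] mult.commute)
      then show ?thesis using dual_bound(1)[OF p \<phi> emV[of x]] by (simp add: N_def)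
    qed
    show "(1 - q) * N x \<le> N (\<lambda>i. if i < k then \<Sum>j<k. Y i j * x j else 0)" for x
    proof -
      let ?r = "em (\<lambda>i. if i < k then \<Sum>j<k. Y i j * x j else 0)"
      let ?g = "lp_cut k (G (em x))"
      \<comment> \<open>On embedded vectors the section acts as the identity plus the truncation of
        \<open>G\<close>. The triangle inequality and the bound for \<open>G\<close> then leave the
        factor \<open>1 - q\<close>.\<close>
      have "?r = em x + ?g"
      proof
        fix i
        show "?r i = (em x + ?g) i"
        proof (cases "int_encode i < k")
          case True
          have "(\<Sum>j<k. Y (int_encode i) j * x j) =
              (\<Sum>j<k. if j = int_encode i then x j else 0) + (\<Sum>j<k. G (unit_at j) i * x j)"
            unfolding sum.distrib[symmetric] Y_def by (intro sum.cong) (auto simp: distrib_right)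
          then show ?thesis using True by (simp add: em_apply lp_cut_apply G_em)
        qed (simp add: em_apply lp_cut_apply)
      qed
      then have "em x = ?r - ?g" by simp
      then have "N x \<le> lp_norm p ?r + lp_norm p ?g"
        unfolding N_def using lp_diff(2)[OF p, of ?r ?g] emV lp_cut_lp(1)[OF p GV[OF emV]] by simp
      also have "lp_norm p ?g \<le> q * N x"
        using lp_cut_lp(2)[OF p GV[OF emV]] q(2)[OF emV] unfolding N_def by (rule order_trans)
      finally show ?thesis by (simp add: N_def algebra_simps)
    qed
  qed
  then obtain a where a: "Determinant.det (mat k k (\<lambda>(i, j). Y i j + y (int_decode i) * \<phi> (unit_at j))) =
      Determinant.det (mat k k (\<lambda>(i, j). Y i j)) * (1 + a)"
    "(1 - q) * cmod a \<le> lp_dnorm p \<phi> * N (\<lambda>i. if i < k then y (int_decode i) else 0)" by blast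
  have "lp_dnorm p \<phi> * N (\<lambda>i. if i < k then y (int_decode i) else 0) \<le> lp_dnorm p \<phi> * lp_norm p y"
    unfolding N_def cut by (intro mult_left_mono lp_cut_lp[OF p] y dual_bound(2)[OF p \<phi>])
  with a show ?thesis
    by (intro exI[of _ a]) (simp add: section_det_def Y_def cscale_def mult.commute add.assoc)
qed

text \<open>Adding the terms of \<open>F - A\<close> one at a time multiplies the section by factors
  \<open>1 + a\<close>, and the distance of their product from 1 is at most the exponential of the
  summed bounds, minus 1. Since \<open>q\<close> dominates \<open>q\<^sub>0 + s\<close>, every
  intermediate operator obeys the same norm bound, so one denominator \<open>1 - q\<close> serves
  all steps and all \<open>k\<close>.\<close>

lemma section_det_perturb:
  assumes A: "linear_op_on (lp p) A" "\<And>x. x \<in> lp p \<Longrightarrow> lp_norm p (A x) \<le> q\<^sub>0 * lp_norm p x"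
    and rep: "nuclear_rep (lp p) (lp_norm p) (F - A) \<phi> y" and lin: "linear_op_on (lp p) (F - A)"
    and s: "(\<Sum>n. lp_dnorm p (\<phi> n) * lp_norm p (y n)) \<le> s" and q: "q\<^sub>0 + s \<le> q" "q < 1"
  shows "cmod (section_det k F - section_det k A) \<le> cmod (section_det k A) * (exp (s / (1 - q)) - 1)"
proof -
  note R = nuclear_repD[OF p rep]
  let ?w = "\<lambda>n. lp_dnorm p (\<phi> n) * lp_norm p (y n)"
  have w: "0 \<le> ?w n" for n by (rule weight_nonneg[OF p R(1)])
  have ws: "(\<Sum>n<m. ?w n) \<le> s" for m
    using sum_le_suminf[OF R(3), of "{..<m}"] w s by force
  define G where "G m x = A x + (\<Sum>n<m. cscale (\<phi> n x) (y n))" for m x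
  have AV: "A x \<in> lp p" if "x \<in> lp p" for x using A(1) that unfolding linear_op_on_def by blast
  have G: "linear_op_on (lp p) (G m)" for m
    unfolding linear_op_on_def
  proof (intro conjI ballI allI)
    fix x :: "int \<Rightarrow> complex" assume x: "x \<in> lp p"
    show "G m x \<in> lp p"
      unfolding G_def by (intro lp_add(1)[OF p] AV x rank_one_sum_bound(1)[OF p] R)
    fix c
    have "A (cscale c x) = cscale c (A x)" using A(1) x unfolding linear_op_on_def by blast
    then show "G m (cscale c x) = cscale c (G m x)"
      unfolding G_def
      by (simp add: cfun.scale_right_distrib cfun.scale_sum_right dual_cscale[OF p R(1) x] del: plus_fun_apply)
  next
    fix x x' :: "int \<Rightarrow> complex" assume x: "x \<in> lp p" "x' \<in> lp p"
    have "A (x + x') = A x + A x'" using A(1) x unfolding linear_op_on_def by blast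
    moreover have "(\<Sum>n<m. cscale (\<phi> n (x + x')) (y n)) =
        (\<Sum>n<m. cscale (\<phi> n x) (y n)) + (\<Sum>n<m. cscale (\<phi> n x') (y n))"
      by (simp add: cfun.scale_left_distrib sum.distrib dual_add[OF p R(1) x] del: plus_fun_apply)
    ultimately show "G m (x + x') = G m x + G m x'" by (simp only: G_def ac_simps)
  qed
  have Gq: "lp_norm p (G m x) \<le> q * lp_norm p x" if x: "x \<in> lp p" for m x
  proof -
    have "lp_norm p (G m x) \<le> lp_norm p (A x) + lp_norm p (\<Sum>n<m. cscale (\<phi> n x) (y n))"
      unfolding G_def by (intro lp_add(2)[OF p] AV x rank_one_sum_bound(1)[OF p] R)
    also have "\<dots> \<le> q\<^sub>0 * lp_norm p x + (\<Sum>n<m. ?w n) * lp_norm p x"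
      by (intro add_mono A(2) x rank_one_sum_bound(2)[OF p] R)
    also have "\<dots> \<le> q * lp_norm p x"
      using ws[of m] q(1) unfolding distrib_right[symmetric] by (intro mult_right_mono) auto
    finally show ?thesis .
  qed
  have step: "cmod (section_det k (G m) - section_det k A) \<le>
      cmod (section_det k A) * (exp ((\<Sum>n<m. ?w n) / (1 - q)) - 1)" for m
  proof (induction m)
    case (Suc m)
    let ?d = "section_det k A" and ?E = "exp ((\<Sum>n<m. ?w n) / (1 - q))"
    have G_Suc: "G (Suc m) = (\<lambda>x. G m x + cscale (\<phi> m x) (y m))" by (simp add: G_def fun_eq_iff)
    have "\<exists>a. section_det k (G (Suc m)) = section_det k (G m) * (1 + a) \<and> (1 - q) * cmod a \<le> ?w m"
      unfolding G_Suc by (rule section_det_rank_one_update[OF G q(2) Gq R(1) R(2)])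
    then obtain a where a: "section_det k (G (Suc m)) = section_det k (G m) * (1 + a)" "(1 - q) * cmod a \<le> ?w m"
      by blast
    have a': "cmod a \<le> ?w m / (1 - q)" using a(2) q(2) by (simp add: field_simps)
    have "cmod (section_det k (G m)) \<le> cmod ?d + cmod (section_det k (G m) - ?d)"
      by (rule norm_triangle_sub)
    also have "\<dots> \<le> cmod ?d * ?E" using Suc by (simp add: algebra_simps)
    finally have b: "cmod (section_det k (G m)) \<le> cmod ?d * ?E" .
    have "section_det k (G (Suc m)) - ?d = (section_det k (G m) - ?d) + section_det k (G m) * a"
      by (simp add: a(1) algebra_simps)
    then have "cmod (section_det k (G (Suc m)) - ?d) \<le> cmod (section_det k (G m) - ?d) + cmod (section_det k (G m)) * cmod a"
      using norm_triangle_ineq[of "section_det k (G m) - ?d" "section_det k (G m) * a"] by (simp only: norm_mult)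
    also have "\<dots> \<le> cmod ?d * (?E - 1) + cmod ?d * ?E * (?w m / (1 - q))"
      by (rule add_mono[OF Suc mult_mono[OF b a']]) simp_all
    also have "\<dots> = cmod ?d * (?E * (1 + ?w m / (1 - q)) - 1)" by (simp add: algebra_simps)
    also have "\<dots> \<le> cmod ?d * (?E * exp (?w m / (1 - q)) - 1)"
      by (intro mult_left_mono diff_right_mono exp_ge_add_one_self) simp_all
    finally show ?case by (simp add: exp_add add_divide_distrib)
  qed (simp add: G_def)
  \<comment> \<open>For fixed \<open>k\<close> the section involves finitely many entries, so
    coordinatewise convergence of the representation suffices to reach \<open>F\<close>.\<close>
  have lim: "(\<lambda>m. section_det k (G m)) \<longlonglongrightarrow> section_det k F"
    unfolding section_det_def
  proof (intro tendsto_det tendsto_add tendsto_const)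
    fix i j :: nat
    let ?u = "unit_at j" and ?i = "int_decode i"
    have "(\<lambda>m. \<Sum>n<m. \<phi> n ?u * y n ?i) \<longlonglongrightarrow> (F - A) ?u ?i"
      by (rule nuclear_rep_pointwise[OF p rep lin unit_seq_lp(1)[OF p]])
    from tendsto_add[OF tendsto_const[of "A ?u ?i"] this]
    show "(\<lambda>m. G m ?u ?i) \<longlonglongrightarrow> F ?u ?i" by (simp add: G_def sum_fun_eval cscale_def)
  qed
  show ?thesis
  proof (rule tendsto_upperbound)
    show "(\<lambda>m. cmod (section_det k (G m) - section_det k A)) \<longlonglongrightarrow> cmod (section_det k F - section_det k A)"
      by (intro tendsto_norm tendsto_diff lim tendsto_const)
    have "cmod (section_det k (G m) - section_det k A) \<le> cmod (section_det k A) * (exp (s / (1 - q)) - 1)" for m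
      using ws[of m] q(2)
      by (intro order_trans[OF step] mult_left_mono diff_right_mono) (auto simp: divide_right_mono)
    then show "\<forall>\<^sub>F m in sequentially. cmod (section_det k (G m) - section_det k A) \<le>
        cmod (section_det k A) * (exp (s / (1 - q)) - 1)" by simp
  qed simp
qed

end

section \<open>Operators given by a kernel\<close>

definition kernel_op :: "(int \<Rightarrow> int \<Rightarrow> complex) \<Rightarrow> (int \<Rightarrow> complex) \<Rightarrow> int \<Rightarrow> complex"
  where "kernel_op K f i = (\<Sum>\<^sub>\<infinity>j. K i j * f j)"

lemma has_sum_infsum_bounded:
  fixes g :: "'a \<Rightarrow> complex"
  assumes "\<And>S. finite S \<Longrightarrow> S \<subseteq> A \<Longrightarrow> (\<Sum>j\<in>S. cmod (g j)) \<le> B"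
  shows "(g has_sum infsum g A) A" "cmod (infsum g A) \<le> B"
proof -
  have abs: "g abs_summable_on A"
    by (rule nonneg_bdd_above_summable_on) (auto intro!: bdd_aboveI2[where M = B] assms)
  then show "(g has_sum infsum g A) A"
    using abs_summable_summable by (intro has_sum_infsum) blast
  have "cmod (infsum g A) \<le> (\<Sum>\<^sub>\<infinity>j\<in>A. cmod (g j))" using abs by (rule norm_infsum_bound)
  also have "\<dots> \<le> B" by (rule infsum_le_finite_sums[OF abs]) (rule assms)
  finally show "cmod (infsum g A) \<le> B" .
qed

lemma has_sum_int_decode:
  assumes "(g has_sum s) UNIV"
  shows "(\<lambda>n. g (int_decode n)) sums s"
proof -
  have "((\<lambda>n. g (int_decode n)) has_sum s) UNIV"
    using assms has_sum_reindex_bij_betw[OF bij_int_decode, of g s] by simp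
  then show ?thesis by (rule has_sum_imp_sums)
qed

lemma kernel_op_unit_seq: "kernel_op K (unit_seq j) i = K i j"
proof -
  have "kernel_op K (unit_seq j) i = (\<Sum>\<^sub>\<infinity>l\<in>{j}. K i l * unit_seq j l)"
    unfolding kernel_op_def by (rule infsum_cong_neutral) (auto simp: unit_seq_def)
  then show ?thesis by (simp add: unit_seq_def)
qed

context
  fixes p :: real
  assumes p: "1 \<le> p"
begin

text \<open>The operator is decomposed by rows: the functional is pairing with a row, the vector a
  unit vector. By the pairing estimate the weights are at most the norms of the rows.\<close>

lemma kernel_op_nuclear_row:
  assumes p2: "p \<le> 2" and K: "row_summable p K"
  shows "f \<in> lp p \<Longrightarrow> ((\<lambda>j. K i j * f j) has_sum kernel_op K f i) UNIV"
    and "linear_op_on (lp p) (kernel_op K)"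
    and "\<exists>\<phi> y. nuclear_rep (lp p) (lp_norm p) (kernel_op K) \<phi> y"
proof -
  have KV: "K i \<in> lp p" for i using K by (simp add: row_summable_def)
  define c where "c i = lp_norm p (K i)" for i
  have c: "0 \<le> c i" for i by (simp add: c_def)
  have sm: "summable (\<lambda>n. c (int_decode n))"
    using K unfolding row_summable_def c_def by (intro summable_int_decode) auto
  have fin: "(\<Sum>j\<in>S. cmod (K i j * f j)) \<le> c i * lp_norm p f" if "f \<in> lp p" "finite S" for i f S
    unfolding c_def by (rule lp_pairing[OF p p2 KV that])
  have hs: "((\<lambda>j. K i j * f j) has_sum kernel_op K f i) UNIV"
    and le: "cmod (kernel_op K f i) \<le> c i * lp_norm p f" if "f \<in> lp p" for f i
    unfolding kernel_op_def
    using has_sum_infsum_bounded[of UNIV "\<lambda>j. K i j * f j" "c i * lp_norm p f"] fin[OF that] by simp_all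
  show "f \<in> lp p \<Longrightarrow> ((\<lambda>j. K i j * f j) has_sum kernel_op K f i) UNIV" by (rule hs)
  define \<phi> where "\<phi> n f = kernel_op K f (int_decode n)" for n f
  have \<phi>: "\<phi> n \<in> lp_dual p" for n
  proof -
    have "\<phi> n (f + g) = \<phi> n f + \<phi> n g" if "f \<in> lp p" "g \<in> lp p" for f g
      using infsumI[OF has_sum_add[OF hs[OF that(1)] hs[OF that(2)], of "int_decode n" "int_decode n"]]
      by (simp add: \<phi>_def kernel_op_def distrib_left)
    moreover have "\<phi> n (cscale a f) = a * \<phi> n f" if "f \<in> lp p" for a f
      using infsumI[OF has_sum_cmult_right[OF hs[OF that], of a "int_decode n"]]
      by (simp add: \<phi>_def kernel_op_def cscale_def mult.left_commute)
    moreover have "\<exists>C. \<forall>f\<in>lp p. cmod (\<phi> n f) \<le> C * lp_norm p f"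
      using le unfolding \<phi>_def by blast
    ultimately show ?thesis unfolding dual_space_def by blast
  qed
  have dn: "lp_dnorm p (\<phi> n) \<le> c (int_decode n)" for n
    by (rule dual_normI[OF p]) (simp_all add: \<phi>_def le c)
  have sm': "summable (\<lambda>n. lp_dnorm p (\<phi> n) * lp_norm p (unit_at n))"
    using dn dual_bound(2)[OF p \<phi>]
    by (intro summable_comparison_test[OF _ sm]) (simp add: unit_seq_lp[OF p])
  \<comment> \<open>At a fixed coordinate only one term is nonzero, so the partial sums are
    eventually constant.\<close>
  have lim: "(\<lambda>k. \<Sum>n<k. \<phi> n f * unit_at n i) \<longlonglongrightarrow> kernel_op K f i" for f i
  proof (rule tendsto_eventually)
    have eq: "(\<Sum>n<k. \<phi> n f * unit_at n i) = lp_cut k (kernel_op K f) i" for k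
      by (simp add: lp_cut_def sum_fun_eval cscale_def \<phi>_def)
    show "\<forall>\<^sub>F k in sequentially. (\<Sum>n<k. \<phi> n f * unit_at n i) = kernel_op K f i"
      by (rule eventually_mono[OF eventually_gt_at_top[of "int_encode i"]]) (simp add: eq lp_cut_apply)
  qed
  note rep = nuclear_repI[OF p \<phi> unit_seq_lp(1)[OF p] sm' lim]
  show "linear_op_on (lp p) (kernel_op K)" by (rule rep(1))
  show "\<exists>\<phi> y. nuclear_rep (lp p) (lp_norm p) (kernel_op K) \<phi> y" using rep(2) by blast
qed

text \<open>The operator is decomposed by columns: the functional is evaluation at a coordinate, of
  norm at most 1 for every \<open>p \<ge> 1\<close>, and the vector is a column. The weights are
  then at most the norms of the columns.\<close>

lemma kernel_op_nuclear_col: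
  assumes K: "col_summable p K"
  shows "f \<in> lp p \<Longrightarrow> ((\<lambda>j. K i j * f j) has_sum kernel_op K f i) UNIV"
    and "linear_op_on (lp p) (kernel_op K)"
    and "\<exists>\<phi> y. nuclear_rep (lp p) (lp_norm p) (kernel_op K) \<phi> y"
proof -
  have KV: "(\<lambda>i. K i j) \<in> lp p" for j using K by (simp add: col_summable_def row_summable_def)
  define c where "c j = lp_norm p (\<lambda>i. K i j)" for j
  have c: "0 \<le> c i" for i by (simp add: c_def)
  have sm: "summable (\<lambda>n. c (int_decode n))"
    using K unfolding col_summable_def row_summable_def c_def by (intro summable_int_decode) auto
  have fin: "(\<Sum>j\<in>S. cmod (K i j * f j)) \<le> (\<Sum>n. c (int_decode n)) * lp_norm p f"
    if "f \<in> lp p" "finite S" for i f S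
  proof -
    have "(\<Sum>j\<in>S. cmod (K i j * f j)) \<le> (\<Sum>j\<in>S. c j * lp_norm p f)"
      unfolding norm_mult c_def
      by (intro sum_mono mult_mono norm_le_lp_norm[OF p] norm_le_lp_norm[OF p KV] that) simp_all
    also have "\<dots> = (\<Sum>j\<in>S. c j) * lp_norm p f" by (simp add: sum_distrib_right)
    also have "\<dots> \<le> (\<Sum>n. c (int_decode n)) * lp_norm p f"
      by (intro mult_right_mono sum_int_encode_le_suminf sm c that) simp
    finally show ?thesis .
  qed
  have hs: "((\<lambda>j. K i j * f j) has_sum kernel_op K f i) UNIV" if "f \<in> lp p" for f i
    unfolding kernel_op_def
    by (rule has_sum_infsum_bounded) (rule fin[OF that])
  show "f \<in> lp p \<Longrightarrow> ((\<lambda>j. K i j * f j) has_sum kernel_op K f i) UNIV" by (rule hs)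
  define \<phi> where "\<phi> n = (\<lambda>f :: int \<Rightarrow> complex. f (int_decode n))" for n
  have \<phi>: "\<phi> n \<in> lp_dual p" for n unfolding \<phi>_def by (rule dual_eval[OF p])
  have dn: "lp_dnorm p (\<phi> n) \<le> 1" for n
    by (rule dual_normI[OF p]) (simp_all add: \<phi>_def norm_le_lp_norm[OF p])
  have sm': "summable (\<lambda>n. lp_dnorm p (\<phi> n) * lp_norm p (\<lambda>i. K i (int_decode n)))"
  proof (rule summable_comparison_test[OF _ sm], intro exI allI impI)
    fix n
    show "norm (lp_dnorm p (\<phi> n) * lp_norm p (\<lambda>i. K i (int_decode n))) \<le> c (int_decode n)"
      using dn[of n] dual_bound(2)[OF p \<phi>] mult_right_mono[OF dn[of n] c[of "int_decode n"]]
      by (simp add: c_def)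
  qed
  have lim: "(\<lambda>k. \<Sum>n<k. \<phi> n f * K i (int_decode n)) \<longlonglongrightarrow> kernel_op K f i" if "f \<in> lp p" for f i
    using has_sum_int_decode[OF hs[OF that, of i]] by (simp add: sums_def \<phi>_def mult.commute)
  note rep = nuclear_repI[OF p \<phi> KV sm' lim]
  show "linear_op_on (lp p) (kernel_op K)" by (rule rep(1))
  show "\<exists>\<phi> y. nuclear_rep (lp p) (lp_norm p) (kernel_op K) \<phi> y" using rep(2) by blast
qed

end

section \<open>Sums over closed walks and traces of sections\<close>

definition closed_walk_sum :: "(int \<Rightarrow> int \<Rightarrow> complex) \<Rightarrow> nat \<Rightarrow> complex"
  where "closed_walk_sum K m = (\<Sum>\<^sub>\<infinity>j\<in>closed_tuples m. \<Prod>s=1..m. K (j (s - 1)) (j s))"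

text \<open>Both kinds of bound lead to the product of \<open>c\<close> over
  \<open>j 1, ..., j m\<close>. Forgetting \<open>j 0\<close> embeds the closed walks into free
  tuples of length \<open>m\<close>, over which the sum of products factors. For
  \<open>m = 0\<close> the estimate fails: there are infinitely many closed tuples, each with empty
  product 1.\<close>

lemma closed_tuples_sum_bound:
  fixes c :: "int \<Rightarrow> real"
  assumes c: "\<And>i. 0 \<le> c i" and sm: "summable (\<lambda>n. c (int_decode n))"
    and bound: "(\<forall>i j. cmod (K i j) \<le> c i) \<or> (\<forall>i j. cmod (K i j) \<le> c j)"
    and m: "1 \<le> m" and S: "finite S" "S \<subseteq> closed_tuples m"
  shows "(\<Sum>j\<in>S. cmod (\<Prod>s=1..m. K (j (s - 1)) (j s))) \<le> (\<Sum>n. c (int_decode n)) ^ m"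
proof -
  have walk: "cmod (\<Prod>s=1..m. K (j (s - 1)) (j s)) \<le> (\<Prod>s=1..m. c (j s))" if j: "j \<in> closed_tuples m" for j
    using bound
  proof
    assume *: "\<forall>i j. cmod (K i j) \<le> c j"
    show ?thesis unfolding prod_norm[symmetric] by (intro prod_mono) (simp add: *)
  next
    assume *: "\<forall>i j. cmod (K i j) \<le> c i"
    have "cmod (\<Prod>s=1..m. K (j (s - 1)) (j s)) \<le> (\<Prod>s=1..m. c (j (s - 1)))"
      unfolding prod_norm[symmetric] by (intro prod_mono) (simp add: *)
    also have "\<dots> = (\<Prod>s=1..m. c (j s))" \<comment> \<open>a cyclic shift of the closed walk\<close>
    proof -
      obtain m' where m': "m = Suc m'" using m by (cases m) auto
      have "j 0 = j (Suc m')" using j by (simp add: closed_tuples_def m')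
      moreover have "(\<Prod>s=1..m. c (j (s - 1))) = (\<Prod>s<Suc m'. c (j s))"
        "(\<Prod>s=1..m. c (j s)) = (\<Prod>s<Suc m'. c (j (Suc s)))"
        by (simp_all only: m' One_nat_def prod.atLeast1_atMost_eq diff_Suc_Suc diff_zero)
      ultimately show ?thesis
        unfolding prod.lessThan_Suc_shift[of "\<lambda>s. c (j s)"] prod.lessThan_Suc[of "\<lambda>s. c (j (Suc s))"]
        by (simp add: mult.commute)
    qed
    finally show ?thesis .
  qed
  define J where "J = (\<Union>j\<in>S. j ` {1..m})"
  let ?r = "\<lambda>j. restrict j {1..m}"
  have J: "finite J" using S by (simp add: J_def)
  \<comment> \<open>The forgotten value \<open>j 0\<close> equals \<open>j m\<close>, which is
    retained because \<open>m\<close> is at least 1.\<close>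
  have inj: "inj_on ?r S"
  proof (rule inj_onI)
    fix f g assume fg: "f \<in> S" "g \<in> S" "?r f = ?r g"
    have eq: "f s = g s" if "1 \<le> s" "s \<le> m" for s using fun_cong[OF fg(3), of s] that by simp
    have "f \<in> closed_tuples m" "g \<in> closed_tuples m" using fg S by auto
    then have cl: "f 0 = f m" "g 0 = g m" and ext: "f \<in> extensional {0..m}" "g \<in> extensional {0..m}"
      by (auto simp: closed_tuples_def PiE_def)
    show "f = g"
    proof (rule extensionalityI[OF ext])
      fix s assume "s \<in> {0..m}"
      then show "f s = g s" using eq[of s] eq[of m] cl m by (cases "s = 0") auto
    qed
  qed
  have "(\<Sum>j\<in>S. cmod (\<Prod>s=1..m. K (j (s - 1)) (j s))) \<le> (\<Sum>j\<in>S. \<Prod>s=1..m. c (?r j s))"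
    using S(2) by (intro sum_mono order_trans[OF walk]) auto
  also have "\<dots> = (\<Sum>g\<in>?r ` S. \<Prod>s=1..m. c (g s))" by (simp only: sum.reindex[OF inj] o_def)
  also have "\<dots> \<le> (\<Sum>g\<in>{1..m} \<rightarrow>\<^sub>E J. \<Prod>s=1..m. c (g s))"
  proof (rule sum_mono2)
    show "?r ` S \<subseteq> {1..m} \<rightarrow>\<^sub>E J"
      by (rule image_subsetI, rule restrict_PiE_iff[THEN iffD2]) (auto simp: J_def)
  qed (use J c in \<open>simp_all add: finite_PiE prod_nonneg\<close>)
  also have "\<dots> = (\<Prod>s=1..m. \<Sum>i\<in>J. c i)"
    using J by (subst prod_sum_PiE) auto
  also have "\<dots> = (\<Sum>i\<in>J. c i) ^ m" by simp
  also have "\<dots> \<le> (\<Sum>n. c (int_decode n)) ^ m"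
    using c J by (intro power_mono sum_int_encode_le_suminf sm sum_nonneg) auto
  finally show ?thesis .
qed

lemma trace_section_pow:
  fixes K :: "int \<Rightarrow> int \<Rightarrow> complex"
  shows "(\<Sum>i<k. (mat k k (\<lambda>(i, j). K (int_decode i) (int_decode j)) ^\<^sub>m m) $$ (i, i)) =
    (\<Sum>j\<in>{j \<in> closed_tuples m. j ` {0..m} \<subseteq> int_decode ` {..<k}}. \<Prod>s=1..m. K (j (s - 1)) (j s))"
  unfolding trace_pow_mat
proof (rule sum.reindex_bij_witness[where i = "\<lambda>j. \<lambda>s\<in>{0..m}. int_encode (j s)" and j = "\<lambda>j. \<lambda>s\<in>{0..m}. int_decode (j s)"])
  fix j assume j: "j \<in> {j \<in> {0..m} \<rightarrow>\<^sub>E {..<k}. j 0 = j m}"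
  then show "(\<lambda>s\<in>{0..m}. int_encode ((\<lambda>s\<in>{0..m}. int_decode (j s)) s)) = j"
    by (auto simp: fun_eq_iff PiE_def extensional_def)
  show "(\<lambda>s\<in>{0..m}. int_decode (j s)) \<in> {j \<in> closed_tuples m. j ` {0..m} \<subseteq> int_decode ` {..<k}}"
    using j by (auto simp: closed_tuples_def PiE_def Pi_def)
  show "(\<Prod>s=1..m. K ((\<lambda>s\<in>{0..m}. int_decode (j s)) (s - 1)) ((\<lambda>s\<in>{0..m}. int_decode (j s)) s)) =
      (\<Prod>s=1..m. K (int_decode (j (s - 1))) (int_decode (j s)))"
    by (intro prod.cong) auto
next
  fix j assume j: "j \<in> {j \<in> closed_tuples m. j ` {0..m} \<subseteq> int_decode ` {..<k}}"
  then show "(\<lambda>s\<in>{0..m}. int_decode ((\<lambda>s\<in>{0..m}. int_encode (j s)) s)) = j"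
    by (auto simp: fun_eq_iff closed_tuples_def PiE_def extensional_def)
  have "int_encode (j s) < k" if "s \<le> m" for s
  proof -
    have "j s \<in> int_decode ` {..<k}" using j that by auto
    then show ?thesis by auto
  qed
  then show "(\<lambda>s\<in>{0..m}. int_encode (j s)) \<in> {j \<in> {0..m} \<rightarrow>\<^sub>E {..<k}. j 0 = j m}"
    using j by (auto simp: closed_tuples_def)
qed

context
  fixes c :: "int \<Rightarrow> real" and K
  assumes c: "\<And>i. 0 \<le> c i" and sm: "summable (\<lambda>n. c (int_decode n))"
    and bound: "(\<forall>i j. cmod (K i j) \<le> c i) \<or> (\<forall>i j. cmod (K i j) \<le> c j)"
begin

lemma closed_walk_has_sum:
  assumes "1 \<le> m"
  shows "((\<lambda>j. \<Prod>s=1..m. K (j (s - 1)) (j s)) has_sum closed_walk_sum K m) (closed_tuples m)"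
    "cmod (closed_walk_sum K m) \<le> (\<Sum>n. c (int_decode n)) ^ m"
  unfolding closed_walk_sum_def
  using has_sum_infsum_bounded[OF closed_tuples_sum_bound[OF c sm bound assms]] by simp_all

text \<open>The trace is a partial sum of the walk series, over walks confined to the first
  \<open>k\<close> indices. These finite sets eventually contain any given finite set of walks, so
  the limit along finite subsets in \<open>has_sum\<close> specialises to a limit in
  \<open>k\<close>.\<close>

lemma trace_section_pow_tendsto:
  assumes m: "1 \<le> m"
  shows "(\<lambda>k. \<Sum>i<k. (mat k k (\<lambda>(i, j). K (int_decode i) (int_decode j)) ^\<^sub>m m) $$ (i, i))
      \<longlonglongrightarrow> closed_walk_sum K m"
    "cmod (\<Sum>i<k. (mat k k (\<lambda>(i, j). K (int_decode i) (int_decode j)) ^\<^sub>m m) $$ (i, i))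
      \<le> (\<Sum>n. c (int_decode n)) ^ m"
proof -
  let ?C = "\<lambda>k. {j \<in> closed_tuples m. j ` {0..m} \<subseteq> int_decode ` {..<k}}"
  have fin: "finite (?C k)" for k
    by (rule finite_subset[OF _ finite_PiE[of "{0..m}" "\<lambda>_. int_decode ` {..<k}"]])
      (auto simp: closed_tuples_def PiE_def Pi_def)
  have "filterlim ?C (finite_subsets_at_top (closed_tuples m)) sequentially"
    unfolding filterlim_finite_subsets_at_top
  proof (intro allI impI, elim conjE)
    fix X assume X: "finite X" "X \<subseteq> closed_tuples m"
    \<comment> \<open>Exceeds every code visited by a walk in \<open>X\<close>; the inserted 0
      covers an empty \<open>X\<close>.\<close>
    define k\<^sub>0 where "k\<^sub>0 = Suc (Max (insert 0 (\<Union>j\<in>X. (\<lambda>s. int_encode (j s)) ` {0..m})))"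
    have "X \<subseteq> ?C k" if k: "k\<^sub>0 \<le> k" for k
    proof (rule subsetI, intro CollectI conjI image_subsetI)
      fix j s assume js: "j \<in> X" "s \<in> {0..m}"
      have "int_encode (j s) \<le> Max (insert 0 (\<Union>j\<in>X. (\<lambda>s. int_encode (j s)) ` {0..m}))"
        using X(1) js by (intro Max_ge insertI2 UN_I[of j] imageI) auto
      then have "int_encode (j s) < k" using k by (simp add: k\<^sub>0_def)
      then show "j s \<in> int_decode ` {..<k}" by (metis imageI int_encode_inverse lessThan_iff)
    qed (use X in auto)
    moreover have "?C k \<subseteq> closed_tuples m" for k by (rule Collect_restrict)
    ultimately show "\<forall>\<^sub>F k in sequentially. finite (?C k) \<and> X \<subseteq> ?C k \<and> ?C k \<subseteq> closed_tuples m"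
      by (intro eventually_mono[OF eventually_ge_at_top[of k\<^sub>0]] conjI fin)
  qed
  from filterlim_compose[OF closed_walk_has_sum(1)[OF m, unfolded has_sum_def] this]
  show "(\<lambda>k. \<Sum>i<k. (mat k k (\<lambda>(i, j). K (int_decode i) (int_decode j)) ^\<^sub>m m) $$ (i, i))
      \<longlonglongrightarrow> closed_walk_sum K m"
    unfolding trace_section_pow by simp
  show "cmod (\<Sum>i<k. (mat k k (\<lambda>(i, j). K (int_decode i) (int_decode j)) ^\<^sub>m m) $$ (i, i))
      \<le> (\<Sum>n. c (int_decode n)) ^ m"
    unfolding trace_section_pow
    by (rule order_trans[OF norm_sum closed_tuples_sum_bound[OF c sm bound m fin]]) auto
qed

text \<open>The bounds on eigenvalues and traces involve only the total of \<open>c\<close>. Hence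
  one radius makes the logarithm series converge for all \<open>k\<close>, and one geometric
  majorant allows the limit in \<open>k\<close> to be taken term by term.\<close>

lemma section_det_kernel_tendsto:
  fixes z :: complex
  assumes z: "cmod z * (\<Sum>n. c (int_decode n)) < 1"
  shows "summable (\<lambda>n. (-1) ^ (Suc n + 1) / of_nat (Suc n) * z ^ Suc n * closed_walk_sum K (Suc n))"
    "(\<lambda>k. section_det k (\<lambda>f. cscale z (kernel_op K f))) \<longlonglongrightarrow>
      exp (\<Sum>n. (-1) ^ (Suc n + 1) / of_nat (Suc n) * z ^ Suc n * closed_walk_sum K (Suc n))"
proof -
  let ?C = "\<Sum>n. c (int_decode n)"
  let ?A = "\<lambda>k. mat k k (\<lambda>(i, j). K (int_decode i) (int_decode j))"
  define a where "a n k = (-1) ^ (Suc n + 1) / of_nat (Suc n) * z ^ Suc n * (\<Sum>i<k. (?A k ^\<^sub>m Suc n) $$ (i, i))"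
    for n k
  have C: "0 \<le> ?C" by (rule suminf_nonneg[OF sm c])
  have q: "0 \<le> cmod z * ?C" using C by simp
  have det: "section_det k (\<lambda>f. cscale z (kernel_op K f)) = exp (\<Sum>n. a n k)" for k
  proof -
    have "mat k k (\<lambda>(i, j). (if i = j then 1 else 0) + cscale z (kernel_op K (unit_at j)) (int_decode i)) =
        1\<^sub>m k + z \<cdot>\<^sub>m ?A k"
      by (intro eq_matI) (auto simp: cscale_def kernel_op_unit_seq)
    moreover have "cmod z * (\<Sum>i<k. c (int_decode i)) < 1"
      using mult_left_mono[OF sum_le_suminf[OF sm, of "{..<k}"], of "cmod z"] c z by simp
    then have "Determinant.det (1\<^sub>m k + z \<cdot>\<^sub>m ?A k) = exp (\<Sum>n. a n k)"
      unfolding a_def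
      by (intro det_eq_exp_trace[where c = "\<lambda>i. c (int_decode i)"]) (use c bound in auto)
    ultimately show ?thesis by (simp add: section_det_def)
  qed
  have coef: "cmod ((-1) ^ (Suc n + 1) / of_nat (Suc n)) \<le> 1" for n
    by (simp add: norm_divide norm_power divide_le_eq del: of_nat_Suc)
  have bnd: "cmod (a n k) \<le> (cmod z * ?C) ^ Suc n" for n k
  proof -
    have "cmod (a n k) \<le> 1 * cmod z ^ Suc n * ?C ^ Suc n"
      unfolding a_def norm_mult norm_power[of z]
      by (intro mult_mono coef trace_section_pow_tendsto(2)) (auto simp del: power_Suc)
    then show ?thesis by (simp only: power_mult_distrib mult_1)
  qed
  have sm_q: "summable (\<lambda>n. (cmod z * ?C) ^ Suc n)"
    using q z by (subst summable_Suc_iff) (auto intro: summable_geometric)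
  have T: "(\<forall>\<^sub>F k in sequentially. summable (\<lambda>n. norm (a n k))) \<and>
      summable (\<lambda>n. norm ((-1) ^ (Suc n + 1) / of_nat (Suc n) * z ^ Suc n * closed_walk_sum K (Suc n))) \<and>
      (\<lambda>k. suminf (\<lambda>n. a n k)) \<longlonglongrightarrow>
        (\<Sum>n. (-1) ^ (Suc n + 1) / of_nat (Suc n) * z ^ Suc n * closed_walk_sum K (Suc n))"
  proof (rule tannerys_theorem[OF _ _ sm_q])
    show "(\<lambda>k. a n k) \<longlonglongrightarrow> (-1) ^ (Suc n + 1) / of_nat (Suc n) * z ^ Suc n * closed_walk_sum K (Suc n)" for n
      unfolding a_def by (intro tendsto_mult tendsto_const trace_section_pow_tendsto(1)) simp
    show "\<forall>\<^sub>F (n, k) in at_top \<times>\<^sub>F sequentially. cmod (a n k) \<le> (cmod z * ?C) ^ Suc n"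
      by (rule always_eventually) (use bnd in auto)
  qed simp
  from T[THEN conjunct2, THEN conjunct1] show "summable (\<lambda>n. (-1) ^ (Suc n + 1) / of_nat (Suc n) * z ^ Suc n * closed_walk_sum K (Suc n))"
    by (rule summable_norm_cancel)
  show "(\<lambda>k. section_det k (\<lambda>f. cscale z (kernel_op K f))) \<longlonglongrightarrow>
      exp (\<Sum>n. (-1) ^ (Suc n + 1) / of_nat (Suc n) * z ^ Suc n * closed_walk_sum K (Suc n))"
    unfolding det by (intro tendsto_exp T[THEN conjunct2, THEN conjunct2])
qed

end

section \<open>The determinant of a nuclear operator\<close>

context
  fixes p :: real
  assumes p: "1 \<le> p"
begin

lemma nuclear_eval_dual:
  assumes "nuclear_on (lp p) (lp_norm p) T"
  shows "(\<lambda>x. T x i) \<in> lp_dual p"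
proof -
  from assms obtain \<phi> y where lin: "linear_op_on (lp p) T" and rep: "nuclear_rep (lp p) (lp_norm p) T \<phi> y"
    unfolding nuclear_on_def by blast
  have TV: "T x \<in> lp p" if "x \<in> lp p" for x using lin that unfolding linear_op_on_def by blast
  have "cmod (T x i) \<le> (\<Sum>n. lp_dnorm p (\<phi> n) * lp_norm p (y n)) * lp_norm p x" if "x \<in> lp p" for x
    by (rule order_trans[OF norm_le_lp_norm[OF p TV[OF that]] nuclear_rep_bound[OF p rep lin that]])
  then have "\<exists>C. \<forall>x\<in>lp p. cmod (T x i) \<le> C * lp_norm p x" by blast
  then show ?thesis
    using lin unfolding dual_space_def linear_op_on_def by (simp add: cscale_def)
qed

text \<open>Each coordinate of a nuclear operator is a bounded functional, hence determined on unit
  vectors. This is the sense in which a kernel defines its operator.\<close>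

lemma nuclear_on_eqI:
  fixes f :: "int \<Rightarrow> complex"
  assumes S: "nuclear_on (lp p) (lp_norm p) S" and T: "nuclear_on (lp p) (lp_norm p) T"
    and eq: "\<And>j. S (unit_seq j) = T (unit_seq j)" and f: "f \<in> lp p"
  shows "S f = T f"
proof
  fix i
  have "(\<lambda>k. S (lp_cut k f) i) \<longlonglongrightarrow> S f i" "(\<lambda>k. T (lp_cut k f) i) \<longlonglongrightarrow> T f i"
    by (rule dual_lp_cut(2)[OF p nuclear_eval_dual f], fact)+
  moreover have "S (lp_cut k f) i = T (lp_cut k f) i" for k
    unfolding dual_lp_cut(1)[OF p nuclear_eval_dual[OF S] f] dual_lp_cut(1)[OF p nuclear_eval_dual[OF T] f]
    by (simp only: eq)
  ultimately show "S f i = T f i" by (simp only:) (rule LIMSEQ_unique)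
qed

section \<open>Approximation by finite rank in the nuclear norm\<close>

lemma sum_lessThan_offset: "(\<Sum>n<k + m. f n) = (\<Sum>n<m. f n) + (\<Sum>n<k. f (n + m))"
  for f :: "nat \<Rightarrow> 'a :: comm_monoid_add"
  by (induction k) (simp_all add: ac_simps)

text \<open>The finite expansion of \<open>F\<close> is spliced in front of \<open>- z\<close> times
  the representation of \<open>T\<close>. Some representation of the difference must be known before
  its \<open>nuclear_norm\<close> carries information.\<close>

lemma nuclear_rep_finite_rank_diff:
  assumes lin: "linear_op_on (lp p) T" and rep: "nuclear_rep (lp p) (lp_norm p) T \<phi> y"
    and F: "finite_rank_on (lp p) (lp_norm p) F"
  shows "linear_op_on (lp p) (F - (\<lambda>f. cscale z (T f)))"
    "\<exists>\<phi>' y'. nuclear_rep (lp p) (lp_norm p) (F - (\<lambda>f. cscale z (T f))) \<phi>' y'"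
proof -
  note R = nuclear_repD[OF p rep]
  obtain m :: nat and \<psi> b where \<psi>: "\<And>i. i < m \<Longrightarrow> \<psi> i \<in> lp_dual p" and b: "\<And>i. i < m \<Longrightarrow> b i \<in> lp p"
    and Fx: "\<And>x. x \<in> lp p \<Longrightarrow> F x = (\<Sum>i<m. cscale (\<psi> i x) (b i))"
    by (rule finite_rank_expand[OF p F]) (rule that; assumption)
  define \<phi>' where "\<phi>' n = (if n < m then \<psi> n else \<phi> (n - m))" for n
  define y' where "y' n = (if n < m then b n else cscale (- z) (y (n - m)))" for n
  have \<phi>': "\<phi>' n \<in> lp_dual p" for n by (simp add: \<phi>'_def \<psi> R)
  have y': "y' n \<in> lp p" for n by (simp add: y'_def b R lp_cscale[OF p] del: cfun.scale_minus_left)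
  have sm: "summable (\<lambda>n. lp_dnorm p (\<phi>' n) * lp_norm p (y' n))"
  proof (rule summable_iff_shift[THEN iffD1, of _ m])
    show "summable (\<lambda>n. lp_dnorm p (\<phi>' (n + m)) * lp_norm p (y' (n + m)))"
      using summable_mult[OF R(3), of "cmod z"]
      by (simp add: \<phi>'_def y'_def lp_cscale[OF p R(2)] mult.left_commute del: cfun.scale_minus_left)
  qed
  have lim: "(\<lambda>k. \<Sum>n<k. \<phi>' n x * y' n i) \<longlonglongrightarrow> (F - (\<lambda>f. cscale z (T f))) x i" if x: "x \<in> lp p" for x i
  proof (rule LIMSEQ_offset[where k = m])
    have "(\<Sum>n<k + m. \<phi>' n x * y' n i) = F x i - z * (\<Sum>n<k. \<phi> n x * y n i)" for k
      unfolding sum_lessThan_offset Fx[OF x]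
      by (simp add: \<phi>'_def y'_def sum_fun_eval cscale_def sum_distrib_left sum_negf mult.left_commute)
    then show "(\<lambda>k. \<Sum>n<k + m. \<phi>' n x * y' n i) \<longlonglongrightarrow> (F - (\<lambda>f. cscale z (T f))) x i"
      by (simp add: cscale_def)
        (intro tendsto_diff tendsto_mult tendsto_const nuclear_rep_pointwise[OF p rep lin x])
  qed
  note * = nuclear_repI[OF p \<phi>' y' sm lim]
  show "linear_op_on (lp p) (F - (\<lambda>f. cscale z (T f)))" by (rule *(1))
  show "\<exists>\<phi>' y'. nuclear_rep (lp p) (lp_norm p) (F - (\<lambda>f. cscale z (T f))) \<phi>' y'"
    by (intro exI) (rule *(2))
qed

text \<open>Cutting off a representation leaves a tail of small weight. This makes the filter of
  approximants proper, so that the limit defining \<open>nuclear_det\<close> is determined.\<close>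

lemma finite_rank_dense:
  assumes lin: "linear_op_on (lp p) T" and rep: "nuclear_rep (lp p) (lp_norm p) T \<phi> y" and e: "0 < e"
  obtains F where "finite_rank_on (lp p) (lp_norm p) F"
    "nuclear_norm (lp p) (lp_norm p) (F - (\<lambda>f. cscale z (T f))) < e"
proof -
  note R = nuclear_repD[OF p rep]
  let ?w = "\<lambda>n. lp_dnorm p (\<phi> n) * lp_norm p (y n)"
  have "(\<lambda>M. cmod z * (\<Sum>n. ?w (n + M))) \<longlonglongrightarrow> cmod z * ((\<Sum>n. ?w n) - (\<Sum>n. ?w n))"
    unfolding suminf_minus_initial_segment[OF R(3)]
    by (intro tendsto_mult tendsto_diff tendsto_const summable_LIMSEQ R(3))
  then have "\<forall>\<^sub>F M in sequentially. cmod z * (\<Sum>n. ?w (n + M)) < e"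
    using e by (intro order_tendstoD) auto
  then obtain M where M: "cmod z * (\<Sum>n. ?w (n + M)) < e"
    by (auto simp: eventually_sequentially)
  define b where "b n = cscale z (y n)" for n
  define F where "F x = (\<Sum>n<M. cscale (\<phi> n x) (b n))" for x
  have b: "b n \<in> lp p" for n unfolding b_def by (rule lp_cscale(1)[OF p R(2)])
  have "finite_rank_on (lp p) (lp_norm p) F"
    unfolding finite_rank_on_def linear_op_on_def
  proof (intro conjI ballI allI)
    show "F x \<in> lp p" if "x \<in> lp p" for x
      unfolding F_def by (rule rank_one_sum_bound(1)[OF p R(1) b that])
    show "F (x + x') = F x + F x'" if "x \<in> lp p" "x' \<in> lp p" for x x'
      unfolding F_def
      by (simp add: cfun.scale_left_distrib sum.distrib dual_add[OF p R(1) that] del: plus_fun_apply)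
    show "F (cscale c x) = cscale c (F x)" if "x \<in> lp p" for c x
      unfolding F_def by (simp add: cfun.scale_sum_right dual_cscale[OF p R(1) that])
    show "\<exists>C. \<forall>x\<in>lp p. lp_norm p (F x) \<le> C * lp_norm p x"
      unfolding F_def by (intro exI ballI) (rule rank_one_sum_bound(2)[OF p R(1) b])
    show "\<exists>S. finite S \<and> F ` lp p \<subseteq> cfun.span S"
    proof (intro exI conjI)
      show "F ` lp p \<subseteq> cfun.span (b ` {..<M})"
        unfolding F_def by (intro image_subsetI cfun.span_sum cfun.span_scale cfun.span_base) auto
    qed simp
  qed
  moreover have "nuclear_norm (lp p) (lp_norm p) (F - (\<lambda>f. cscale z (T f))) < e"
  proof -
    \<comment> \<open>The difference is minus the tail of the scaled representation; sign and scalar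
      are absorbed into the vectors.\<close>
    define y' where "y' n = cscale (- z) (y (n + M))" for n
    have weight: "lp_dnorm p (\<phi> (n + M)) * lp_norm p (y' n) = cmod z * ?w (n + M)" for n
      by (simp add: y'_def lp_cscale[OF p R(2)] mult.left_commute del: cfun.scale_minus_left)
    have sm: "summable (\<lambda>n. ?w (n + M))" by (rule summable_iff_shift[THEN iffD2, OF R(3)])
    have "nuclear_rep (lp p) (lp_norm p) (F - (\<lambda>f. cscale z (T f))) (\<lambda>n. \<phi> (n + M)) y'"
    proof (rule nuclear_repI(2)[OF p])
      show "\<phi> (n + M) \<in> lp_dual p" for n by (rule R(1))
      show "y' n \<in> lp p" for n unfolding y'_def by (rule lp_cscale(1)[OF p R(2)])
      show "summable (\<lambda>n. lp_dnorm p (\<phi> (n + M)) * lp_norm p (y' n))"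
        unfolding weight by (rule summable_mult[OF sm])
      fix x :: "'a \<Rightarrow> complex" and i assume x: "x \<in> lp p"
      have "(\<Sum>n<k. \<phi> (n + M) x * y' n i) = F x i - z * (\<Sum>n<k + M. \<phi> n x * y n i)" for k
        unfolding sum_lessThan_offset
        by (simp add: F_def b_def y'_def sum_fun_eval cscale_def sum_distrib_left sum_negf distrib_left mult.left_commute)
      then show "(\<lambda>k. \<Sum>n<k. \<phi> (n + M) x * y' n i) \<longlonglongrightarrow> (F - (\<lambda>f. cscale z (T f))) x i"
        by (simp add: cscale_def)
          (intro tendsto_diff tendsto_mult tendsto_const LIMSEQ_ignore_initial_segment nuclear_rep_pointwise[OF p rep lin x])
    qed
    from nuclear_norm_le[OF p this] show ?thesis
      unfolding weight using M suminf_mult[OF sm, of "cmod z"] by simp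
  qed
  ultimately show ?thesis by (rule that)
qed

text \<open>The limits are taken in order: \<open>k\<close> to infinity for a fixed approximant
  \<open>F\<close>, then the distance \<open>e\<close> to 0. The norm budget is 1/2 for the scaled
  operator and 1/4 for the difference, in total 3/4; dividing by \<open>1 - 3 / 4\<close> produces
  the factor 4 in \<open>exp (4 * e)\<close>.\<close>

lemma nuclear_det_eqI:
  assumes lin: "linear_op_on (lp p) T" and rep: "nuclear_rep (lp p) (lp_norm p) T \<phi> y"
    and z: "cmod z * (\<Sum>n. lp_dnorm p (\<phi> n) * lp_norm p (y n)) \<le> 1 / 2"
    and lim: "(\<lambda>k. section_det k (\<lambda>f. cscale z (T f))) \<longlonglongrightarrow> D"
  shows "nuclear_det (lp p) (lp_norm p) (\<lambda>f. cscale z (T f)) = D"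
proof -
  let ?A = "\<lambda>f. cscale z (T f)"
  let ?B = "\<lambda>e. {F. finite_rank_on (lp p) (lp_norm p) F \<and> nuclear_norm (lp p) (lp_norm p) (F - ?A) < e}"
  have TV: "T x \<in> lp p" if "x \<in> lp p" for x using lin that unfolding linear_op_on_def by blast
  have A: "linear_op_on (lp p) ?A"
    using lin lp_cscale(1)[OF p TV] unfolding linear_op_on_def
    by (simp add: cfun.scale_right_distrib mult.commute del: plus_fun_apply)
  have A_bound: "lp_norm p (?A x) \<le> 1 / 2 * lp_norm p x" if x: "x \<in> lp p" for x
  proof -
    have "lp_norm p (?A x) = cmod z * lp_norm p (T x)" by (rule lp_cscale(2)[OF p TV[OF x]])
    also have "\<dots> \<le> cmod z * ((\<Sum>n. lp_dnorm p (\<phi> n) * lp_norm p (y n)) * lp_norm p x)"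
      by (intro mult_left_mono nuclear_rep_bound[OF p rep lin x]) simp
    also have "\<dots> \<le> 1 / 2 * lp_norm p x"
      using mult_right_mono[OF z lp_norm_nonneg[of p x]] by (simp add: mult.assoc)
    finally show ?thesis .
  qed
  have close: "cmod (finite_rank_det (lp p) F - D) \<le> cmod D * (exp (4 * e) - 1)"
    if F: "F \<in> ?B e" and e: "e \<le> 1 / 4" for F e
  proof -
    have F: "finite_rank_on (lp p) (lp_norm p) F" "nuclear_norm (lp p) (lp_norm p) (F - ?A) < e" using F by auto
    obtain \<phi>\<^sub>0 y\<^sub>0 where rep0: "nuclear_rep (lp p) (lp_norm p) (F - ?A) \<phi>\<^sub>0 y\<^sub>0"
      using nuclear_rep_finite_rank_diff(2)[OF lin rep F(1)] by blast
    obtain \<phi>' y' where rep': "nuclear_rep (lp p) (lp_norm p) (F - ?A) \<phi>' y'"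
      "(\<Sum>n. lp_dnorm p (\<phi>' n) * lp_norm p (y' n)) < e"
      by (rule nuclear_norm_lessD[OF p rep0 F(2)])
    have "cmod (section_det k F - section_det k ?A) \<le> cmod (section_det k ?A) * (exp (e / (1 - 3 / 4)) - 1)" for k
      by (rule section_det_perturb[OF p A A_bound rep'(1) nuclear_rep_finite_rank_diff(1)[OF lin rep F(1)]])
        (use rep'(2) e in auto)
    moreover have "e / (1 - 3 / 4) = 4 * e" by simp
    ultimately have le: "cmod (section_det k F - section_det k ?A) \<le> cmod (section_det k ?A) * (exp (4 * e) - 1)" for k
      by (simp only:)
    have "(\<lambda>k. cmod (section_det k F - section_det k ?A)) \<longlonglongrightarrow> cmod (finite_rank_det (lp p) F - D)"
      by (rule tendsto_norm[OF tendsto_diff[OF section_det_tendsto_finite_rank_det[OF p F(1)] lim]])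
    moreover have "(\<lambda>k. cmod (section_det k ?A) * (exp (4 * e) - 1)) \<longlonglongrightarrow> cmod D * (exp (4 * e) - 1)"
      by (rule tendsto_mult[OF tendsto_norm[OF lim] tendsto_const])
    ultimately show ?thesis by (rule LIMSEQ_le) (intro exI allI impI le)
  qed
  \<comment> \<open>The sets \<open>?B e\<close> are nested, hence form a base of the
    filter.\<close>
  have ev: "eventually P (finite_rank_approx (lp p) (lp_norm p) ?A) \<longleftrightarrow> (\<exists>e>0. \<forall>F\<in>?B e. P F)" for P
    unfolding finite_rank_approx_def
  proof (subst eventually_INF_base)
    show "{0<..} \<noteq> ({} :: real set)" by (rule greaterThan_non_empty)
    fix a b :: real assume "a \<in> {0<..}" "b \<in> {0<..}"
    then show "\<exists>x\<in>{0<..}. principal (?B x) \<le> inf (principal (?B a)) (principal (?B b))"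
      by (intro bexI[of _ "min a b"]) auto
  qed (auto simp: eventually_principal)
  have "finite_rank_approx (lp p) (lp_norm p) ?A \<noteq> bot"
    unfolding trivial_limit_def ev using finite_rank_dense[OF lin rep] by blast
  moreover have "(finite_rank_det (lp p) \<longlongrightarrow> D) (finite_rank_approx (lp p) (lp_norm p) ?A)"
  proof (rule tendstoI)
    fix \<epsilon> :: real assume \<epsilon>: "0 < \<epsilon>"
    have "((\<lambda>e. cmod D * (exp (4 * e) - 1)) \<longlongrightarrow> cmod D * (exp (4 * 0) - 1)) (at_right 0)"
      by (intro tendsto_intros)
    then have "\<forall>\<^sub>F e in at_right 0. cmod D * (exp (4 * e) - 1) < \<epsilon>"
      using \<epsilon> by (intro order_tendstoD) auto
    moreover have "\<forall>\<^sub>F e in at_right (0 :: real). e < 1 / 4 \<and> 0 < e"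
      by (intro eventually_conj eventually_at_right_less order_tendstoD[OF tendsto_ident_at]) simp
    ultimately have "\<forall>\<^sub>F e in at_right 0. cmod D * (exp (4 * e) - 1) < \<epsilon> \<and> e < 1 / 4 \<and> 0 < e"
      by (rule eventually_conj)
    then obtain e where e: "cmod D * (exp (4 * e) - 1) < \<epsilon>" "e < 1 / 4" "0 < e"
      using eventually_happens' trivial_limit_at_right_real by blast
    show "\<forall>\<^sub>F F in finite_rank_approx (lp p) (lp_norm p) ?A. dist (finite_rank_det (lp p) F) D < \<epsilon>"
      unfolding ev
    proof (intro exI[of _ e] conjI ballI)
      fix F assume "F \<in> ?B e"
      from order_le_less_trans[OF close[OF this less_imp_le[OF e(2)]] e(1)]
      show "dist (finite_rank_det (lp p) F) D < \<epsilon>" by (simp add: dist_norm)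
    qed (rule e(3))
  qed
  ultimately show ?thesis unfolding nuclear_det_def by (rule tendsto_Lim)
qed

end

text \<open>The row condition is paired with \<open>p \<le> 2\<close>, where \<open>lp p\<close>
  lies in its own dual; the column condition serves every \<open>p \<ge> 1\<close>. Uniqueness among
  nuclear operators expresses that the kernel defines \<open>T\<close>. The summability clauses
  exclude the default values of \<open>infsum\<close> and \<open>suminf\<close>, and
  \<open>Suc n\<close> lets the exponents start at 1.\<close>

theorem theorem3p8:
  fixes p :: real and K :: "int \<Rightarrow> int \<Rightarrow> complex"
  assumes "1 \<le> p"
    and "(p \<le> 2 \<and> row_summable p K) \<or> col_summable p K"
  shows "\<exists>T :: (int \<Rightarrow> complex) \<Rightarrow> (int \<Rightarrow> complex).
    nuclear_on (lp p) (lp_norm p) T \<and>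
    (\<forall>i j. K i j = T (unit_seq j) i) \<and>
    (\<forall>f\<in>lp p. \<forall>i. ((\<lambda>j. K i j * f j) has_sum T f i) UNIV) \<and>
    (\<forall>S. nuclear_on (lp p) (lp_norm p) S \<and> (\<forall>i j. K i j = S (unit_seq j) i)
        \<longrightarrow> (\<forall>f\<in>lp p. S f = T f)) \<and>
    (\<forall>m\<ge>1. (\<lambda>j. \<Prod>s=1..m. K (j (s - 1)) (j s)) summable_on closed_tuples m) \<and>
    (\<exists>r>0. \<forall>z::complex. cmod z < r \<longrightarrow>
      summable (\<lambda>n. (-1) ^ (Suc n + 1) / of_nat (Suc n) * z ^ Suc n *
        (\<Sum>\<^sub>\<infinity>j\<in>closed_tuples (Suc n). \<Prod>s=1..Suc n. K (j (s - 1)) (j s))) \<and>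
      nuclear_det (lp p) (lp_norm p) (\<lambda>f. cscale z (T f)) =
        exp (\<Sum>n. (-1) ^ (Suc n + 1) / of_nat (Suc n) * z ^ Suc n *
          (\<Sum>\<^sub>\<infinity>j\<in>closed_tuples (Suc n). \<Prod>s=1..Suc n. K (j (s - 1)) (j s))))"
proof -
  note p = assms(1)
  have hs: "((\<lambda>j. K i j * f j) has_sum kernel_op K f i) UNIV" if "f \<in> lp p" for f i
    using assms(2) kernel_op_nuclear_row(1)[OF p _ _ that] kernel_op_nuclear_col(1)[OF p _ that] by blast
  have lin: "linear_op_on (lp p) (kernel_op K)"
    using assms(2) kernel_op_nuclear_row(2)[OF p] kernel_op_nuclear_col(2)[OF p] by blast
  have "\<exists>\<phi> y. nuclear_rep (lp p) (lp_norm p) (kernel_op K) \<phi> y"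
    using assms(2) kernel_op_nuclear_row(3)[OF p] kernel_op_nuclear_col(3)[OF p] by blast
  then obtain \<phi> y where rep: "nuclear_rep (lp p) (lp_norm p) (kernel_op K) \<phi> y" by (elim exE)
  have nuc: "nuclear_on (lp p) (lp_norm p) (kernel_op K)"
    unfolding nuclear_on_def using lin rep by blast
  \<comment> \<open>Row norms in one case, column norms in the other; the walk and trace estimates
    accept either through the same disjunction.\<close>
  obtain c :: "int \<Rightarrow> real" where c: "\<And>i. 0 \<le> c i" "summable (\<lambda>n. c (int_decode n))"
    "(\<forall>i j. cmod (K i j) \<le> c i) \<or> (\<forall>i j. cmod (K i j) \<le> c j)"
    using assms(2)
  proof
    assume K: "p \<le> 2 \<and> row_summable p K"
    show ?thesis
    proof (rule that)
      show "summable (\<lambda>n. lp_norm p (\<lambda>m. K (int_decode n) m))"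
        using K unfolding row_summable_def by (intro summable_int_decode) blast
      have "K i \<in> lp p" for i using K unfolding row_summable_def by simp
      then show "(\<forall>i j. cmod (K i j) \<le> lp_norm p (\<lambda>m. K i m)) \<or> (\<forall>i j. cmod (K i j) \<le> lp_norm p (\<lambda>m. K j m))"
        by (intro disjI1 allI norm_le_lp_norm[OF p])
    qed simp
  next
    assume K: "col_summable p K"
    show ?thesis
    proof (rule that)
      show "summable (\<lambda>n. lp_norm p (\<lambda>m. K m (int_decode n)))"
        using K unfolding col_summable_def row_summable_def by (intro summable_int_decode) blast
      have KV: "(\<lambda>m. K m j) \<in> lp p" for j using K unfolding col_summable_def row_summable_def by simp
      show "(\<forall>i j. cmod (K i j) \<le> lp_norm p (\<lambda>m. K m i)) \<or> (\<forall>i j. cmod (K i j) \<le> lp_norm p (\<lambda>m. K m j))"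
        by (intro disjI2 allI norm_le_lp_norm[OF p KV])
    qed simp
  qed
  define B C where "B = (\<Sum>n. lp_dnorm p (\<phi> n) * lp_norm p (y n))" and "C = (\<Sum>n. c (int_decode n))"
  have B: "0 \<le> B"
    unfolding B_def by (rule suminf_nonneg[OF nuclear_repD(3)[OF p rep]])
      (rule weight_nonneg[OF p nuclear_repD(1)[OF p rep]])
  have C: "0 \<le> C" unfolding C_def by (rule suminf_nonneg[OF c(2) c(1)])
  \<comment> \<open>One radius for both demands: \<open>B\<close> is the weight of the
    representation, to be scaled below 1/2, and \<open>C\<close> the total of \<open>c\<close>, to
    be scaled below 1. The summand 1 keeps the denominator positive when both vanish.\<close>
  define r where "r = 1 / (2 * (B + C + 1))"
  have r: "0 < r" using B C by (simp add: r_def)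
  have small: "cmod z * B \<le> 1 / 2" "cmod z * C < 1" if "cmod z < r" for z
  proof -
    have "cmod z * (2 * (B + C + 1)) < 1" using that B C by (simp add: r_def field_simps)
    then have "2 * (cmod z * B) + 2 * (cmod z * C) + 2 * cmod z < 1" by (simp add: algebra_simps)
    moreover have "0 \<le> cmod z * B" "0 \<le> cmod z * C" using B C by simp_all
    ultimately show "cmod z * B \<le> 1 / 2" "cmod z * C < 1" using norm_ge_zero[of z] by linarith+
  qed
  note walk = closed_walk_sum_def[symmetric]
  show ?thesis
    unfolding walk
  proof (intro exI[of _ "kernel_op K"] conjI allI ballI impI)
    show "nuclear_on (lp p) (lp_norm p) (kernel_op K)" by (rule nuc)
    show "K i j = kernel_op K (unit_seq j) i" for i j by (simp only: kernel_op_unit_seq)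
    show "((\<lambda>j. K i j * f j) has_sum kernel_op K f i) UNIV" if "f \<in> lp p" for f i by (rule hs[OF that])
    show "S f = kernel_op K f"
      if "nuclear_on (lp p) (lp_norm p) S \<and> (\<forall>i j. K i j = S (unit_seq j) i)" "f \<in> lp p" for S f
    proof (rule nuclear_on_eqI[OF p _ nuc _ that(2)])
      show "S (unit_seq j) = kernel_op K (unit_seq j)" for j
        using that(1) by (simp add: fun_eq_iff kernel_op_unit_seq)
    qed (use that in blast)
    show "(\<lambda>j. \<Prod>s=1..m. K (j (s - 1)) (j s)) summable_on closed_tuples m" if "1 \<le> m" for m
      using closed_walk_has_sum(1)[OF c that] by (rule has_sum_imp_summable)
    show "\<exists>r>0. \<forall>z. cmod z < r \<longrightarrow>
      summable (\<lambda>n. (-1) ^ (Suc n + 1) / of_nat (Suc n) * z ^ Suc n * closed_walk_sum K (Suc n)) \<and>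
      nuclear_det (lp p) (lp_norm p) (\<lambda>f. cscale z (kernel_op K f)) =
        exp (\<Sum>n. (-1) ^ (Suc n + 1) / of_nat (Suc n) * z ^ Suc n * closed_walk_sum K (Suc n))"
    proof (intro exI[of _ r] conjI allI impI r)
      fix z assume z: "cmod z < r"
      note det = section_det_kernel_tendsto[OF c small(2)[OF z, unfolded C_def]]
      show "summable (\<lambda>n. (-1) ^ (Suc n + 1) / of_nat (Suc n) * z ^ Suc n * closed_walk_sum K (Suc n))"
        by (rule det(1))
      show "nuclear_det (lp p) (lp_norm p) (\<lambda>f. cscale z (kernel_op K f)) =
        exp (\<Sum>n. (-1) ^ (Suc n + 1) / of_nat (Suc n) * z ^ Suc n * closed_walk_sum K (Suc n))"
        by (rule nuclear_det_eqI[OF p lin rep small(1)[OF z, unfolded B_def] det(2)])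
    qed
  qed
qed

end
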